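(* Fix $b>0$ satisfying $b^2<\tfrac12W(2/e)$. If $m=m(n)=(1+o(1))\frac b2n^{3/2}$ as $n\to\infty$, then $$\lim_{n\to\infty}\frac1{n^{3/2}}\log\mathbb P_m(X=0)=-\frac{b^3}6 .$$ In other words, $$T(n,m)=\binom{\binom n2}{m}\exp\left(-\frac43\left(\frac mn\right)^3+o(n^{3/2})\right).$$
   Context: $\mathbb P_m$ is probability for the random graph $G(n,m)$, a uniformly random graph on $n$ labeled vertices with exactly $m$ edges; $X$ is its number of triangles. $T(n,m)$ is the number of triangle-free (labeled) graphs on $n$ vertices with $m$ edges. $W$ is the Lambert-W function, the inverse of $x\mapsto xe^x$ on the nonnegative reals. *)

theory Defs
  imports "HOL-Probability.Probability" "HOL-Library.Ramsey" "HOL-Library.Landau_Symbols"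
begin

text \<open>
  A simple graph on the vertex set \<open>{..<n}\<close> is represented by its edge set, a subset of
  \<open>[{..<n}]\<^bsup>2\<^esup>\<close> (the two-element subsets of \<open>{..<n}\<close>).
\<close>

definition graphs :: "nat \<Rightarrow> nat \<Rightarrow> nat set set set" where
  "graphs n m = {E. E \<subseteq> [{..<n}]\<^bsup>2\<^esup> \<and> card E = m}"

definition triangles :: "nat \<Rightarrow> nat set set \<Rightarrow> nat set set" where
  "triangles n E = {S \<in> [{..<n}]\<^bsup>3\<^esup>. [S]\<^bsup>2\<^esup> \<subseteq> E}"

definition num_triangles :: "nat \<Rightarrow> nat set set \<Rightarrow> nat" where
  "num_triangles n E = card (triangles n E)"

definition num_triangle_free :: "nat \<Rightarrow> nat \<Rightarrow> nat" where
  "num_triangle_free n m = card {E \<in> graphs n m. triangles n E = {}}"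

text \<open>
  The random graph \<open>G(n,m)\<close>. It is meaningful only for \<open>m \<le> n choose 2\<close>; otherwise
  \<open>graphs n m\<close> is empty and \<open>pmf_of_set\<close> is unspecified.
\<close>

definition Gnm :: "nat \<Rightarrow> nat \<Rightarrow> nat set set pmf" where
  "Gnm n m = pmf_of_set (graphs n m)"

text \<open>Meaningful for nonnegative arguments only.\<close>

definition Lambert_W :: "real \<Rightarrow> real" where
  "Lambert_W = the_inv_into {0..} (\<lambda>x. x * exp x)"

end

theory Submission
  imports Defs "HOL-Real_Asymp.Real_Asymp"
begin

text \<open>
  Weight every triangle-free graph with \<open>j\<close> edges by \<open>t\<^sup>j\<close>, where \<open>t = c / sqrt n\<close> and
  \<open>c = \<beta> * exp (\<beta>\<^sup>2)\<close>. Given the graph on the other vertices, the neighbourhood of a vertex is then a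
  hard-core random independent set of that graph. If all degrees lie in \<open>[a, A]\<close> on the scale \<open>sqrt n\<close>
  and codegrees are negligible, the recursion for occupation probabilities of the hard-core model shows
  that the new degrees lie in \<open>[c * exp (- A\<^sup>2), c * exp (- a\<^sup>2)]\<close>. For \<open>2 * c\<^sup>2 < 1\<close>, which the hypothesis on
  \<open>b\<close> guarantees for \<open>\<beta>\<close> near \<open>b\<close>, this map contracts to \<open>\<beta>\<close>, so the mean number of edges is
  asymptotically \<open>\<beta> / 2 * n powr (3/2)\<close>. Integrating this gives
  \<open>(\<beta> / 2 + \<beta>\<^sup>3 / 3) * n powr (3/2)\<close> for the logarithm of the partition function. The edge
  count is concentrated and the probability that \<open>G(n,m)\<close> is triangle-free decreases in \<open>m\<close>, so the
  probability for a single \<open>m\<close> can be read off from the partition function.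
\<close>

subsection \<open>Partition functions and exponential tilting\<close>

text \<open>Degrees and occupation probabilities obey one recursion because a degree is a sum of
  about n occupation probabilities of order n^(-1/2): an interval for the latter is, conditionally,
  an interval for the former. No variance is estimated. Means are controlled on a whole window of
  fugacities, and tilting the weights turns this into exponential tails. The contraction factor is
  the bound 2c^2 for the slope of x -> c exp(-x^2) on [0, c]. Along t = x exp(x^2) / sqrt n one has
  d(ln t) = (1/x + 2x) dx, so the mean x/2 gives the integrand 1/2 + x^2. On the scale n^(3/2), the
  logarithm of binom(n choose 2, m) t^m is (b/2)(b^2 + 1), and b/2 + b^3/3 minus this is -b^3/6. The
  transfer has an obstacle: without the triangle condition, weights t^j favour about (c/2) n^(3/2)
  edges, more than the (\<beta>/2) n^(3/2) of typical triangle-free graphs. Monotonicity of the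
  density alone therefore loses; the edge count must be cut from above and the fugacity lowered to
  match.\<close>

definition part_fun :: "'a set set \<Rightarrow> real \<Rightarrow> real" where
  "part_fun F t = (\<Sum>S\<in>F. t ^ card S)"

definition mean_card :: "'a set set \<Rightarrow> real \<Rightarrow> real" where
  "mean_card F t = (\<Sum>S\<in>F. t ^ card S * real (card S)) / part_fun F t"

lemma part_fun_pos:
  assumes "finite F" "{} \<in> F" "t \<ge> 0"
  shows "part_fun F t \<ge> 1"
  unfolding part_fun_def using member_le_sum[of "{}" F "\<lambda>S. t ^ card S"] assms by simp

text \<open>
  Jensen's inequality for the Gibbs measure at fugacity \<open>s * t\<close>; no sign condition on \<open>ln s\<close> is
  needed, so \<open>part_fun_tail_le\<close> covers the upper tail (\<open>s > 1\<close>) and the lower tail (\<open>s < 1\<close>) at once.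
\<close>

lemma part_fun_scale_le:
  assumes "finite F" "{} \<in> F" "s > 0" "t > 0"
  shows "part_fun F (s * t) \<le> part_fun F t * exp (ln s * mean_card F (s * t))"
proof -
  let ?m = "mean_card F (s * t)"
  have Zpos: "part_fun F (s * t) > 0"
    using part_fun_pos[of F "s * t"] assms by simp
  have m: "(\<Sum>S\<in>F. (s * t) ^ card S * real (card S)) = ?m * part_fun F (s * t)"
    using Zpos by (simp add: mean_card_def)
  \<comment> \<open>The subtracted term has mean zero under the Gibbs measure at
    \<open>s * t\<close>, so the tangent line \<open>1 - ln s * (card S - ?m)\<close> sums to
    \<open>part_fun F (s * t)\<close>; bounding it by the exponential is Jensen.\<close>
  have "(\<Sum>S\<in>F. (s * t) ^ card S * (1 - ln s * (real (card S) - ?m)))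
      = (\<Sum>S\<in>F. (1 + ln s * ?m) * (s * t) ^ card S - ln s * ((s * t) ^ card S * real (card S)))"
    by (intro sum.cong refl) (simp add: algebra_simps)
  also have "\<dots> = (1 + ln s * ?m) * part_fun F (s * t) - ln s * (?m * part_fun F (s * t))"
    unfolding sum_subtractf sum_distrib_left[symmetric] m part_fun_def ..
  finally have "part_fun F (s * t) = (\<Sum>S\<in>F. (s * t) ^ card S * (1 - ln s * (real (card S) - ?m)))"
    by (simp add: algebra_simps)
  also have "\<dots> \<le> (\<Sum>S\<in>F. (s * t) ^ card S * exp (- ln s * (real (card S) - ?m)))"
    using assms exp_ge_add_one_self[of "- ln s * (real (card S) - ?m)" for S]
    by (intro sum_mono mult_left_mono) auto
  also have "\<dots> = (\<Sum>S\<in>F. t ^ card S * exp (ln s * ?m))"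
  proof (intro sum.cong refl)
    fix S
    have "s ^ card S = exp (ln s * real (card S))"
      using \<open>s > 0\<close> by (simp add: powr_realpow[symmetric] powr_def mult.commute)
    then show "(s * t) ^ card S * exp (- ln s * (real (card S) - ?m)) = t ^ card S * exp (ln s * ?m)"
      by (simp add: power_mult_distrib exp_add[symmetric] algebra_simps flip: exp_add)
  qed
  also have "\<dots> = part_fun F t * exp (ln s * ?m)"
    by (simp add: part_fun_def sum_distrib_right)
  finally show ?thesis .
qed

lemma part_fun_tail_le:
  assumes "finite F" "{} \<in> F" "s > 0" "t > 0"
  shows "(\<Sum>S\<in>{S\<in>F. ln s * (real (card S) - x) \<ge> 0}. t ^ card S)
           \<le> part_fun F t * exp (ln s * (mean_card F (s * t) - x))"
proof -
  have eq: "t ^ k * exp (ln s * (real k - x)) = (s * t) ^ k * exp (- ln s * x)" for k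
  proof -
    have "s ^ k = exp (ln s * real k)"
      using \<open>s > 0\<close> by (simp add: powr_realpow[symmetric] powr_def mult.commute)
    then show ?thesis
      by (simp add: power_mult_distrib algebra_simps flip: exp_add)
  qed
  have "(\<Sum>S\<in>{S\<in>F. ln s * (real (card S) - x) \<ge> 0}. t ^ card S)
      \<le> (\<Sum>S\<in>{S\<in>F. ln s * (real (card S) - x) \<ge> 0}. t ^ card S * exp (ln s * (real (card S) - x)))"
    using assms by (intro sum_mono) (auto simp: mult_le_cancel_left1)
  also have "\<dots> \<le> (\<Sum>S\<in>F. t ^ card S * exp (ln s * (real (card S) - x)))"
    using assms by (intro sum_mono2) auto
  also have "\<dots> = part_fun F (s * t) * exp (- ln s * x)"
    by (simp add: eq part_fun_def sum_distrib_right)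
  \<comment> \<open>The mean enters at the tilted fugacity \<open>s * t\<close>, not at
    \<open>t\<close>. Bounds on means at nearby fugacities are therefore all that exponential tails
    require.\<close>
  also have "\<dots> \<le> (part_fun F t * exp (ln s * mean_card F (s * t))) * exp (- ln s * x)"
    by (intro mult_right_mono part_fun_scale_le assms) auto
  also have "\<dots> = part_fun F t * exp (ln s * (mean_card F (s * t) - x))"
    by (simp add: algebra_simps flip: exp_add)
  finally show ?thesis .
qed

subsection \<open>The hard-core model on a graph\<close>

definition nbhd :: "'a set set \<Rightarrow> 'a \<Rightarrow> 'a set" where
  "nbhd E v = {w. {v, w} \<in> E}"

text \<open>The case \<open>x = y\<close> is included, so a loop \<open>{x} \<in> E\<close> would
  exclude \<open>x\<close>; hence the hypotheses \<open>{w} \<notin> E\<close> below.\<close>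

definition independent_sets :: "'a set set \<Rightarrow> 'a set \<Rightarrow> 'a set set" where
  "independent_sets E U = {S. S \<subseteq> U \<and> (\<forall>x\<in>S. \<forall>y\<in>S. {x, y} \<notin> E)}"

text \<open>The independence polynomial of the graph that \<open>E\<close> induces on
  \<open>U\<close>. \<open>E\<close> stays fixed while \<open>U\<close> shrinks, so deleting
  vertices changes only one argument.\<close>

definition hardcore :: "'a set set \<Rightarrow> 'a set \<Rightarrow> real \<Rightarrow> real" where
  "hardcore E U t = part_fun (independent_sets E U) t"

text \<open>
  The probability that \<open>w\<close> is occupied in the hard-core model on \<open>U\<close>, for \<open>w \<in> U\<close> and \<open>{w} \<notin> E\<close>.
\<close>

definition occupation :: "'a set set \<Rightarrow> 'a set \<Rightarrow> real \<Rightarrow> 'a \<Rightarrow> real" where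
  "occupation E U t w = t * hardcore E (U - {w} - nbhd E w) t / hardcore E U t"

lemma finite_independent_sets [simp]: "finite U \<Longrightarrow> finite (independent_sets E U)"
  unfolding independent_sets_def by (rule finite_subset[of _ "Pow U"]) auto

lemma empty_in_independent_sets [simp]: "{} \<in> independent_sets E U"
  by (simp add: independent_sets_def)

lemma hardcore_ge_1: "finite U \<Longrightarrow> t \<ge> 0 \<Longrightarrow> hardcore E U t \<ge> 1"
  unfolding hardcore_def by (rule part_fun_pos) auto

lemma sum_independent_sets_containing:
  fixes t :: real
  assumes "finite U" "w \<in> U" "{w} \<notin> E"
  shows "(\<Sum>S\<in>{S\<in>independent_sets E U. w \<in> S}. t ^ card S) = t * hardcore E (U - {w} - nbhd E w) t"
proof -
  have "(\<Sum>S\<in>{S\<in>independent_sets E U. w \<in> S}. t ^ card S)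
      = (\<Sum>S\<in>independent_sets E (U - {w} - nbhd E w). t ^ card (insert w S))"
  proof (rule sum.reindex_bij_witness[of _ "insert w" "\<lambda>S. S - {w}"])
    fix S assume "S \<in> {S\<in>independent_sets E U. w \<in> S}"
    then show "S - {w} \<in> independent_sets E (U - {w} - nbhd E w)" "insert w (S - {w}) = S"
       "t ^ card (insert w (S - {w})) = t ^ card S"
      by (auto simp: independent_sets_def nbhd_def insert_absorb)
  next
    fix S assume S: "S \<in> independent_sets E (U - {w} - nbhd E w)"
    have "{x, w} \<notin> E" if "x \<in> S" for x
      using S that by (auto simp: independent_sets_def nbhd_def insert_commute)
    then show "insert w S \<in> {S\<in>independent_sets E U. w \<in> S}"
      using S assms by (auto simp: independent_sets_def nbhd_def)
    show "insert w S - {w} = S"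
      using S by (auto simp: independent_sets_def)
  qed
  also have "\<dots> = (\<Sum>S\<in>independent_sets E (U - {w} - nbhd E w). t * t ^ card S)"
  proof (intro sum.cong refl)
    fix S assume "S \<in> independent_sets E (U - {w} - nbhd E w)"
    then have "finite S" "w \<notin> S"
      using assms(1) by (auto simp: independent_sets_def dest: finite_subset)
    then show "t ^ card (insert w S) = t * t ^ card S" by simp
  qed
  finally show ?thesis by (simp add: hardcore_def part_fun_def sum_distrib_left)
qed

lemma hardcore_rec:
  assumes "finite U" "w \<in> U" "{w} \<notin> E"
  shows "hardcore E U t = hardcore E (U - {w}) t + t * hardcore E (U - {w} - nbhd E w) t"
proof -
  have "hardcore E U t = (\<Sum>S\<in>{S\<in>independent_sets E U. w \<notin> S} \<union> {S\<in>independent_sets E U. w \<in> S}. t ^ card S)"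
    unfolding hardcore_def part_fun_def by (rule sum.cong) auto
  also have "\<dots> = (\<Sum>S\<in>{S\<in>independent_sets E U. w \<notin> S}. t ^ card S) + (\<Sum>S\<in>{S\<in>independent_sets E U. w \<in> S}. t ^ card S)"
    by (rule sum.union_disjoint) (use assms in auto)
  also have "{S\<in>independent_sets E U. w \<notin> S} = independent_sets E (U - {w})"
    by (auto simp: independent_sets_def)
  finally show ?thesis
    by (simp add: sum_independent_sets_containing[OF assms]) (simp add: hardcore_def part_fun_def)
qed

lemma hardcore_mono:
  assumes "finite U" "V \<subseteq> U" "t \<ge> 0"
  shows "hardcore E V t \<le> hardcore E U t"
  unfolding hardcore_def part_fun_def
  using assms by (intro sum_mono2) (auto simp: independent_sets_def)

lemma mean_card_independent_sets:
  assumes "finite U" "\<And>w. w \<in> U \<Longrightarrow> {w} \<notin> E"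
  shows "mean_card (independent_sets E U) t = (\<Sum>w\<in>U. occupation E U t w)"
proof -
  have "(\<Sum>S\<in>independent_sets E U. t ^ card S * real (card S))
      = (\<Sum>S\<in>independent_sets E U. \<Sum>w\<in>U. if w \<in> S then t ^ card S else 0)"
  proof (intro sum.cong refl)
    fix S assume "S \<in> independent_sets E U"
    then have "U \<inter> S = S" by (auto simp: independent_sets_def)
    then show "t ^ card S * real (card S) = (\<Sum>w\<in>U. if w \<in> S then t ^ card S else 0)"
      using assms(1) by (simp add: sum.If_cases Collect_mem_eq)
  qed
  also have "\<dots> = (\<Sum>w\<in>U. \<Sum>S\<in>independent_sets E U. if w \<in> S then t ^ card S else 0)"
    by (rule sum.swap)
  also have "\<dots> = (\<Sum>w\<in>U. t * hardcore E (U - {w} - nbhd E w) t)"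
    using assms by (intro sum.cong refl) (simp add: sum.inter_filter[symmetric] sum_independent_sets_containing)
  finally show ?thesis
    by (simp add: mean_card_def hardcore_def[symmetric] occupation_def sum_divide_distrib)
qed

lemma hardcore_remove:
  assumes "finite U" "w \<in> U" "{w} \<notin> E" "t \<ge> 0"
  shows "hardcore E (U - {w}) t = (1 - occupation E U t w) * hardcore E U t"
  using hardcore_rec[OF assms(1-3), of t] hardcore_ge_1[OF assms(1,4), of E]
  by (simp add: occupation_def field_simps)

lemma occupation_nonneg: "finite U \<Longrightarrow> t \<ge> 0 \<Longrightarrow> occupation E U t w \<ge> 0"
  unfolding occupation_def using hardcore_ge_1[of U t E] hardcore_ge_1[of "U - {w} - nbhd E w" t E]
  by (intro divide_nonneg_nonneg mult_nonneg_nonneg) auto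

text \<open>Let \<open>R\<close> be the ratio on the right, the probability that all neighbours of
  \<open>w\<close> are vacant in the model on \<open>U - {w}\<close>. The recursion gives exactly
  \<open>t * R / (1 + t * R)\<close>. Here the denominator is dropped; \<open>occupation_ge\<close>
  replaces it by \<open>1 + t\<close>, which is harmless for \<open>t\<close> of order
  n^(-1/2).\<close>

lemma occupation_le:
  assumes "finite U" "w \<in> U" "{w} \<notin> E" "t \<ge> 0"
  shows "occupation E U t w \<le> t * (hardcore E (U - {w} - nbhd E w) t / hardcore E (U - {w}) t)"
proof -
  have "hardcore E (U - {w} - nbhd E w) t / hardcore E U t \<le> hardcore E (U - {w} - nbhd E w) t / hardcore E (U - {w}) t"
    using hardcore_mono[of U "U - {w}" t E] hardcore_ge_1[of "U - {w}" t E]  hardcore_ge_1[of "U - {w} - nbhd E w" t E] assms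
    by (intro divide_left_mono mult_pos_pos) auto
  from mult_left_mono[OF this \<open>t \<ge> 0\<close>] show ?thesis
    by (simp add: occupation_def)
qed

lemma occupation_ge:
  assumes "finite U" "w \<in> U" "{w} \<notin> E" "t \<ge> 0"
  shows "occupation E U t w \<ge> t / (1 + t) * (hardcore E (U - {w} - nbhd E w) t / hardcore E (U - {w}) t)"
proof -
  have pos: "hardcore E (U - {w}) t > 0"
    using hardcore_ge_1[of "U - {w}" t E] assms by simp
  have "hardcore E (U - {w} - nbhd E w) t \<le> hardcore E (U - {w}) t"
    using assms by (intro hardcore_mono) auto
  then have "hardcore E U t \<le> (1 + t) * hardcore E (U - {w}) t"
    using hardcore_rec[OF assms(1-3), of t] assms(4) by (simp add: algebra_simps mult_left_mono)
  then have "hardcore E (U - {w} - nbhd E w) t / ((1 + t) * hardcore E (U - {w}) t) \<le> hardcore E (U - {w} - nbhd E w) t / hardcore E U t"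
    using pos hardcore_ge_1[of U t E]  hardcore_ge_1[of "U - {w} - nbhd E w" t E] assms
    by (intro divide_left_mono mult_pos_pos) auto
  from mult_left_mono[OF this \<open>t \<ge> 0\<close>] show ?thesis
    by (simp add: occupation_def)
qed

lemma occupation_le_fugacity:
  assumes "finite U" "w \<in> U" "{w} \<notin> E" "t \<ge> 0"
  shows "occupation E U t w \<le> t"
proof -
  have "hardcore E (U - {w} - nbhd E w) t / hardcore E (U - {w}) t \<le> 1"
    using hardcore_mono[of "U - {w}" "U - {w} - nbhd E w" t E] hardcore_ge_1[of "U - {w}" t E] assms by auto
  from mult_left_mono[OF this \<open>t \<ge> 0\<close>] occupation_le[OF assms] show ?thesis by simp
qed

text \<open>The vertices of \<open>X\<close> are deleted one at a time, and each deletion multiplies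
  the partition function by a vacancy probability. The hypothesis covers every intermediate set
  \<open>U - Y\<close>, since deleting vertices can move occupation probabilities in either
  direction.\<close>

lemma hardcore_diff_ge:
  assumes "finite U" "X \<subseteq> U" "\<And>x. x \<in> U \<Longrightarrow> {x} \<notin> E" "t \<ge> 0" "q \<le> 1"
    and "\<And>x Y. Y \<subseteq> X \<Longrightarrow> x \<in> X - Y \<Longrightarrow> occupation E (U - Y) t x \<le> q"
  shows "hardcore E (U - X) t \<ge> (1 - q) ^ card X * hardcore E U t"
proof -
  have "finite X" using assms by (auto dest: finite_subset)
  from this assms(2,6) show ?thesis
  proof (induction X)
    case empty
    then show ?case by simp
  next
    case (insert x X)
    have IH: "(1 - q) ^ card X * hardcore E U t \<le> hardcore E (U - X) t"
      using insert by (intro insert.IH) auto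
    have eq: "U - insert x X = (U - X) - {x}" by auto
    have "(1 - q) * hardcore E (U - X) t \<le> (1 - occupation E (U - X) t x) * hardcore E (U - X) t"
      using insert.prems(2)[of X x] insert.hyps hardcore_ge_1[of "U - X" t E] assms
      by (intro mult_right_mono) auto
    also have "\<dots> = hardcore E (U - insert x X) t"
      unfolding eq using insert assms by (intro hardcore_remove[symmetric]) auto
    finally have "(1 - q) * ((1 - q) ^ card X * hardcore E U t) \<le> hardcore E (U - insert x X) t"
      using mult_left_mono[OF IH, of "1 - q"] assms(5) by linarith
    then show ?case using insert.hyps by simp
  qed
qed

lemma hardcore_diff_le:
  assumes "finite U" "X \<subseteq> U" "\<And>x. x \<in> U \<Longrightarrow> {x} \<notin> E" "t \<ge> 0"
    and "\<And>x Y. Y \<subseteq> X \<Longrightarrow> x \<in> X - Y \<Longrightarrow> occupation E (U - Y) t x \<ge> q"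
  shows "hardcore E (U - X) t \<le> exp (- q * card X) * hardcore E U t"
proof -
  have "finite X" using assms by (auto dest: finite_subset)
  from this assms(2,5) show ?thesis
  proof (induction X)
    case empty
    then show ?case by simp
  next
    case (insert x X)
    have IH: "hardcore E (U - X) t \<le> exp (- q * card X) * hardcore E U t"
      using insert by (intro insert.IH) auto
    have eq: "U - insert x X = (U - X) - {x}" by auto
    have "hardcore E (U - insert x X) t = (1 - occupation E (U - X) t x) * hardcore E (U - X) t"
      unfolding eq using insert assms by (intro hardcore_remove) auto
    also have "\<dots> \<le> exp (- q) * hardcore E (U - X) t"
    proof (intro mult_right_mono)
      have "q \<le> occupation E (U - X) t x"
        using insert by (intro insert.prems(2)) auto
      then show "1 - occupation E (U - X) t x \<le> exp (- q)"
        using exp_ge_add_one_self[of "- q"] by linarith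
    qed (use hardcore_ge_1[of "U - X" t E] assms in auto)
    also have "\<dots> \<le> exp (- q) * (exp (- q * card X) * hardcore E U t)"
      using IH by (intro mult_left_mono) auto
    also have "\<dots> = exp (- q * card (insert x X)) * hardcore E U t"
      using insert.hyps by (simp add: algebra_simps flip: exp_add)
    finally show ?case .
  qed
qed

text \<open>Upper bounds on the marginals of the neighbours give a lower bound at \<open>w\<close>:
  at most \<open>d\<close> neighbours, each vacant with conditional probability at least
  \<open>1 - q\<close>, are all vacant with probability at least \<open>(1 - q)\<close> to the power
  \<open>d\<close>.\<close>

lemma occupation_ge_exp:
  assumes "finite U" "w \<in> U" "\<And>x. x \<in> U \<Longrightarrow> {x} \<notin> E" "t \<ge> 0" "0 \<le> q" "q < 1"
    and "finite (nbhd E w)" "real (card (nbhd E w)) \<le> d"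
    and occupation: "\<And>x Y. Y \<subseteq> nbhd E w \<inter> U \<Longrightarrow> x \<in> U - {w} - Y \<Longrightarrow> occupation E (U - {w} - Y) t x \<le> q"
  shows "occupation E U t w \<ge> t / (1 + t) * exp (- (q / (1 - q) * d))"
proof -
  define X where "X = nbhd E w \<inter> (U - {w})"
  have pos: "hardcore E (U - {w}) t > 0"
    using hardcore_ge_1[of "U - {w}" t E] assms by simp
  have "U - {w} - nbhd E w = (U - {w}) - X" by (auto simp: X_def)
  moreover have "hardcore E ((U - {w}) - X) t \<ge> (1 - q) ^ card X * hardcore E (U - {w}) t"
    using assms by (intro hardcore_diff_ge occupation) (auto simp: X_def)
  ultimately have r: "hardcore E (U - {w} - nbhd E w) t / hardcore E (U - {w}) t \<ge> (1 - q) ^ card X"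
    using pos by (simp add: field_simps)
  have "real (card X) \<le> real (card (nbhd E w))"
    using assms by (auto simp: X_def intro!: card_mono)
  then have cX: "real (card X) \<le> d" using assms by linarith
  \<comment> \<open>This is \<open>1 + x \<le> exp x\<close> at \<open>x = q / (1 - q)\<close>,
    where \<open>1 + x = 1 / (1 - q)\<close>; it bounds \<open>1 - q\<close> from below by an
    exponential.\<close>
  have "1 / (1 - q) \<le> exp (q / (1 - q))"
    using exp_ge_add_one_self[of "q / (1 - q)"] assms by (simp add: field_simps)
  then have "exp (- (q / (1 - q))) \<le> 1 - q"
    using assms by (simp add: exp_minus field_simps)
  then have "exp (- (q / (1 - q))) ^ card X \<le> (1 - q) ^ card X"
    by (intro power_mono) auto
  moreover have "exp (- (q / (1 - q) * d)) \<le> exp (- (q / (1 - q))) ^ card X"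
  proof -
    have "q / (1 - q) * real (card X) \<le> q / (1 - q) * d"
      using cX assms by (intro mult_left_mono) auto
    then show ?thesis by (simp flip: exp_of_nat_mult add: mult.commute)
  qed
  ultimately have "exp (- (q / (1 - q) * d)) \<le> hardcore E (U - {w} - nbhd E w) t / hardcore E (U - {w}) t"
    using r by linarith
  then have "t / (1 + t) * exp (- (q / (1 - q) * d))
      \<le> t / (1 + t) * (hardcore E (U - {w} - nbhd E w) t / hardcore E (U - {w}) t)"
    using assms by (intro mult_left_mono) auto
  also have "\<dots> \<le> occupation E U t w"
    using assms by (intro occupation_ge) auto
  finally show ?thesis .
qed

text \<open>The reverse direction. Only neighbours inside \<open>U\<close> can suppress
  \<open>w\<close>, so the degree inside \<open>U\<close> is what must be large here, whereas in
  \<open>occupation_ge_exp\<close> a bound on the full degree is enough.\<close>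

lemma occupation_le_exp:
  assumes "finite U" "w \<in> U" "\<And>x. x \<in> U \<Longrightarrow> {x} \<notin> E" "t \<ge> 0" "0 \<le> q"
    and "w \<notin> nbhd E w" "d \<le> real (card (nbhd E w \<inter> U))"
    and occupation: "\<And>x Y. Y \<subseteq> nbhd E w \<inter> U \<Longrightarrow> x \<in> U - {w} - Y \<Longrightarrow> q \<le> occupation E (U - {w} - Y) t x"
  shows "occupation E U t w \<le> t * exp (- (q * d))"
proof -
  define X where "X = nbhd E w \<inter> (U - {w})"
  have pos: "hardcore E (U - {w}) t > 0"
    using hardcore_ge_1[of "U - {w}" t E] assms by simp
  have "U - {w} - nbhd E w = (U - {w}) - X" by (auto simp: X_def)
  moreover have "hardcore E ((U - {w}) - X) t \<le> exp (- q * card X) * hardcore E (U - {w}) t"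
    using assms by (intro hardcore_diff_le occupation) (auto simp: X_def)
  ultimately have r: "hardcore E (U - {w} - nbhd E w) t / hardcore E (U - {w}) t \<le> exp (- q * card X)"
    using pos by (simp add: field_simps)
  have "nbhd E w \<inter> U = X" using assms by (auto simp: X_def)
  then have "exp (- q * card X) \<le> exp (- (q * d))"
    using assms by (simp add: mult_left_mono)
  with r have "hardcore E (U - {w} - nbhd E w) t / hardcore E (U - {w}) t \<le> exp (- (q * d))" by linarith
  then have "t * (hardcore E (U - {w} - nbhd E w) t / hardcore E (U - {w}) t) \<le> t * exp (- (q * d))"
    using assms by (intro mult_left_mono) auto
  moreover have "occupation E U t w \<le> t * (hardcore E (U - {w} - nbhd E w) t / hardcore E (U - {w}) t)"
    using assms(1-4) by (intro occupation_le) simp_all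
  ultimately show ?thesis by (rule order_trans[rotated])
qed

section \<open>Nearly regular graphs and the recursion for marginals\<close>

lemma graph_no_loop: "E \<subseteq> [A]\<^bsup>2\<^esup> \<Longrightarrow> {x} \<notin> E"
  by (auto simp: nsets_def)

lemma nbhd_subset: "E \<subseteq> [A]\<^bsup>2\<^esup> \<Longrightarrow> nbhd E x \<subseteq> A - {x}"
  by (auto simp: nsets_def nbhd_def)

lemma finite_nbhd: "E \<subseteq> [{..<n::nat}]\<^bsup>2\<^esup> \<Longrightarrow> finite (nbhd E x)"
  using finite_subset[OF nbhd_subset[of E "{..<n}" x]] by simp

lemma nbhd_sym: "x \<in> nbhd E y \<longleftrightarrow> y \<in> nbhd E x"
  by (auto simp: nbhd_def insert_commute)

text \<open>
  The degree upper bound is imposed in the whole graph but the lower bound inside \<open>U\<close>. Small codegrees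
  make the lower bound survive the deletion of part of a neighbourhood, which is what the recursion
  for occupation probabilities does to \<open>U\<close>.
\<close>

definition nearly_regular :: "nat \<Rightarrow> real \<Rightarrow> real \<Rightarrow> real \<Rightarrow> nat set set \<Rightarrow> nat set \<Rightarrow> bool" where
  "nearly_regular n a A \<delta> E U \<longleftrightarrow>
     (\<forall>x. real (card (nbhd E x)) \<le> (A + \<delta>) * sqrt n) \<and>
     (\<forall>x y. x \<noteq> y \<longrightarrow> real (card (nbhd E x \<inter> nbhd E y)) \<le> \<delta> * sqrt n) \<and>
     (\<forall>x\<in>U. (a - \<delta>) * sqrt n \<le> real (card (nbhd E x \<inter> U)))"

text \<open>A vertex \<open>x\<close> loses at most \<open>w\<close> and its common neighbours with
  \<open>w\<close>. Each of the two losses is at most \<open>\<delta> * sqrt n\<close>; with the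
  tolerance already spent this makes \<open>3 * \<delta>\<close>.\<close>

lemma nearly_regular_remove:
  assumes reg: "nearly_regular n a A \<delta> E U" and E: "E \<subseteq> [{..<n}]\<^bsup>2\<^esup>"
    and Y: "Y \<subseteq> nbhd E w" and \<delta>: "0 < \<delta>" "3 * \<delta> \<le> \<delta>'" "1 \<le> \<delta> * sqrt n"
  shows "nearly_regular n a A \<delta>' E (U - {w} - Y)"
  unfolding nearly_regular_def
proof (intro conjI allI ballI impI)
  have le: "\<delta> * sqrt n \<le> \<delta>' * sqrt n" "3 * (\<delta> * sqrt n) \<le> \<delta>' * sqrt n"
  proof -
    have "\<delta> \<le> \<delta>'" using \<delta>(1,2) by linarith
    then show "\<delta> * sqrt n \<le> \<delta>' * sqrt n" by (rule mult_right_mono) simp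
    show "3 * (\<delta> * sqrt n) \<le> \<delta>' * sqrt n"
      using mult_right_mono[OF \<delta>(2), of "sqrt n"] by (simp add: mult.assoc)
  qed
  fix x
  show "real (card (nbhd E x)) \<le> (A + \<delta>') * sqrt n"
  proof -
    have "real (card (nbhd E x)) \<le> (A + \<delta>) * sqrt n"
      using reg by (simp add: nearly_regular_def)
    also have "\<dots> \<le> (A + \<delta>') * sqrt n"
      by (rule mult_right_mono) (use \<delta>(1,2) in linarith, simp)
    finally show ?thesis .
  qed
  show "real (card (nbhd E x \<inter> nbhd E y)) \<le> \<delta>' * sqrt n" if "x \<noteq> y" for y
  proof -
    have "real (card (nbhd E x \<inter> nbhd E y)) \<le> \<delta> * sqrt n"
      using reg that by (simp add: nearly_regular_def)
    with le(1) show ?thesis by linarith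
  qed
  assume x: "x \<in> U - {w} - Y"
  have fin: "finite (nbhd E x)" by (rule finite_nbhd[OF E])
  have "card (nbhd E x \<inter> U) \<le> card ((nbhd E x \<inter> (U - {w} - Y)) \<union> ({w} \<union> (nbhd E x \<inter> nbhd E w)))"
    using Y fin by (intro card_mono) auto
  also have "\<dots> \<le> card (nbhd E x \<inter> (U - {w} - Y)) + (card {w} + card (nbhd E x \<inter> nbhd E w))"
    by (intro card_Un_le[THEN order_trans] add_left_mono card_Un_le)
  finally have "real (card (nbhd E x \<inter> U))
      \<le> real (card (nbhd E x \<inter> (U - {w} - Y))) + 1 + real (card (nbhd E x \<inter> nbhd E w))"
    by simp
  moreover have "(a - \<delta>) * sqrt n \<le> real (card (nbhd E x \<inter> U))"
    "real (card (nbhd E x \<inter> nbhd E w)) \<le> \<delta> * sqrt n"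
    using reg x by (auto simp: nearly_regular_def)
  ultimately show "(a - \<delta>') * sqrt n \<le> real (card (nbhd E x \<inter> (U - {w} - Y)))"
    using le \<delta>(3) left_diff_distrib[of a \<delta> "sqrt n"] left_diff_distrib[of a \<delta>' "sqrt n"]
    by linarith
qed

text \<open>Uniform over all vertex sets \<open>U\<close> that are still nearly regular, because the
  recursion shrinks \<open>U\<close>, and over a window of fugacities, because the tail bounds
  evaluate means at \<open>s * t\<close> with \<open>s\<close> near 1.\<close>

definition marginals_within :: "real \<Rightarrow> real \<Rightarrow> real \<Rightarrow> real \<Rightarrow> real \<Rightarrow> real \<Rightarrow> nat \<Rightarrow> bool" where
  "marginals_within c a0 A0 \<delta> l u n \<longleftrightarrow>
     (\<forall>t E U w. t > 0 \<longrightarrow> \<bar>sqrt n * t - c\<bar> \<le> \<delta> \<longrightarrow> E \<subseteq> [{..<n}]\<^bsup>2\<^esup> \<longrightarrow> U \<subseteq> {..<n} \<longrightarrow> w \<in> U \<longrightarrow>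
        nearly_regular n a0 A0 \<delta> E U \<longrightarrow> sqrt n * occupation E U t w \<in> {l..u})"

lemma marginals_withinI:
  assumes "\<And>t E U w. t > 0 \<Longrightarrow> \<bar>sqrt n * t - c\<bar> \<le> \<delta> \<Longrightarrow> E \<subseteq> [{..<n}]\<^bsup>2\<^esup> \<Longrightarrow> U \<subseteq> {..<n} \<Longrightarrow> w \<in> U \<Longrightarrow>
    nearly_regular n a0 A0 \<delta> E U \<Longrightarrow> l \<le> sqrt n * occupation E U t w \<and> sqrt n * occupation E U t w \<le> u"
  shows "marginals_within c a0 A0 \<delta> l u n"
  unfolding marginals_within_def atLeastAtMost_iff using assms by blast

lemma marginals_withinD:
  assumes "marginals_within c a0 A0 \<delta> l u n" "t > 0" "\<bar>sqrt n * t - c\<bar> \<le> \<delta>" "E \<subseteq> [{..<n}]\<^bsup>2\<^esup>"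
    "U \<subseteq> {..<n}" "w \<in> U" "nearly_regular n a0 A0 \<delta> E U"
  shows "l \<le> sqrt n * occupation E U t w" "sqrt n * occupation E U t w \<le> u"
  using assms unfolding marginals_within_def atLeastAtMost_iff by blast+

definition marginal_bounds :: "real \<Rightarrow> real \<Rightarrow> real \<Rightarrow> real \<Rightarrow> real \<Rightarrow> bool" where
  "marginal_bounds c a0 A0 a A \<longleftrightarrow>
     (\<forall>\<epsilon>>0. \<exists>\<delta>>0. \<forall>\<^sub>F n in sequentially. marginals_within c a0 A0 \<delta> (a - \<epsilon>) (A + \<epsilon>) n)"

lemma nearly_regular_mono:
  assumes "nearly_regular n a' A' \<delta>' E U" "a - \<delta> \<le> a' - \<delta>'" "A' + \<delta>' \<le> A + \<delta>" "\<delta>' \<le> \<delta>"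
  shows "nearly_regular n a A \<delta> E U"
proof -
  have le: "(A' + \<delta>') * sqrt n \<le> (A + \<delta>) * sqrt n" "(a - \<delta>) * sqrt n \<le> (a' - \<delta>') * sqrt n"
       "\<delta>' * sqrt n \<le> \<delta> * sqrt n"
    by (rule mult_right_mono; use assms(2-4) in simp)+
  show ?thesis
    unfolding nearly_regular_def
  proof (intro conjI allI ballI impI)
    fix x
    have "real (card (nbhd E x)) \<le> (A' + \<delta>') * sqrt n"
      using assms(1) by (simp add: nearly_regular_def)
    then show "real (card (nbhd E x)) \<le> (A + \<delta>) * sqrt n"
      using le(1) by (rule order_trans)
    show "real (card (nbhd E x \<inter> nbhd E y)) \<le> \<delta> * sqrt n" if "x \<noteq> y" for y
    proof -
      have "real (card (nbhd E x \<inter> nbhd E y)) \<le> \<delta>' * sqrt n"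
        using assms(1) that by (simp add: nearly_regular_def)
      then show ?thesis using le(3) by (rule order_trans)
    qed
    assume "x \<in> U"
    then have "(a' - \<delta>') * sqrt n \<le> real (card (nbhd E x \<inter> U))"
      using assms(1) by (simp add: nearly_regular_def)
    with le(2) show "(a - \<delta>) * sqrt n \<le> real (card (nbhd E x \<inter> U))"
      by (rule order_trans)
  qed
qed

lemma marginal_bounds_mono:
  assumes "marginal_bounds c a0 A0 a A" "a0 \<le> a1" "A1 \<le> A0"
  shows "marginal_bounds c a1 A1 a A"
proof -
  have nr: "nearly_regular n a1 A1 \<delta> E U \<Longrightarrow> nearly_regular n a0 A0 \<delta> E U" for n E U \<delta>
    by (erule nearly_regular_mono) (use assms in auto)
  have "marginals_within c a1 A1 \<delta> l u n" if *: "marginals_within c a0 A0 \<delta> l u n" for \<delta> l u n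
    by (rule marginals_withinI) (intro conjI marginals_withinD[OF *] nr; assumption)
  then show ?thesis
    using assms(1) unfolding marginal_bounds_def by (meson eventually_mono)
qed

lemma marginal_bounds_trivial: "marginal_bounds c a0 A0 0 c"
proof -
  have "marginals_within c a0 A0 \<epsilon> (0 - \<epsilon>) (c + \<epsilon>) n" if "\<epsilon> > 0" for \<epsilon> n
  proof (rule marginals_withinI)
    fix t E U w
    assume *: "t > 0" "\<bar>sqrt n * t - c\<bar> \<le> \<epsilon>" "E \<subseteq> [{..<n}]\<^bsup>2\<^esup>" "U \<subseteq> {..<n}" "w \<in> U"
    have fin: "finite U" using *(4) by (rule finite_subset) simp
    have "0 \<le> occupation E U t w" using *(1) fin by (intro occupation_nonneg) simp_all
    then have "0 \<le> sqrt n * occupation E U t w" by simp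
    moreover have "sqrt n * occupation E U t w \<le> sqrt n * t"
      using *(1,5) fin graph_no_loop[OF *(3)] by (intro mult_left_mono occupation_le_fugacity) simp_all
    ultimately show "0 - \<epsilon> \<le> sqrt n * occupation E U t w \<and> sqrt n * occupation E U t w \<le> c + \<epsilon>"
      using *(2) that by linarith
  qed
  then show ?thesis unfolding marginal_bounds_def by (meson always_eventually)
qed

text \<open>One turn of the approximate identity that an occupation probability is \<open>t\<close>
  times the exponential of minus the sum of those of the neighbours. On the scale
  \<open>sqrt n\<close> that sum lies in \<open>[a0 * a, A0 * A]\<close>. The exponential is
  decreasing, so the upper data produce the new lower end.\<close>

lemma marginal_bounds_step:
  assumes mb: "marginal_bounds c a0 A0 a A"
    and nonneg: "c > 0" "a0 \<ge> 0" "A0 \<ge> 0" "a \<ge> 0" "A \<ge> 0"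
  shows "marginal_bounds c a0 A0 (c * exp (- (A0 * A))) (c * exp (- (a0 * a)))"
  unfolding marginal_bounds_def
proof (intro allI impI)
  fix \<epsilon> :: real assume \<epsilon>: "\<epsilon> > 0"
  \<comment> \<open>\<open>L\<close> and \<open>R\<close> are what the estimates below yield when
    every error, including \<open>1 / sqrt n\<close>, is at most \<open>\<eta>\<close>; they tend to
    the claimed ends. The truncations \<open>max 0\<close> keep both factors of the exponent
    nonnegative when \<open>a\<close> or \<open>a0\<close> is 0.\<close>
  define L where "L = (\<lambda>\<eta>. (c - \<eta>) / (1 + (c + \<eta>) * \<eta>) * exp (- ((A + \<eta>) * (A0 + \<eta>) / (1 - (A + \<eta>) * \<eta>))))"
  define R where "R = (\<lambda>\<eta>. (c + \<eta>) * exp (- (max 0 (a - \<eta>) * max 0 (a0 - \<eta>))))"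
  have "(L \<longlongrightarrow> (c - 0) / (1 + (c + 0) * 0) * exp (- ((A + 0) * (A0 + 0) / (1 - (A + 0) * 0)))) (at_right 0)"
    unfolding L_def by (intro tendsto_intros) auto
  then have "(L \<longlongrightarrow> c * exp (- (A0 * A))) (at_right 0)" by (simp add: mult.commute)
  then have 1: "eventually (\<lambda>\<eta>. L \<eta> > c * exp (- (A0 * A)) - \<epsilon>) (at_right 0)"
    by (rule order_tendstoD) (use \<epsilon> in auto)
  have "(R \<longlongrightarrow> (c + 0) * exp (- (max 0 (a - 0) * max 0 (a0 - 0)))) (at_right 0)"
    unfolding R_def by (intro tendsto_intros)
  then have "(R \<longlongrightarrow> c * exp (- (a0 * a))) (at_right 0)" using nonneg by (simp add: mult.commute)
  then have 2: "eventually (\<lambda>\<eta>. R \<eta> < c * exp (- (a0 * a)) + \<epsilon>) (at_right 0)"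
    by (rule order_tendstoD) (use \<epsilon> in auto)
  have "((\<lambda>\<eta>. (A + \<eta>) * \<eta>) \<longlongrightarrow> (A + 0) * 0) (at_right 0)"
    by (intro tendsto_intros)
  then have 3: "eventually (\<lambda>\<eta>. (A + \<eta>) * \<eta> < 1) (at_right 0)"
    by (rule order_tendstoD) auto
  have 4: "eventually (\<lambda>\<eta>. \<eta> \<in> {0<..<c}) (at_right 0)"
    using nonneg by (intro eventually_at_right_real) auto
  have "eventually (\<lambda>\<eta>. L \<eta> > c * exp (- (A0 * A)) - \<epsilon> \<and> R \<eta> < c * exp (- (a0 * a)) + \<epsilon> \<and>
           (A + \<eta>) * \<eta> < 1 \<and> \<eta> \<in> {0<..<c}) (at_right 0)"
    by (intro eventually_conj 1 2 3 4)
  then obtain \<eta> where \<eta>: "L \<eta> > c * exp (- (A0 * A)) - \<epsilon>" "R \<eta> < c * exp (- (a0 * a)) + \<epsilon>"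
    "(A + \<eta>) * \<eta> < 1" "0 < \<eta>" "\<eta> < c"
    using eventually_happens[of _ "at_right (0::real)"] by auto
  obtain \<delta>1 where \<delta>1: "\<delta>1 > 0"
    and ev: "\<forall>\<^sub>F n in sequentially. marginals_within c a0 A0 \<delta>1 (a - \<eta>) (A + \<eta>) n"
    using mb \<open>\<eta> > 0\<close> unfolding marginal_bounds_def by meson
  \<comment> \<open>The factor 1/3 pays for \<open>nearly_regular_remove\<close>, which triples the
    tolerance.\<close>
  define \<delta> where "\<delta> = min \<eta> (\<delta>1 / 3)"
  have \<delta>: "\<delta> > 0" "\<delta> \<le> \<eta>" "3 * \<delta> \<le> \<delta>1" using \<delta>1 \<eta> by (auto simp: \<delta>_def)
  have "\<forall>\<^sub>F n in sequentially. 1 \<le> \<delta> * sqrt (real n)"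
    using \<delta> by real_asymp
  then have "\<forall>\<^sub>F n in sequentially.
      marginals_within c a0 A0 \<delta> (c * exp (- (A0 * A)) - \<epsilon>) (c * exp (- (a0 * a)) + \<epsilon>) n"
    using ev
  proof (eventually_elim, intro marginals_withinI)
    fix n :: nat and t E U w
    assume n: "1 \<le> \<delta> * sqrt (real n)"
    assume bound: "marginals_within c a0 A0 \<delta>1 (a - \<eta>) (A + \<eta>) n"
    assume t: "t > 0" "\<bar>sqrt n * t - c\<bar> \<le> \<delta>" and E: "E \<subseteq> [{..<n}]\<^bsup>2\<^esup>" and U: "U \<subseteq> {..<n}" "w \<in> U"
      and reg: "nearly_regular n a0 A0 \<delta> E U"
    have fin: "finite U" using U(1) by (rule finite_subset) simp
    have sq: "sqrt (real n) > 0" using n by (cases "n = 0") auto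
    have sq_inv: "1 / sqrt (real n) \<le> \<eta>"
    proof -
      have "\<delta> * sqrt (real n) \<le> \<eta> * sqrt (real n)" using \<delta> sq by (intro mult_right_mono) auto
      then have "1 \<le> \<eta> * sqrt (real n)" using n by linarith
      then show ?thesis using sq by (simp add: pos_divide_le_eq)
    qed
    have occupation: "a - \<eta> \<le> sqrt n * occupation E (U - {w} - Y) t x" "sqrt n * occupation E (U - {w} - Y) t x \<le> A + \<eta>"
      if "Y \<subseteq> nbhd E w \<inter> U" "x \<in> U - {w} - Y" for Y x
    proof -
      have "nearly_regular n a0 A0 \<delta>1 E (U - {w} - Y)"
        by (rule nearly_regular_remove[OF reg E]) (use that \<delta> n in auto)
      moreover have "\<bar>sqrt n * t - c\<bar> \<le> \<delta>1" "U - {w} - Y \<subseteq> {..<n}"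
        using t \<delta> U by auto
      ultimately show "a - \<eta> \<le> sqrt n * occupation E (U - {w} - Y) t x"
          "sqrt n * occupation E (U - {w} - Y) t x \<le> A + \<eta>"
        using marginals_withinD[OF bound t(1) _ E] that by blast+
    qed
    have t_le: "t \<le> (c + \<eta>) * \<eta>"
    proof -
      have "t = (sqrt n * t) * (1 / sqrt n)" using sq by simp
      also have "\<dots> \<le> (c + \<eta>) * \<eta>"
        using t \<delta> sq sq_inv nonneg \<eta> by (intro mult_mono) auto
      finally show ?thesis .
    qed
    show "c * exp (- (A0 * A)) - \<epsilon> \<le> sqrt n * occupation E U t w \<and> sqrt n * occupation E U t w \<le> c * exp (- (a0 * a)) + \<epsilon>"
    proof
      define q where "q = (A + \<eta>) * (1 / sqrt n)"
      have q: "0 \<le> q" "q \<le> (A + \<eta>) * \<eta>"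
        unfolding q_def by (use \<eta> nonneg in simp, rule mult_left_mono, use sq_inv \<eta> nonneg in auto)
      have q1: "q < 1" using q \<eta>(3) by linarith
      have "occupation E U t w \<ge> t / (1 + t) * exp (- (q / (1 - q) * ((A0 + \<delta>) * sqrt n)))"
      proof (rule occupation_ge_exp)
        show "occupation E (U - {w} - Y) t x \<le> q" if "Y \<subseteq> nbhd E w \<inter> U" "x \<in> U - {w} - Y" for x Y
          using occupation(2)[OF that] sq unfolding q_def by (simp add: pos_le_divide_eq mult.commute)
        show "real (card (nbhd E w)) \<le> (A0 + \<delta>) * sqrt (real n)"
          using reg by (auto simp: nearly_regular_def)
      qed (rule fin U(2) graph_no_loop[OF E] less_imp_le[OF t(1)] q(1) q1 finite_nbhd[OF E])+
      then have "sqrt n * (t / (1 + t) * exp (- (q / (1 - q) * ((A0 + \<delta>) * sqrt n)))) \<le> sqrt n * occupation E U t w"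
        by (rule mult_left_mono) simp
      moreover have "L \<eta> \<le> sqrt n * (t / (1 + t) * exp (- (q / (1 - q) * ((A0 + \<delta>) * sqrt n))))"
      proof -
        have "(c - \<eta>) / (1 + (c + \<eta>) * \<eta>) \<le> (sqrt n * t) / (1 + t)"
        proof (rule frac_le)
          show "0 \<le> sqrt n * t" "0 < 1 + t" "1 + t \<le> 1 + (c + \<eta>) * \<eta>"
            using t(1) sq t_le by simp_all
          show "c - \<eta> \<le> sqrt n * t" using t(2) \<delta>(2) by linarith
        qed
        moreover have "q / (1 - q) * ((A0 + \<delta>) * sqrt n) \<le> (A + \<eta>) * (A0 + \<eta>) / (1 - (A + \<eta>) * \<eta>)"
        proof -
          have "q / (1 - q) * ((A0 + \<delta>) * sqrt n) = (A + \<eta>) * (A0 + \<delta>) / (1 - q)"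
            using sq by (simp add: q_def)
          also have "\<dots> \<le> (A + \<eta>) * (A0 + \<eta>) / (1 - (A + \<eta>) * \<eta>)"
          proof (rule frac_le)
            show "(A + \<eta>) * (A0 + \<delta>) \<le> (A + \<eta>) * (A0 + \<eta>)"
              by (rule mult_left_mono) (use \<eta> \<delta> nonneg in simp_all)
            show "0 \<le> (A + \<eta>) * (A0 + \<eta>)" using \<eta> nonneg by simp
            show "0 < 1 - (A + \<eta>) * \<eta>" "1 - (A + \<eta>) * \<eta> \<le> 1 - q"
              using \<eta>(3) q(2) by linarith+
          qed
          finally show ?thesis .
        qed
        ultimately have "L \<eta> \<le> (sqrt n * t) / (1 + t) * exp (- (q / (1 - q) * ((A0 + \<delta>) * sqrt n)))"
          unfolding L_def by (intro mult_mono) (use t(1) sq in simp_all)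
        then show ?thesis by simp
      qed
      ultimately show "c * exp (- (A0 * A)) - \<epsilon> \<le> sqrt n * occupation E U t w"
        using \<eta>(1) by linarith
    next
      define q where "q = max 0 (a - \<eta>) * (1 / sqrt n)"
      define d where "d = max 0 (a0 - \<delta>) * sqrt n"
      have "occupation E U t w \<le> t * exp (- (q * d))"
      proof (rule occupation_le_exp)
        show "q \<le> occupation E (U - {w} - Y) t x" if "Y \<subseteq> nbhd E w \<inter> U" "x \<in> U - {w} - Y" for x Y
        proof -
          have "max 0 (a - \<eta>) \<le> sqrt n * occupation E (U - {w} - Y) t x"
            using occupation(1)[OF that] occupation_nonneg[of "U - {w} - Y" t E x] fin t by simp
          then show ?thesis
            using sq unfolding q_def by (simp add: pos_divide_le_eq mult.commute)
        qed
        show "d \<le> real (card (nbhd E w \<inter> U))"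
          using reg U by (auto simp: nearly_regular_def d_def max_def)
        show "w \<notin> nbhd E w" using nbhd_subset[OF E, of w] by auto
        show "0 \<le> q" unfolding q_def by simp
      qed (rule fin U(2) graph_no_loop[OF E] less_imp_le[OF t(1)])+
      then have "sqrt n * occupation E U t w \<le> sqrt n * (t * exp (- (q * d)))"
        by (rule mult_left_mono) simp
      also have "\<dots> = (sqrt n * t) * exp (- (max 0 (a - \<eta>) * max 0 (a0 - \<delta>)))"
        using sq by (simp add: q_def d_def)
      also have "\<dots> \<le> (c + \<eta>) * exp (- (max 0 (a - \<eta>) * max 0 (a0 - \<eta>)))"
                proof (rule mult_mono)
          show "sqrt n * t \<le> c + \<eta>" using t(2) \<delta>(2) by linarith
          have "max 0 (a - \<eta>) * max 0 (a0 - \<eta>) \<le> max 0 (a - \<eta>) * max 0 (a0 - \<delta>)"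
            using \<delta>(2) by (intro mult_left_mono) auto
          then show "exp (- (max 0 (a - \<eta>) * max 0 (a0 - \<delta>))) \<le> exp (- (max 0 (a - \<eta>) * max 0 (a0 - \<eta>)))"
            by simp
        qed (use nonneg \<eta> in simp_all)
      also have "\<dots> = R \<eta>" by (simp add: R_def)
      finally show "sqrt n * occupation E U t w \<le> c * exp (- (a0 * a)) + \<epsilon>"
        using \<eta>(2) by linarith
    qed
  qed
  with \<delta>(1) show "\<exists>\<delta>>0. \<forall>\<^sub>F n in sequentially.
      marginals_within c a0 A0 \<delta> (c * exp (- (A0 * A)) - \<epsilon>) (c * exp (- (a0 * a)) + \<epsilon>) n"
    by blast
qed

subsection \<open>Triangle-free graphs\<close>

definition triangle_free_graphs :: "nat \<Rightarrow> nat set set set" where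
  "triangle_free_graphs n = {E. E \<subseteq> [{..<n}]\<^bsup>2\<^esup> \<and> triangles n E = {}}"

text \<open>The vertex set is kept, so \<open>u\<close> becomes isolated; it is excluded separately
  by taking \<open>{..<n} - {u}\<close> as the vertex set of the hard-core model.\<close>

definition del_vertex :: "'a set set \<Rightarrow> 'a \<Rightarrow> 'a set set" where
  "del_vertex E u = {e \<in> E. u \<notin> e}"

definition star :: "'a \<Rightarrow> 'a set \<Rightarrow> 'a set set" where
  "star u S = (\<lambda>s. {u, s}) ` S"

lemma finite_pairs: "finite ([{..<n::nat}]\<^bsup>2\<^esup>)"
  by (simp add: finite_imp_finite_nsets)

lemma finite_graph: "E \<subseteq> [{..<n::nat}]\<^bsup>2\<^esup> \<Longrightarrow> finite E"
  using finite_pairs finite_subset by blast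

lemma finite_triangle_free_graphs [simp]: "finite (triangle_free_graphs n)"
  by (rule finite_subset[of _ "Pow ([{..<n}]\<^bsup>2\<^esup>)"]) (auto simp: triangle_free_graphs_def finite_pairs)

lemma triangle_free_iff:
  assumes E: "E \<subseteq> [{..<n::nat}]\<^bsup>2\<^esup>"
  shows "triangles n E = {} \<longleftrightarrow> (\<forall>x y z. {x, y} \<in> E \<longrightarrow> {y, z} \<in> E \<longrightarrow> {x, z} \<notin> E)"
proof
  assume tf: "triangles n E = {}"
  show "\<forall>x y z. {x, y} \<in> E \<longrightarrow> {y, z} \<in> E \<longrightarrow> {x, z} \<notin> E"
  proof (intro allI impI notI)
    fix x y z assume *: "{x, y} \<in> E" "{y, z} \<in> E" "{x, z} \<in> E"
    have "{x, y} \<in> [{..<n}]\<^bsup>2\<^esup>" "{y, z} \<in> [{..<n}]\<^bsup>2\<^esup>" "{x, z} \<in> [{..<n}]\<^bsup>2\<^esup>"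
      using * E by blast+
    moreover have "{x, x} \<notin> E" for x using graph_no_loop[OF E, of x] by simp
    then have "x \<noteq> y" "y \<noteq> z" "x \<noteq> z" using * by metis+
    ultimately have d: "x \<noteq> y" "y \<noteq> z" "x \<noteq> z" "x < n" "y < n" "z < n"
      by (simp_all add: nsets_def)
    have "[{x, y, z}]\<^bsup>2\<^esup> \<subseteq> E"
    proof
      fix e assume "e \<in> [{x, y, z}]\<^bsup>2\<^esup>"
      then obtain p q where "e = {p, q}" "p \<noteq> q" "p \<in> {x, y, z}" "q \<in> {x, y, z}"
        by (auto simp: nsets_def card_2_iff)
      then show "e \<in> E" using * by (auto simp: insert_commute)
    qed
    moreover have "{x, y, z} \<in> [{..<n}]\<^bsup>3\<^esup>" using d by (auto simp: nsets_def)
    ultimately have "{x, y, z} \<in> triangles n E" by (simp add: triangles_def)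
    then show False using tf by simp
  qed
next
  assume tf: "\<forall>x y z. {x, y} \<in> E \<longrightarrow> {y, z} \<in> E \<longrightarrow> {x, z} \<notin> E"
  show "triangles n E = {}"
  proof (rule ccontr)
    assume "triangles n E \<noteq> {}"
    then obtain S where S: "S \<in> [{..<n}]\<^bsup>3\<^esup>" "[S]\<^bsup>2\<^esup> \<subseteq> E" by (auto simp: triangles_def)
    from S(1) obtain x y z where xyz: "S = {x, y, z}" "x \<noteq> y" "y \<noteq> z" "x \<noteq> z"
      by (auto simp: nsets_def card_3_iff)
    have "{x, y} \<in> [S]\<^bsup>2\<^esup>" "{y, z} \<in> [S]\<^bsup>2\<^esup>" "{x, z} \<in> [S]\<^bsup>2\<^esup>"
      using xyz by (auto simp: nsets_def)
    then show False using S(2) tf by blast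
  qed
qed

lemma triangle_free_subset:
  assumes "E \<in> triangle_free_graphs n" "F \<subseteq> E"
  shows "F \<in> triangle_free_graphs n"
  using assms unfolding triangle_free_graphs_def triangles_def by blast

lemma empty_triangle_free [simp]: "{} \<in> triangle_free_graphs n"
proof -
  have "triangles n {} = {}"
    using triangle_free_iff[of "{}" n] by simp
  then show ?thesis by (simp add: triangle_free_graphs_def)
qed

lemma triangle_free_graphs_subset: "E \<in> triangle_free_graphs n \<Longrightarrow> E \<subseteq> [{..<n}]\<^bsup>2\<^esup>"
  by (simp add: triangle_free_graphs_def)

section \<open>Removing a vertex and resampling its neighbourhood\<close>

lemma nbhd_independent_del_vertex:
  assumes "E \<in> triangle_free_graphs n"
  shows "nbhd E u \<in> independent_sets (del_vertex E u) ({..<n} - {u})"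
proof -
  have E: "E \<subseteq> [{..<n}]\<^bsup>2\<^esup>" and tf: "\<forall>x y z. {x, y} \<in> E \<longrightarrow> {y, z} \<in> E \<longrightarrow> {x, z} \<notin> E"
    using assms triangle_free_iff by (auto simp: triangle_free_graphs_def)
  have "{x, y} \<notin> E" if "{u, x} \<in> E" "{u, y} \<in> E" for x y
    using tf that by metis
  then show ?thesis
    using nbhd_subset[OF E] by (auto simp: independent_sets_def del_vertex_def nbhd_def)
qed

lemma graph_decompose:
  assumes "E \<subseteq> [A]\<^bsup>2\<^esup>"
  shows "del_vertex E u \<union> star u (nbhd E u) = E"
proof
  show "E \<subseteq> del_vertex E u \<union> star u (nbhd E u)"
  proof
    fix e assume e: "e \<in> E"
    then have "e \<in> [A]\<^bsup>2\<^esup>" using assms by auto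
    then obtain p q where pq: "e = {p, q}" by (auto simp: nsets_def card_2_iff)
    show "e \<in> del_vertex E u \<union> star u (nbhd E u)"
    proof (cases "u \<in> e")
      case True
      then obtain v where "e = {u, v}" using pq by (auto simp: insert_commute)
      then show ?thesis using e by (auto simp: star_def nbhd_def)
    qed (use e in \<open>auto simp: del_vertex_def\<close>)
  qed
qed (auto simp: del_vertex_def star_def nbhd_def)

text \<open>A triangle through \<open>u\<close> would need an edge of \<open>E\<close> inside
  \<open>S\<close>. Together with \<open>nbhd_independent_del_vertex\<close> this makes
  \<open>E\<close> correspond bijectively to the pair of \<open>del_vertex E u\<close> and
  \<open>nbhd E u\<close>.\<close>

lemma add_star_triangle_free:
  assumes E: "E \<in> triangle_free_graphs n" and u: "\<And>e. e \<in> E \<Longrightarrow> u \<notin> e" "u < n"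
    and S: "S \<in> independent_sets E ({..<n} - {u})"
  shows "E \<union> star u S \<in> triangle_free_graphs n"
    and "del_vertex (E \<union> star u S) u = E" and "nbhd (E \<union> star u S) u = S"
proof -
  have E2: "E \<subseteq> [{..<n}]\<^bsup>2\<^esup>" and tf: "\<And>x y z. {x, y} \<in> E \<Longrightarrow> {y, z} \<in> E \<Longrightarrow> {x, z} \<in> E \<Longrightarrow> False"
    using E triangle_free_iff[of E n] by (auto simp: triangle_free_graphs_def)
  have S2: "S \<subseteq> {..<n} - {u}" and ind: "\<And>x y. x \<in> S \<Longrightarrow> y \<in> S \<Longrightarrow> {x, y} \<notin> E"
    using S by (auto simp: independent_sets_def)
  have sub: "E \<union> star u S \<subseteq> [{..<n}]\<^bsup>2\<^esup>"
  proof -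
    have "{u, s} \<in> [{..<n}]\<^bsup>2\<^esup>" if "s \<in> S" for s
      using S2 u(2) that by (auto simp: nsets_def card_2_iff)
    then show ?thesis using E2 by (auto simp: star_def)
  qed
  have mem: "{x, y} \<in> E \<union> star u S \<longleftrightarrow>
      ({x, y} \<in> E \<and> x \<noteq> u \<and> y \<noteq> u) \<or> (x = u \<and> y \<in> S) \<or> (y = u \<and> x \<in> S)" for x y
    using u(1)[of "{x, y}"] by (auto simp: star_def doubleton_eq_iff)
  have "\<not> ({x, y} \<in> E \<union> star u S \<and> {y, z} \<in> E \<union> star u S \<and> {x, z} \<in> E \<union> star u S)" for x y z
    unfolding mem using ind[of x y] ind[of y z] ind[of x z] tf[of x y z] S2 by auto
  then show "E \<union> star u S \<in> triangle_free_graphs n"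
    unfolding triangle_free_graphs_def using sub triangle_free_iff[OF sub] by blast
  show "del_vertex (E \<union> star u S) u = E"
    using u(1) by (auto simp: del_vertex_def star_def)
  show "nbhd (E \<union> star u S) u = S"
    using u(1) S2 by (auto simp: nbhd_def star_def doubleton_eq_iff)
qed

lemma card_star: "u \<notin> S \<Longrightarrow> card (star u S) = card S"
  unfolding star_def by (rule card_image) (auto simp: inj_on_def doubleton_eq_iff)

lemma card_graph_decompose:
  assumes "E \<subseteq> [{..<n::nat}]\<^bsup>2\<^esup>"
  shows "card E = card (del_vertex E u) + card (nbhd E u)"
proof -
  have "card E = card (del_vertex E u \<union> star u (nbhd E u))"
    by (simp add: graph_decompose[OF assms])
  also have "\<dots> = card (del_vertex E u) + card (star u (nbhd E u))"
    using finite_graph[OF assms] finite_nbhd[OF assms, of u]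
    by (intro card_Un_disjoint) (auto simp: del_vertex_def star_def)
  also have "card (star u (nbhd E u)) = card (nbhd E u)"
    using nbhd_subset[OF assms, of u] by (intro card_star) auto
  finally show ?thesis .
qed

lemma sum_triangle_free_decompose:
  fixes t :: real
  assumes "u < n"
  shows "(\<Sum>E\<in>triangle_free_graphs n. t ^ card E * f (del_vertex E u) (nbhd E u))
    = (\<Sum>E\<in>{E\<in>triangle_free_graphs n. \<forall>e\<in>E. u \<notin> e}.
         t ^ card E * (\<Sum>S\<in>independent_sets E ({..<n} - {u}). t ^ card S * f E S))"
proof -
  let ?B = "{E\<in>triangle_free_graphs n. \<forall>e\<in>E. u \<notin> e}"
  have "(\<Sum>E\<in>?B. t ^ card E * (\<Sum>S\<in>independent_sets E ({..<n} - {u}). t ^ card S * f E S))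
      = (\<Sum>E\<in>?B. \<Sum>S\<in>independent_sets E ({..<n} - {u}). t ^ (card E + card S) * f E S)"
    by (simp add: sum_distrib_left power_add mult.assoc)
  also have "\<dots> = (\<Sum>(E, S)\<in>Sigma ?B (\<lambda>E. independent_sets E ({..<n} - {u})). t ^ (card E + card S) * f E S)"
    by (rule sum.Sigma) auto
  also have "\<dots> = (\<Sum>E\<in>triangle_free_graphs n. t ^ card E * f (del_vertex E u) (nbhd E u))"
  proof (rule sym, rule sum.reindex_bij_witness[of _ "\<lambda>(E, S). E \<union> star u S" "\<lambda>E. (del_vertex E u, nbhd E u)"])
    fix E assume E: "E \<in> triangle_free_graphs n"
    have "del_vertex E u \<in> triangle_free_graphs n"
      by (rule triangle_free_subset[OF E]) (auto simp: del_vertex_def)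
    then show "(del_vertex E u, nbhd E u) \<in> Sigma ?B (\<lambda>E. independent_sets E ({..<n} - {u}))"
      using nbhd_independent_del_vertex[OF E, of u] by (auto simp: del_vertex_def)
    show "(case (del_vertex E u, nbhd E u) of (E, S) \<Rightarrow> E \<union> star u S) = E"
      using graph_decompose[OF triangle_free_graphs_subset[OF E]] by simp
    show "(case (del_vertex E u, nbhd E u) of (E, S) \<Rightarrow> t ^ (card E + card S) * f E S)
        = t ^ card E * f (del_vertex E u) (nbhd E u)"
      using card_graph_decompose[OF triangle_free_graphs_subset[OF E], of u] by simp
  next
    fix p assume p: "p \<in> Sigma ?B (\<lambda>E. independent_sets E ({..<n} - {u}))"
    obtain E S where ES: "p = (E, S)" by (cases p)
    show "(case p of (E, S) \<Rightarrow> E \<union> star u S) \<in> triangle_free_graphs n"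
      "(del_vertex (case p of (E, S) \<Rightarrow> E \<union> star u S) u, nbhd (case p of (E, S) \<Rightarrow> E \<union> star u S) u) = p"
      using add_star_triangle_free[of E n u S] p ES assms by auto
  qed
  finally show ?thesis by simp
qed

text \<open>The tower property: \<open>f\<close> is replaced by its conditional average given the
  graph without \<open>u\<close>. Both sides run over all triangle-free graphs, so estimates valid
  outside a rare set of graphs can be averaged.\<close>

lemma sum_triangle_free_resample:
  fixes t :: real and f :: "nat set set \<Rightarrow> nat set \<Rightarrow> real"
  assumes "u < n" "t > 0"
  shows "(\<Sum>E\<in>triangle_free_graphs n. t ^ card E * f (del_vertex E u) (nbhd E u))
    = (\<Sum>E\<in>triangle_free_graphs n. t ^ card E *
         ((\<Sum>S\<in>independent_sets (del_vertex E u) ({..<n} - {u}). t ^ card S * f (del_vertex E u) S)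
            / hardcore (del_vertex E u) ({..<n} - {u}) t))"
proof -
  have "hardcore E ({..<n} - {u}) t \<noteq> 0" for E
    using hardcore_ge_1[of "{..<n} - {u}" t E] assms by simp
  \<comment> \<open>The conditional average does not depend on the neighbourhood of
    \<open>u\<close>, so averaging it once more changes nothing; both sides thus decompose into the
    same sum.\<close>
  then have eq: "(\<Sum>S\<in>independent_sets E ({..<n} - {u}). t ^ card S * f E S)
      = (\<Sum>S\<in>independent_sets E ({..<n} - {u}). t ^ card S * ((\<Sum>S\<in>independent_sets E ({..<n} - {u}). t ^ card S * f E S)
            / hardcore E ({..<n} - {u}) t))" for E
    unfolding sum_distrib_right[symmetric] by (simp add: hardcore_def part_fun_def)
  show ?thesis
    unfolding sum_triangle_free_decompose[OF assms(1), where f = f]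
      sum_triangle_free_decompose[OF assms(1), where f = "\<lambda>E _. (\<Sum>S\<in>independent_sets E ({..<n} - {u}). t ^ card S * f E S)
            / hardcore E ({..<n} - {u}) t"]
    by (subst eq) (rule refl)
qed

lemma sum_degree_triangle_free:
  assumes "u < n" "t > 0"
  shows "(\<Sum>E\<in>triangle_free_graphs n. t ^ card E * real (card (nbhd E u)))
    = (\<Sum>E\<in>triangle_free_graphs n. t ^ card E * mean_card (independent_sets (del_vertex E u) ({..<n} - {u})) t)"
  using sum_triangle_free_resample[OF assms, of "\<lambda>_ S. real (card S)"]
  by (simp add: mean_card_def hardcore_def)

text \<open>A conditional Chernoff bound. \<open>Q\<close> sees only the graph without
  \<open>u\<close>, so it stays fixed while the neighbourhood of \<open>u\<close> is resampled, and
  the tilted mean has to be controlled only where \<open>Q\<close> holds.\<close>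

lemma sum_degree_tail_triangle_free:
  assumes "u < n" "t > 0" "s > 0"
    and mean: "\<And>E. E \<in> triangle_free_graphs n \<Longrightarrow> Q (del_vertex E u) \<Longrightarrow>
      ln s * (mean_card (independent_sets (del_vertex E u) ({..<n} - {u})) (s * t) - x) \<le> y"
  shows "(\<Sum>E\<in>{E\<in>triangle_free_graphs n. Q (del_vertex E u) \<and> ln s * (real (card (nbhd E u)) - x) \<ge> 0}. t ^ card E)
    \<le> part_fun (triangle_free_graphs n) t * exp y"
proof -
  let ?f = "\<lambda>E S. of_bool (Q E \<and> ln s * (real (card S) - x) \<ge> 0) :: real"
  let ?U = "{..<n} - {u}"
  have "(\<Sum>E\<in>{E\<in>triangle_free_graphs n. Q (del_vertex E u) \<and> ln s * (real (card (nbhd E u)) - x) \<ge> 0}. t ^ card E)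
      = (\<Sum>E\<in>triangle_free_graphs n. t ^ card E * ?f (del_vertex E u) (nbhd E u))"
    by (rule sum.mono_neutral_cong_left) auto
  also have "\<dots> = (\<Sum>E\<in>triangle_free_graphs n. t ^ card E *
         ((\<Sum>S\<in>independent_sets (del_vertex E u) ?U. t ^ card S * ?f (del_vertex E u) S) / hardcore (del_vertex E u) ?U t))"
    by (rule sum_triangle_free_resample[OF assms(1,2)])
  also have "\<dots> \<le> (\<Sum>E\<in>triangle_free_graphs n. t ^ card E * exp y)"
  proof (intro sum_mono mult_left_mono)
    fix E assume E: "E \<in> triangle_free_graphs n"
    let ?D = "del_vertex E u"
    have pos: "hardcore ?D ?U t > 0" using hardcore_ge_1[of ?U t ?D] assms by simp
    show "(\<Sum>S\<in>independent_sets ?D ?U. t ^ card S * ?f ?D S) / hardcore ?D ?U t \<le> exp y"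
    proof (cases "Q ?D")
      case True
      have "(\<Sum>S\<in>independent_sets ?D ?U. t ^ card S * ?f ?D S)
          = (\<Sum>S\<in>{S\<in>independent_sets ?D ?U. ln s * (real (card S) - x) \<ge> 0}. t ^ card S)"
        using True by (intro sum.mono_neutral_cong_right) auto
      also have "\<dots> \<le> hardcore ?D ?U t * exp (ln s * (mean_card (independent_sets ?D ?U) (s * t) - x))"
        unfolding hardcore_def using assms by (intro part_fun_tail_le) auto
      also have "\<dots> \<le> hardcore ?D ?U t * exp y"
        using mean[OF E True] pos by (intro mult_left_mono) auto
      finally show ?thesis using pos by (simp add: field_simps)
    qed simp
  qed (use assms in auto)
  finally show ?thesis by (simp add: part_fun_def sum_distrib_right)
qed

lemma sum_degrees:
  assumes E: "E \<subseteq> [{..<n::nat}]\<^bsup>2\<^esup>"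
  shows "(\<Sum>u<n. card (nbhd E u)) = 2 * card E"
proof -
  have fin: "finite E" by (rule finite_graph[OF E])
  have "(\<Sum>u<n. card (nbhd E u)) = (\<Sum>u<n. card {e\<in>E. u \<in> e})"
  proof (intro sum.cong refl)
    fix u
    have "{e\<in>E. u \<in> e} = star u (nbhd E u)"
      using graph_decompose[OF E, of u] by (auto simp: del_vertex_def star_def nbhd_def)
    then show "card (nbhd E u) = card {e\<in>E. u \<in> e}"
      using card_star[of u "nbhd E u"] nbhd_subset[OF E, of u] by (simp add: subset_Diff_insert)
  qed
  also have "\<dots> = (\<Sum>u<n. \<Sum>e\<in>E. if u \<in> e then 1 else 0)"
    using fin by (intro sum.cong refl) (simp only: card_eq_sum sum.inter_filter)
  also have "\<dots> = (\<Sum>e\<in>E. \<Sum>u<n. if u \<in> e then 1 else 0)"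
    by (rule sum.swap)
  also have "\<dots> = (\<Sum>e\<in>E. 2)"
  proof (intro sum.cong refl)
    fix e assume "e \<in> E"
    then have "e \<subseteq> {..<n}" "card e = 2" using E by (auto simp: nsets_def)
    moreover from this have "{u\<in>{..<n}. u \<in> e} = e" by blast
    ultimately have "card {u\<in>{..<n}. u \<in> e} = 2" by metis
    then show "(\<Sum>u<n. if u \<in> e then 1 else 0) = (2::nat)"
      by (simp only: card_eq_sum sum.inter_filter finite_lessThan)
  qed
  finally show ?thesis by simp
qed

text \<open>Deleting \<open>F\<close> is injective on the graphs that contain \<open>F\<close> and
  preserves triangle-freeness. So a prescribed edge set is present with probability at most
  \<open>t ^ card F\<close>, as if edges were independent.\<close>

lemma sum_triangle_free_superset_le:
  assumes "t \<ge> (0::real)"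
  shows "(\<Sum>E\<in>{E\<in>triangle_free_graphs n. F \<subseteq> E}. t ^ card E)
    \<le> t ^ card F * part_fun (triangle_free_graphs n) t"
proof -
  have "(\<Sum>E\<in>{E\<in>triangle_free_graphs n. F \<subseteq> E}. t ^ card E)
      = (\<Sum>E\<in>{E\<in>triangle_free_graphs n. F \<subseteq> E}. t ^ card F * t ^ card (E - F))"
  proof (intro sum.cong refl)
    fix E assume "E \<in> {E\<in>triangle_free_graphs n. F \<subseteq> E}"
    then have "finite E" "F \<subseteq> E"
      using finite_graph[OF triangle_free_graphs_subset] by auto
    then have "card E = card F + card (E - F)"
      by (metis card_Diff_subset card_mono finite_subset le_add_diff_inverse)
    then show "t ^ card E = t ^ card F * t ^ card (E - F)" by (simp add: power_add)
  qed
  also have "\<dots> = t ^ card F * (\<Sum>E\<in>(\<lambda>E. E - F) ` {E\<in>triangle_free_graphs n. F \<subseteq> E}. t ^ card E)"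
    unfolding sum_distrib_left[symmetric]
    by (subst sum.reindex) (auto simp: inj_on_def)
  also have "\<dots> \<le> t ^ card F * part_fun (triangle_free_graphs n) t"
    unfolding part_fun_def using assms
    by (intro mult_left_mono sum_mono2) (auto intro: triangle_free_subset)
  finally show ?thesis .
qed

lemma sum_UN_le:
  fixes g :: "'b \<Rightarrow> real"
  assumes "finite I" "\<And>i. i \<in> I \<Longrightarrow> finite (A i)" "\<And>x. g x \<ge> 0"
  shows "sum g (\<Union>i\<in>I. A i) \<le> (\<Sum>i\<in>I. sum g (A i))"
  using assms(1,2)
proof (induction I)
  case empty
  then show ?case by simp
next
  case (insert i I)
  have "sum g (A i \<union> (\<Union>i\<in>I. A i)) + sum g (A i \<inter> (\<Union>i\<in>I. A i)) = sum g (A i) + sum g (\<Union>i\<in>I. A i)"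
    using insert by (intro sum.union_inter) auto
  moreover have "sum g (A i \<inter> (\<Union>i\<in>I. A i)) \<ge> 0" by (intro sum_nonneg assms(3))
  moreover have "sum g (\<Union>i\<in>I. A i) \<le> (\<Sum>i\<in>I. sum g (A i))" using insert by simp
  ultimately show ?case using insert.hyps by simp
qed

text \<open>A union bound over sets \<open>W\<close> of \<open>k\<close> common neighbours: there
  are at most \<open>n ^ k\<close> of them, and each forces \<open>2 * k\<close> edges.\<close>

lemma sum_triangle_free_codegree_le:
  fixes x y :: nat
  assumes "x \<noteq> y" "t > 0"
  shows "(\<Sum>E\<in>{E\<in>triangle_free_graphs n. card (nbhd E x \<inter> nbhd E y) \<ge> k}. t ^ card E)
    \<le> (real n * t\<^sup>2) ^ k * part_fun (triangle_free_graphs n) t"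
proof -
  let ?Z = "part_fun (triangle_free_graphs n) t"
  let ?W = "[{..<n} - {x, y}]\<^bsup>k\<^esup>"
  have finW: "finite ?W" by (simp add: finite_imp_finite_nsets)
  have Z: "?Z \<ge> 0" using part_fun_pos[of "triangle_free_graphs n" t] assms by simp
  have "(\<Sum>E\<in>{E\<in>triangle_free_graphs n. card (nbhd E x \<inter> nbhd E y) \<ge> k}. t ^ card E)
     \<le> (\<Sum>E\<in>(\<Union>W\<in>?W. {E\<in>triangle_free_graphs n. star x W \<union> star y W \<subseteq> E}). t ^ card E)"
  proof (rule sum_mono2)
    show "{E\<in>triangle_free_graphs n. card (nbhd E x \<inter> nbhd E y) \<ge> k}
        \<subseteq> (\<Union>W\<in>?W. {E\<in>triangle_free_graphs n. star x W \<union> star y W \<subseteq> E})"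
    proof
      fix E assume "E \<in> {E\<in>triangle_free_graphs n. card (nbhd E x \<inter> nbhd E y) \<ge> k}"
      then have E: "E \<in> triangle_free_graphs n" and k: "card (nbhd E x \<inter> nbhd E y) \<ge> k" by auto
      obtain W where W: "W \<subseteq> nbhd E x \<inter> nbhd E y" "card W = k"
        using obtain_subset_with_card_n[OF k] by metis
      have sub: "nbhd E x \<inter> nbhd E y \<subseteq> {..<n} - {x, y}"
        using nbhd_subset[OF triangle_free_graphs_subset[OF E]] by fast
      have "finite W" using W sub finite_subset by (metis finite_Diff finite_lessThan)
      then have "W \<in> ?W" using W sub by (auto simp: nsets_def)
      moreover have "star x W \<union> star y W \<subseteq> E"
        using W by (auto simp: star_def nbhd_def)
      ultimately show "E \<in> (\<Union>W\<in>?W. {E\<in>triangle_free_graphs n. star x W \<union> star y W \<subseteq> E})"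
        using E by auto
    qed
  qed (use finW assms in auto)
  also have "\<dots> \<le> (\<Sum>W\<in>?W. \<Sum>E\<in>{E\<in>triangle_free_graphs n. star x W \<union> star y W \<subseteq> E}. t ^ card E)"
    using finW assms by (intro sum_UN_le) auto
  also have "\<dots> \<le> (\<Sum>W\<in>?W. t ^ (2 * k) * ?Z)"
  proof (rule sum_mono)
    fix W assume "W \<in> ?W"
    then have W: "W \<subseteq> {..<n} - {x, y}" "finite W" "card W = k" by (auto simp: nsets_def)
    have "star x W \<inter> star y W = {}"
      using W(1) assms(1) by (auto simp: star_def doubleton_eq_iff)
    then have "card (star x W \<union> star y W) = card (star x W) + card (star y W)"
      using W(2) by (intro card_Un_disjoint) (auto simp: star_def)
    also have "\<dots> = 2 * k"
    proof -
      have "x \<notin> W" "y \<notin> W" using W(1) by auto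
      then show ?thesis using W(3) by (simp add: card_star)
    qed
    finally show "(\<Sum>E\<in>{E\<in>triangle_free_graphs n. star x W \<union> star y W \<subseteq> E}. t ^ card E) \<le> t ^ (2 * k) * ?Z"
      using sum_triangle_free_superset_le[of t n "star x W \<union> star y W"] assms by simp
  qed
  also have "\<dots> = real (card ?W) * (t ^ (2 * k) * ?Z)" by simp
  also have "\<dots> \<le> real n ^ k * (t ^ (2 * k) * ?Z)"
  proof (intro mult_right_mono)
    have "card ?W = (card ({..<n} - {x, y})) choose k" by simp
    also have "\<dots> \<le> n choose k"
      by (rule binomial_right_mono) (metis card_lessThan card_mono Diff_subset finite_lessThan)
    also have "\<dots> \<le> n ^ k" by (cases "k \<le> n") (auto simp: binomial_le_pow binomial_eq_0)
    finally show "real (card ?W) \<le> real n ^ k" by (metis of_nat_le_iff of_nat_power)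
  qed (use assms Z in auto)
  also have "\<dots> = (real n * t\<^sup>2) ^ k * ?Z"
    by (simp add: power_mult_distrib power_mult)
  finally show ?thesis .
qed

subsection \<open>Degrees and codegrees of a random triangle-free graph\<close>

definition gibbs_prob :: "nat \<Rightarrow> real \<Rightarrow> (nat set set \<Rightarrow> bool) \<Rightarrow> real" where
  "gibbs_prob n t P = (\<Sum>E\<in>{E\<in>triangle_free_graphs n. P E}. t ^ card E) / part_fun (triangle_free_graphs n) t"

lemma part_fun_triangle_free_pos: "t \<ge> 0 \<Longrightarrow> part_fun (triangle_free_graphs n) t > 0"
  using part_fun_pos[of "triangle_free_graphs n" t] by simp

lemma gibbs_prob_nonneg: "t \<ge> 0 \<Longrightarrow> gibbs_prob n t P \<ge> 0"
  unfolding gibbs_prob_def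
  by (intro divide_nonneg_nonneg sum_nonneg) (auto simp: less_imp_le part_fun_triangle_free_pos)

lemma gibbs_prob_mono:
  assumes "t \<ge> 0" "\<And>E. E \<in> triangle_free_graphs n \<Longrightarrow> P E \<Longrightarrow> Q E"
  shows "gibbs_prob n t P \<le> gibbs_prob n t Q"
  unfolding gibbs_prob_def using assms
  by (intro divide_right_mono sum_mono2) (auto simp: less_imp_le part_fun_triangle_free_pos)

lemma gibbs_prob_or_le:
  assumes "t \<ge> 0"
  shows "gibbs_prob n t (\<lambda>E. P E \<or> Q E) \<le> gibbs_prob n t P + gibbs_prob n t Q"
proof -
  let ?T = "triangle_free_graphs n"
  have eq: "{E\<in>?T. P E \<or> Q E} = {E\<in>?T. P E} \<union> {E\<in>?T. Q E}" by auto
  have "(\<Sum>E\<in>{E\<in>?T. P E} \<union> {E\<in>?T. Q E}. t ^ card E) + (\<Sum>E\<in>{E\<in>?T. P E} \<inter> {E\<in>?T. Q E}. t ^ card E)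
      = (\<Sum>E\<in>{E\<in>?T. P E}. t ^ card E) + (\<Sum>E\<in>{E\<in>?T. Q E}. t ^ card E)"
    by (rule sum.union_inter) auto
  moreover have "(\<Sum>E\<in>{E\<in>?T. P E} \<inter> {E\<in>?T. Q E}. t ^ card E) \<ge> 0"
    using assms by (intro sum_nonneg) auto
  ultimately have "(\<Sum>E\<in>{E\<in>?T. P E \<or> Q E}. t ^ card E)
      \<le> (\<Sum>E\<in>{E\<in>?T. P E}. t ^ card E) + (\<Sum>E\<in>{E\<in>?T. Q E}. t ^ card E)"
    unfolding eq by linarith
  then show ?thesis
    unfolding gibbs_prob_def add_divide_distrib[symmetric]
    by (rule divide_right_mono) (simp add: assms less_imp_le part_fun_triangle_free_pos)
qed

lemma gibbs_prob_ex_le: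
  assumes "t \<ge> 0" "finite I"
  shows "gibbs_prob n t (\<lambda>E. \<exists>i\<in>I. P i E) \<le> (\<Sum>i\<in>I. gibbs_prob n t (P i))"
  using assms(2)
proof (induction I)
  case empty
  then show ?case by (simp add: gibbs_prob_def)
next
  case (insert i I)
  have "gibbs_prob n t (\<lambda>E. \<exists>i\<in>insert i I. P i E) = gibbs_prob n t (\<lambda>E. P i E \<or> (\<exists>i\<in>I. P i E))"
    by simp
  also have "\<dots> \<le> gibbs_prob n t (P i) + gibbs_prob n t (\<lambda>E. \<exists>i\<in>I. P i E)"
    by (rule gibbs_prob_or_le[OF assms(1)])
  finally show ?case using insert by simp
qed

lemma nbhd_eq_empty: "E \<subseteq> [{..<n::nat}]\<^bsup>2\<^esup> \<Longrightarrow> \<not> x < n \<Longrightarrow> nbhd E x = {}"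
  using nbhd_subset[of E "{..<n}"] nbhd_sym[of _ E x] by fastforce

lemma nbhd_del_vertex: "nbhd (del_vertex E u) x = (if x = u then {} else nbhd E x - {u})"
  by (auto simp: nbhd_def del_vertex_def)

lemma del_vertex_subset: "del_vertex E u \<subseteq> E"
  by (auto simp: del_vertex_def)

text \<open>At \<open>t = c / sqrt n\<close> the base \<open>n * t\<^sup>2\<close> is
  \<open>c\<^sup>2 < 1\<close>, and the exponent is about \<open>\<delta> * sqrt n\<close>. The
  resulting tail beats the number of pairs, which is at most n^2.\<close>

lemma codegree_tendsto:
  fixes c \<delta> :: real
  assumes c: "0 < c" "c < 1" and \<delta>: "\<delta> > 0"
  shows "(\<lambda>n. gibbs_prob n (c / sqrt n)
      (\<lambda>E. \<exists>p\<in>{..<n}\<times>{..<n}. fst p \<noteq> snd p \<and> real (card (nbhd E (fst p) \<inter> nbhd E (snd p))) > \<delta> * sqrt n))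
    \<longlonglongrightarrow> 0"
proof (rule tendsto_sandwich[OF _ _ tendsto_const])
  let ?P = "\<lambda>n p E. fst p \<noteq> snd p \<and> real (card (nbhd E (fst p) \<inter> nbhd E (snd p))) > \<delta> * sqrt n"
  show "\<forall>\<^sub>F n in sequentially. 0 \<le> gibbs_prob n (c / sqrt n) (\<lambda>E. \<exists>p\<in>{..<n}\<times>{..<n}. ?P n p E)"
    using c by (intro always_eventually allI gibbs_prob_nonneg) simp
  define \<kappa> where "\<kappa> = - ln c"
  have \<kappa>: "\<kappa> > 0" "c = exp (- \<kappa>)" using c by (auto simp: \<kappa>_def)
  show "(\<lambda>n. (real n)\<^sup>2 * exp (- (2 * \<kappa> * \<delta>) * sqrt n)) \<longlonglongrightarrow> 0"
    using \<kappa> \<delta> by real_asymp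
  show "\<forall>\<^sub>F n in sequentially. gibbs_prob n (c / sqrt n) (\<lambda>E. \<exists>p\<in>{..<n}\<times>{..<n}. ?P n p E)
      \<le> (real n)\<^sup>2 * exp (- (2 * \<kappa> * \<delta>) * sqrt n)"
    using eventually_gt_at_top[of 0]
  proof eventually_elim
    fix n :: nat assume n: "n > 0"
    let ?t = "c / sqrt n" and ?Z = "part_fun (triangle_free_graphs n) (c / sqrt n)"
    have t: "?t > 0" using c n by simp
    define k where "k = nat \<lceil>\<delta> * sqrt n\<rceil>"
    have single: "gibbs_prob n ?t (?P n p) \<le> exp (- (2 * \<kappa> * \<delta>) * sqrt n)" for p
    proof (cases "fst p = snd p")
      case True
      then show ?thesis by (simp add: gibbs_prob_def)
    next
      case False
      have "gibbs_prob n ?t (?P n p) \<le> gibbs_prob n ?t (\<lambda>E. card (nbhd E (fst p) \<inter> nbhd E (snd p)) \<ge> k)"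
        using t by (intro gibbs_prob_mono) (auto simp: k_def nat_le_iff ceiling_le_iff)
      also have "\<dots> \<le> (real n * ?t\<^sup>2) ^ k"
        unfolding gibbs_prob_def
        using sum_triangle_free_codegree_le[OF False t, of n k] part_fun_triangle_free_pos[of ?t n] t
        by (simp add: pos_divide_le_eq)
      also have "real n * ?t\<^sup>2 = exp (- (2 * \<kappa>))"
        using n by (simp add: \<kappa>(2) power_divide exp_double[symmetric])
      also have "exp (- (2 * \<kappa>)) ^ k = exp (- (2 * \<kappa>) * real k)"
        by (simp add: exp_of_nat_mult[symmetric] mult.commute)
      also have "\<dots> \<le> exp (- (2 * \<kappa> * \<delta>) * sqrt n)"
      proof -
        have "\<delta> * sqrt n \<le> real k" unfolding k_def by linarith
        then have "2 * \<kappa> * (\<delta> * sqrt n) \<le> 2 * \<kappa> * real k"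
          using \<kappa>(1) by (intro mult_left_mono) simp_all
        then show ?thesis by (simp add: mult.assoc)
      qed
      finally show ?thesis .
    qed
    have "gibbs_prob n ?t (\<lambda>E. \<exists>p\<in>{..<n}\<times>{..<n}. ?P n p E) \<le> (\<Sum>p\<in>{..<n}\<times>{..<n}. gibbs_prob n ?t (?P n p))"
      using t by (intro gibbs_prob_ex_le) auto
    also have "\<dots> \<le> (\<Sum>p\<in>{..<n}\<times>{..<n}. exp (- (2 * \<kappa> * \<delta>) * sqrt n))"
      by (intro sum_mono single)
    finally show "gibbs_prob n ?t (\<lambda>E. \<exists>p\<in>{..<n}\<times>{..<n}. ?P n p E) \<le> (real n)\<^sup>2 * exp (- (2 * \<kappa> * \<delta>) * sqrt n)"
      by (simp add: power2_eq_square)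
  qed
qed

section \<open>Simultaneous concentration of all degrees\<close>

definition degree_bounds :: "real \<Rightarrow> real \<Rightarrow> real \<Rightarrow> bool" where
  "degree_bounds c a A \<longleftrightarrow> (\<forall>\<epsilon>>0. (\<lambda>n. gibbs_prob n (c / sqrt n)
     (\<lambda>E. \<exists>x<n. real (card (nbhd E x)) < (a - \<epsilon>) * sqrt n \<or> (A + \<epsilon>) * sqrt n < real (card (nbhd E x))))
     \<longlonglongrightarrow> 0)"

definition regular_graph :: "nat \<Rightarrow> real \<Rightarrow> real \<Rightarrow> real \<Rightarrow> nat set set \<Rightarrow> bool" where
  "regular_graph n a A \<delta> E \<longleftrightarrow>
     (\<forall>x<n. (a - \<delta>) * sqrt n \<le> real (card (nbhd E x)) \<and> real (card (nbhd E x)) \<le> (A + \<delta>) * sqrt n) \<and>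
     (\<forall>x<n. \<forall>y<n. x \<noteq> y \<longrightarrow> real (card (nbhd E x \<inter> nbhd E y)) \<le> \<delta> * sqrt n)"

lemma irregular_tendsto:
  assumes "degree_bounds c a A" "0 < c" "c < 1" "\<delta> > 0"
  shows "(\<lambda>n. gibbs_prob n (c / sqrt n) (\<lambda>E. \<not> regular_graph n a A \<delta> E)) \<longlonglongrightarrow> 0"
proof (rule tendsto_sandwich[OF _ _ tendsto_const])
  let ?P = "\<lambda>(n::nat) (E::nat set set). \<exists>x<n. real (card (nbhd E x)) < (a - \<delta>) * sqrt n \<or> (A + \<delta>) * sqrt n < real (card (nbhd E x))"
  let ?Q = "\<lambda>(n::nat) (E::nat set set). \<exists>p\<in>{..<n}\<times>{..<n}. fst p \<noteq> snd p \<and> real (card (nbhd E (fst p) \<inter> nbhd E (snd p))) > \<delta> * sqrt n"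
  show "\<forall>\<^sub>F n in sequentially. 0 \<le> gibbs_prob n (c / sqrt n) (\<lambda>E. \<not> regular_graph n a A \<delta> E)"
    using assms by (intro always_eventually allI gibbs_prob_nonneg) simp
  have "(\<lambda>n. gibbs_prob n (c / sqrt n) (?P n) + gibbs_prob n (c / sqrt n) (?Q n)) \<longlonglongrightarrow> 0 + 0"
    using assms by (intro tendsto_add codegree_tendsto) (auto simp: degree_bounds_def)
  then show "(\<lambda>n. gibbs_prob n (c / sqrt n) (?P n) + gibbs_prob n (c / sqrt n) (?Q n)) \<longlonglongrightarrow> 0" by simp
  show "\<forall>\<^sub>F n in sequentially. gibbs_prob n (c / sqrt n) (\<lambda>E. \<not> regular_graph n a A \<delta> E)
      \<le> gibbs_prob n (c / sqrt n) (?P n) + gibbs_prob n (c / sqrt n) (?Q n)"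
  proof (intro always_eventually allI)
    fix n
    have "gibbs_prob n (c / sqrt n) (\<lambda>E. \<not> regular_graph n a A \<delta> E)
        \<le> gibbs_prob n (c / sqrt n) (\<lambda>E. ?P n E \<or> ?Q n E)"
      using assms by (intro gibbs_prob_mono) (auto simp: regular_graph_def not_le)
    also have "\<dots> \<le> gibbs_prob n (c / sqrt n) (?P n) + gibbs_prob n (c / sqrt n) (?Q n)"
      using assms by (intro gibbs_prob_or_le) simp
    finally show "gibbs_prob n (c / sqrt n) (\<lambda>E. \<not> regular_graph n a A \<delta> E)
        \<le> gibbs_prob n (c / sqrt n) (?P n) + gibbs_prob n (c / sqrt n) (?Q n)" .
  qed
qed

text \<open>Isolating \<open>u\<close> costs every other degree at most one, which
  \<open>1 \<le> \<delta> * sqrt n\<close> absorbs. \<open>nearly_regular\<close> also speaks of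
  numbers that are not vertices; their neighbourhoods are empty, and
  \<open>A + \<delta> \<ge> 0\<close> covers them.\<close>

lemma regular_graph_del_vertex:
  assumes reg: "regular_graph n a A \<delta> E" and E: "E \<subseteq> [{..<n}]\<^bsup>2\<^esup>"
    and u: "u < n" and \<delta>: "1 \<le> \<delta> * sqrt n" "A + \<delta> \<ge> 0" "\<delta> > 0"
  shows "nearly_regular n a A (2 * \<delta>) (del_vertex E u) ({..<n} - {u})"
  unfolding nearly_regular_def
proof (intro conjI allI ballI impI)
  have le: "(A + \<delta>) * sqrt n \<le> (A + 2 * \<delta>) * sqrt n" "\<delta> * sqrt n \<le> 2 * \<delta> * sqrt n"
    by (rule mult_right_mono; use \<delta>(3) in simp)+
  have pos: "0 \<le> (A + \<delta>) * sqrt n" "0 \<le> \<delta> * sqrt n" using \<delta> by simp_all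
  fix x
  have "card (nbhd (del_vertex E u) x) \<le> card (nbhd E x)"
    using finite_nbhd[OF E, of x] by (intro card_mono) (auto simp: nbhd_del_vertex)
  moreover have "real (card (nbhd E x)) \<le> (A + \<delta>) * sqrt n"
    using reg pos nbhd_eq_empty[OF E, of x] by (cases "x < n") (auto simp: regular_graph_def)
  ultimately show "real (card (nbhd (del_vertex E u) x)) \<le> (A + 2 * \<delta>) * sqrt n"
    using le by linarith
  show "real (card (nbhd (del_vertex E u) x \<inter> nbhd (del_vertex E u) y)) \<le> 2 * \<delta> * sqrt n" if "x \<noteq> y" for y
  proof -
    have "card (nbhd (del_vertex E u) x \<inter> nbhd (del_vertex E u) y) \<le> card (nbhd E x \<inter> nbhd E y)"
      using finite_nbhd[OF E, of x] by (intro card_mono) (auto simp: nbhd_del_vertex)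
    moreover have "real (card (nbhd E x \<inter> nbhd E y)) \<le> \<delta> * sqrt n"
      using reg that pos nbhd_eq_empty[OF E, of x] nbhd_eq_empty[OF E, of y]
      by (cases "x < n"; cases "y < n") (auto simp: regular_graph_def)
    ultimately show ?thesis using le by linarith
  qed
  assume x: "x \<in> {..<n} - {u}"
  have "nbhd (del_vertex E u) x \<inter> ({..<n} - {u}) = nbhd E x - {u}"
    using x nbhd_subset[OF E, of x] by (auto simp: nbhd_del_vertex)
  moreover have "card (nbhd E x) \<le> card (nbhd E x - {u}) + 1"
    using finite_nbhd[OF E, of x] by (cases "u \<in> nbhd E x") (auto simp: card_Diff_singleton)
  moreover have "(a - \<delta>) * sqrt n \<le> real (card (nbhd E x))"
    using reg x by (auto simp: regular_graph_def)
  moreover have "(a - 2 * \<delta>) * sqrt n = (a - \<delta>) * sqrt n - \<delta> * sqrt n"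
    by (simp add: algebra_simps)
  ultimately show "(a - 2 * \<delta>) * sqrt n \<le> real (card (nbhd (del_vertex E u) x \<inter> ({..<n} - {u})))"
    using \<delta>(1) by simp
qed

lemma mean_card_bounds:
  assumes mb: "marginals_within c a0 A0 \<delta> l r n" and t: "t > 0" "\<bar>sqrt n * t - c\<bar> \<le> \<delta>"
    and E: "E \<subseteq> [{..<n}]\<^bsup>2\<^esup>" and v: "v < n"
    and reg: "nearly_regular n a0 A0 \<delta> E ({..<n} - {v})"
  shows "(real n - 1) * l \<le> sqrt n * mean_card (independent_sets E ({..<n} - {v})) t"
    and "sqrt n * mean_card (independent_sets E ({..<n} - {v})) t \<le> (real n - 1) * r"
proof -
  let ?U = "{..<n} - {v}"
  have mean: "sqrt n * mean_card (independent_sets E ?U) t = (\<Sum>w\<in>?U. sqrt n * occupation E ?U t w)"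
    using graph_no_loop[OF E] by (simp add: mean_card_independent_sets sum_distrib_left)
  have card: "real (card ?U) = real n - 1" using v by (simp add: of_nat_diff)
  have occupation: "l \<le> sqrt n * occupation E ?U t w" "sqrt n * occupation E ?U t w \<le> r" if "w \<in> ?U" for w
    using marginals_withinD[OF mb t E _ that reg] by auto
  have "(\<Sum>w\<in>?U. l) \<le> (\<Sum>w\<in>?U. sqrt n * occupation E ?U t w)" by (rule sum_mono) (rule occupation)
  then show "(real n - 1) * l \<le> sqrt n * mean_card (independent_sets E ?U) t"
    unfolding mean by (simp only: sum_constant card)
  have "(\<Sum>w\<in>?U. sqrt n * occupation E ?U t w) \<le> (\<Sum>w\<in>?U. r)" by (rule sum_mono) (rule occupation)
  then show "sqrt n * mean_card (independent_sets E ?U) t \<le> (real n - 1) * r"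
    unfolding mean by (simp only: sum_constant card)
qed

lemma mean_card_le_trivial:
  assumes "t > 0" "E \<subseteq> [{..<n}]\<^bsup>2\<^esup>"
  shows "mean_card (independent_sets E ({..<n} - {v})) t \<le> real n * t"
    and "0 \<le> mean_card (independent_sets E ({..<n} - {v})) t"
proof -
  let ?U = "{..<n} - {v}"
  have mean: "mean_card (independent_sets E ?U) t = (\<Sum>w\<in>?U. occupation E ?U t w)"
    using graph_no_loop[OF assms(2)] by (simp add: mean_card_independent_sets)
  have "(\<Sum>w\<in>?U. occupation E ?U t w) \<le> (\<Sum>w\<in>?U. t)"
    using assms graph_no_loop[OF assms(2)] by (intro sum_mono occupation_le_fugacity) auto
  also have "\<dots> \<le> real n * t"
  proof -
    have "card ?U \<le> n" using card_mono[of "{..<n}" ?U] by auto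
    then show ?thesis using assms by simp
  qed
  finally show "mean_card (independent_sets E ?U) t \<le> real n * t" by (simp add: mean)
  show "0 \<le> mean_card (independent_sets E ?U) t"
    unfolding mean using assms by (intro sum_nonneg occupation_nonneg) auto
qed

text \<open>A union bound over the vertices: where \<open>Q\<close> holds, each vertex contributes
  at most \<open>exp (- \<eta> * sqrt n)\<close>, and the failure of \<open>Q\<close> is charged
  once for all vertices. The sign of \<open>ln s\<close> selects the tail.\<close>

lemma degree_tail_tendsto:
  assumes c: "c > 0" and s: "s > 0" and \<eta>: "\<eta> > 0"
    and Q: "(\<lambda>n. gibbs_prob n (c / sqrt n) (\<lambda>E. \<exists>u<n. \<not> Q n u (del_vertex E u))) \<longlonglongrightarrow> 0"
    and mean: "\<forall>\<^sub>F n in sequentially. \<forall>E\<in>triangle_free_graphs n. \<forall>u<n. Q n u (del_vertex E u) \<longrightarrow>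
       ln s * (mean_card (independent_sets (del_vertex E u) ({..<n} - {u})) (s * (c / sqrt n)) - x n) \<le> - \<eta> * sqrt n"
  shows "(\<lambda>n. gibbs_prob n (c / sqrt n) (\<lambda>E. \<exists>u<n. ln s * (real (card (nbhd E u)) - x n) \<ge> 0)) \<longlonglongrightarrow> 0"
proof (rule tendsto_sandwich[OF _ _ tendsto_const])
  let ?B = "\<lambda>n E. \<exists>u<n. \<not> Q n u (del_vertex E u)"
  let ?T = "\<lambda>n E u. ln s * (real (card (nbhd E u)) - x n) \<ge> 0"
  show "\<forall>\<^sub>F n in sequentially. 0 \<le> gibbs_prob n (c / sqrt n) (\<lambda>E. \<exists>u<n. ?T n E u)"
    using c by (intro always_eventually allI gibbs_prob_nonneg) simp
  have "(\<lambda>n. real n * exp (- \<eta> * sqrt n)) \<longlonglongrightarrow> 0"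
    using \<eta> by real_asymp
  from tendsto_add[OF Q this]
  show "(\<lambda>n. gibbs_prob n (c / sqrt n) (?B n) + real n * exp (- \<eta> * sqrt n)) \<longlonglongrightarrow> 0" by simp
  show "\<forall>\<^sub>F n in sequentially. gibbs_prob n (c / sqrt n) (\<lambda>E. \<exists>u<n. ?T n E u)
      \<le> gibbs_prob n (c / sqrt n) (?B n) + real n * exp (- \<eta> * sqrt n)"
    using mean eventually_gt_at_top[of 0]
  proof eventually_elim
    fix n :: nat
    assume mean: "\<forall>E\<in>triangle_free_graphs n. \<forall>u<n. Q n u (del_vertex E u) \<longrightarrow>
       ln s * (mean_card (independent_sets (del_vertex E u) ({..<n} - {u})) (s * (c / sqrt n)) - x n) \<le> - \<eta> * sqrt n"
      and n: "n > 0"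
    let ?t = "c / sqrt n"
    have t: "?t > 0" using c n by simp
    have "gibbs_prob n ?t (\<lambda>E. \<exists>u<n. ?T n E u)
        \<le> gibbs_prob n ?t (\<lambda>E. ?B n E \<or> (\<exists>u\<in>{..<n}. Q n u (del_vertex E u) \<and> ?T n E u))"
      using t by (intro gibbs_prob_mono) auto
    also have "\<dots> \<le> gibbs_prob n ?t (?B n) + gibbs_prob n ?t (\<lambda>E. \<exists>u\<in>{..<n}. Q n u (del_vertex E u) \<and> ?T n E u)"
      using t by (intro gibbs_prob_or_le) simp
    also have "gibbs_prob n ?t (\<lambda>E. \<exists>u\<in>{..<n}. Q n u (del_vertex E u) \<and> ?T n E u)
        \<le> (\<Sum>u\<in>{..<n}. gibbs_prob n ?t (\<lambda>E. Q n u (del_vertex E u) \<and> ?T n E u))"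
      using t by (intro gibbs_prob_ex_le) auto
    also have "\<dots> \<le> (\<Sum>u\<in>{..<n}. exp (- \<eta> * sqrt n))"
    proof (rule sum_mono)
      fix u assume "u \<in> {..<n}"
      then have "(\<Sum>E\<in>{E\<in>triangle_free_graphs n. Q n u (del_vertex E u) \<and> ?T n E u}. ?t ^ card E)
          \<le> part_fun (triangle_free_graphs n) ?t * exp (- \<eta> * sqrt n)"
        using mean by (intro sum_degree_tail_triangle_free t s) auto
      then show "gibbs_prob n ?t (\<lambda>E. Q n u (del_vertex E u) \<and> ?T n E u) \<le> exp (- \<eta> * sqrt n)"
        unfolding gibbs_prob_def using part_fun_triangle_free_pos[of ?t n] t
        by (simp add: pos_divide_le_eq mult.commute)
    qed
    finally show "gibbs_prob n ?t (\<lambda>E. \<exists>u<n. ?T n E u) \<le> gibbs_prob n ?t (?B n) + real n * exp (- \<eta> * sqrt n)"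
      by simp
  qed
qed

lemma gibbs_prob_tendsto_mono:
  assumes "(\<lambda>n. gibbs_prob n (t n) (Q n)) \<longlonglongrightarrow> 0" "\<And>n. t n \<ge> 0"
    and "\<forall>\<^sub>F n in sequentially. \<forall>E\<in>triangle_free_graphs n. P n E \<longrightarrow> Q n E"
  shows "(\<lambda>n. gibbs_prob n (t n) (P n)) \<longlonglongrightarrow> 0"
proof (rule tendsto_sandwich[OF _ _ tendsto_const assms(1)])
  show "\<forall>\<^sub>F n in sequentially. 0 \<le> gibbs_prob n (t n) (P n)"
    using assms(2) by (intro always_eventually allI gibbs_prob_nonneg)
  show "\<forall>\<^sub>F n in sequentially. gibbs_prob n (t n) (P n) \<le> gibbs_prob n (t n) (Q n)"
    using assms(3) by eventually_elim (use assms(2) in \<open>auto intro!: gibbs_prob_mono\<close>)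
qed

lemma degree_bounds_trivial:
  assumes c: "c > 0"
  shows "degree_bounds c 0 c"
  unfolding degree_bounds_def
proof (intro allI impI)
  fix \<epsilon> :: real assume \<epsilon>: "\<epsilon> > 0"
  \<comment> \<open>The tilted mean is then at most \<open>(c + \<epsilon> / 2) * sqrt n\<close>,
    which leaves a gap of \<open>\<epsilon> / 2\<close> below the threshold.\<close>
  define s where "s = 1 + \<epsilon> / (2 * c)"
  have s: "s > 1" "s * c = c + \<epsilon> / 2" using c \<epsilon> by (auto simp: s_def field_simps)
  have "(\<lambda>n. gibbs_prob n (c / sqrt n) (\<lambda>E. \<exists>u<n. ln s * (real (card (nbhd E u)) - (c + \<epsilon>) * sqrt n) \<ge> 0)) \<longlonglongrightarrow> 0"
  proof (rule degree_tail_tendsto[where \<eta> = "ln s * (\<epsilon> / 2)" and Q = "\<lambda>_ _ _. True"])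
    have "gibbs_prob n (c / sqrt n) (\<lambda>E. False) = 0" for n by (simp add: gibbs_prob_def)
    then show "(\<lambda>n. gibbs_prob n (c / sqrt n) (\<lambda>E. \<exists>u<n. \<not> True)) \<longlonglongrightarrow> 0" by simp
    show "\<forall>\<^sub>F n in sequentially. \<forall>E\<in>triangle_free_graphs n. \<forall>u<n. True \<longrightarrow>
       ln s * (mean_card (independent_sets (del_vertex E u) ({..<n} - {u})) (s * (c / sqrt n)) - (c + \<epsilon>) * sqrt n)
       \<le> - (ln s * (\<epsilon> / 2)) * sqrt n"
      using eventually_gt_at_top[of 0]
    proof (eventually_elim, intro ballI allI impI)
      fix n u :: nat and E assume n: "n > 0" and E: "E \<in> triangle_free_graphs n"
      have sub: "del_vertex E u \<subseteq> [{..<n}]\<^bsup>2\<^esup>"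
        using triangle_free_graphs_subset[OF E] del_vertex_subset[of E u] by blast
      have "s * (c / sqrt n) > 0" using s(1) c n by simp
      then have "mean_card (independent_sets (del_vertex E u) ({..<n} - {u})) (s * (c / sqrt n)) \<le> real n * (s * (c / sqrt n))"
        using sub by (intro mean_card_le_trivial)
      also have "\<dots> = (s * c) * (real n / sqrt n)" by simp
      also have "\<dots> = (c + \<epsilon> / 2) * sqrt n"
        unfolding s(2) by (simp add: real_div_sqrt)
      finally have "mean_card (independent_sets (del_vertex E u) ({..<n} - {u})) (s * (c / sqrt n)) - (c + \<epsilon>) * sqrt n
          \<le> - (\<epsilon> / 2) * sqrt n" by (simp add: algebra_simps)
      then have "ln s * (mean_card (independent_sets (del_vertex E u) ({..<n} - {u})) (s * (c / sqrt n)) - (c + \<epsilon>) * sqrt n)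
          \<le> ln s * (- (\<epsilon> / 2) * sqrt n)"
        using s(1) by (intro mult_left_mono) auto
      then show "ln s * (mean_card (independent_sets (del_vertex E u) ({..<n} - {u})) (s * (c / sqrt n)) - (c + \<epsilon>) * sqrt n)
       \<le> - (ln s * (\<epsilon> / 2)) * sqrt n" by simp
    qed
  qed (use s c \<epsilon> in auto)
  then show "(\<lambda>n. gibbs_prob n (c / sqrt n)
     (\<lambda>E. \<exists>x<n. real (card (nbhd E x)) < (0 - \<epsilon>) * sqrt n \<or> (c + \<epsilon>) * sqrt n < real (card (nbhd E x))))
     \<longlonglongrightarrow> 0"
  proof (rule gibbs_prob_tendsto_mono; (intro always_eventually allI ballI impI)?)
    fix n :: nat and E :: "nat set set"
    assume "\<exists>x<n. real (card (nbhd E x)) < (0 - \<epsilon>) * sqrt n \<or> (c + \<epsilon>) * sqrt n < real (card (nbhd E x))"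
    then obtain x where x: "x < n"
      "real (card (nbhd E x)) < (0 - \<epsilon>) * sqrt n \<or> (c + \<epsilon>) * sqrt n < real (card (nbhd E x))" by blast
    have "0 \<le> \<epsilon> * sqrt n" using \<epsilon> by simp
    then have "(0 - \<epsilon>) * sqrt n \<le> real (card (nbhd E x))" by simp
    with x have "0 \<le> ln s * (real (card (nbhd E x)) - (c + \<epsilon>) * sqrt n)"
      using s(1) by (intro mult_nonneg_nonneg) auto
    with x(1) show "\<exists>u<n. ln s * (real (card (nbhd E u)) - (c + \<epsilon>) * sqrt n) \<ge> 0" by blast
  qed (use c in simp)
qed

text \<open>Summing \<open>n - 1\<close> marginals of order n^(-1/2) gives the scale
  \<open>sqrt n\<close>. Half of \<open>\<epsilon>\<close> covers the error of the marginals, the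
  other half the difference between \<open>n - 1\<close> and \<open>n\<close>.\<close>

lemma mean_card_marginal_bounds:
  assumes mb: "marginal_bounds c a0 A0 a A" and nonneg: "a \<ge> 0" "A \<ge> 0" and \<epsilon>: "\<epsilon> > 0"
  obtains \<delta> where "\<delta> > 0"
    "\<forall>\<^sub>F n in sequentially. \<forall>t>0. \<forall>E u. \<bar>sqrt n * t - c\<bar> \<le> \<delta> \<longrightarrow> E \<subseteq> [{..<n}]\<^bsup>2\<^esup> \<longrightarrow> u < n \<longrightarrow>
       nearly_regular n a0 A0 \<delta> E ({..<n} - {u}) \<longrightarrow>
       mean_card (independent_sets E ({..<n} - {u})) t \<in> {(a - \<epsilon>) * sqrt n..(A + \<epsilon>) * sqrt n}"
proof -
  from \<epsilon> have "\<epsilon> / 2 > 0" by simp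
  with mb obtain \<delta> where \<delta>: "\<delta> > 0"
    and within: "\<forall>\<^sub>F n in sequentially. marginals_within c a0 A0 \<delta> (a - \<epsilon> / 2) (A + \<epsilon> / 2) n"
    unfolding marginal_bounds_def by meson
  have "\<forall>\<^sub>F n in sequentially. a \<le> real n * (\<epsilon> / 2)" using \<epsilon> by real_asymp
  with within eventually_gt_at_top[of 0]
  have "\<forall>\<^sub>F n in sequentially. \<forall>t>0. \<forall>E u. \<bar>sqrt n * t - c\<bar> \<le> \<delta> \<longrightarrow> E \<subseteq> [{..<n}]\<^bsup>2\<^esup> \<longrightarrow> u < n \<longrightarrow>
       nearly_regular n a0 A0 \<delta> E ({..<n} - {u}) \<longrightarrow>
       mean_card (independent_sets E ({..<n} - {u})) t \<in> {(a - \<epsilon>) * sqrt n..(A + \<epsilon>) * sqrt n}"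
  proof (eventually_elim, intro allI impI)
    fix n u :: nat and t E
    assume w: "marginals_within c a0 A0 \<delta> (a - \<epsilon> / 2) (A + \<epsilon> / 2) n" and n: "n > 0" "a \<le> real n * (\<epsilon> / 2)"
      and *: "t > 0" "\<bar>sqrt n * t - c\<bar> \<le> \<delta>" "E \<subseteq> [{..<n}]\<^bsup>2\<^esup>" "u < n"
        "nearly_regular n a0 A0 \<delta> E ({..<n} - {u})"
    let ?m = "mean_card (independent_sets E ({..<n} - {u})) t"
    note b = mean_card_bounds[OF w *]
    have sq: "sqrt n > 0" "sqrt n * sqrt n = real n" using n by auto
    have eq: "sqrt n * (y * sqrt n) = real n * y" for y
    proof -
      have "sqrt n * (y * sqrt n) = (sqrt n * sqrt n) * y" by (simp only: mult_ac)
      then show ?thesis by (simp only: sq(2))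
    qed
    have "sqrt n * ((a - \<epsilon>) * sqrt n) = real n * (a - \<epsilon>)" by (rule eq)
    also have "\<dots> \<le> (real n - 1) * (a - \<epsilon> / 2)"
    proof -
      have "(real n - 1) * (a - \<epsilon> / 2) = real n * (a - \<epsilon>) + (real n * (\<epsilon> / 2) - a) + \<epsilon> / 2"
        by (simp add: field_simps)
      then show ?thesis using n(2) \<epsilon> by linarith
    qed
    also have "\<dots> \<le> sqrt n * ?m" by (rule b)
    finally have lower: "(a - \<epsilon>) * sqrt n \<le> ?m" using sq(1) by (simp only: mult_le_cancel_left_pos)
    have "sqrt n * ?m \<le> (real n - 1) * (A + \<epsilon> / 2)" by (rule b)
    also have "\<dots> \<le> real n * (A + \<epsilon>)"
      using nonneg \<epsilon> by (intro mult_mono) auto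
    also have "\<dots> = sqrt n * ((A + \<epsilon>) * sqrt n)"
      by (rule eq[symmetric])
    finally have "?m \<le> (A + \<epsilon>) * sqrt n" using sq(1) by (simp only: mult_le_cancel_left_pos)
    with lower show "?m \<in> {(a - \<epsilon>) * sqrt n..(A + \<epsilon>) * sqrt n}" by simp
  qed
  with \<delta> show thesis by (rule that)
qed

lemma not_nearly_regular_tendsto:
  assumes deg: "degree_bounds c a0 A0" and c: "0 < c" "c < 1" and "A0 \<ge> 0" "\<delta> > 0"
  shows "(\<lambda>n. gibbs_prob n (c / sqrt n)
    (\<lambda>E. \<exists>u<n. \<not> nearly_regular n a0 A0 \<delta> (del_vertex E u) ({..<n} - {u}))) \<longlonglongrightarrow> 0"
proof (rule gibbs_prob_tendsto_mono[OF irregular_tendsto[OF deg c, of "\<delta> / 2"]])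
  have "\<forall>\<^sub>F n in sequentially. 1 \<le> \<delta> / 2 * sqrt (real n)" using assms(5) by real_asymp
  then show "\<forall>\<^sub>F n in sequentially. \<forall>E\<in>triangle_free_graphs n.
      (\<exists>u<n. \<not> nearly_regular n a0 A0 \<delta> (del_vertex E u) ({..<n} - {u})) \<longrightarrow> \<not> regular_graph n a0 A0 (\<delta> / 2) E"
  proof (eventually_elim, intro ballI impI notI)
    fix n :: nat and E
    assume n: "1 \<le> \<delta> / 2 * sqrt (real n)" and E: "E \<in> triangle_free_graphs n"
      and ex: "\<exists>u<n. \<not> nearly_regular n a0 A0 \<delta> (del_vertex E u) ({..<n} - {u})"
      and reg: "regular_graph n a0 A0 (\<delta> / 2) E"
    have "nearly_regular n a0 A0 (2 * (\<delta> / 2)) (del_vertex E u) ({..<n} - {u})" if "u < n" for u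
      using assms(4,5) by (intro regular_graph_del_vertex[OF reg triangle_free_graphs_subset[OF E] that n]) auto
    then show False using ex by auto
  qed
qed (use assms in auto)

text \<open>When the graph without \<open>u\<close> is nearly regular, the conditional mean degree
  of \<open>u\<close> lies in the new window, even at slightly tilted fugacities. Tilting by
  \<open>1 + r\<close> bounds the upper tail, by \<open>1 - r\<close> the lower one.\<close>

lemma degree_bounds_step:
  assumes deg: "degree_bounds c a0 A0" and mb: "marginal_bounds c a0 A0 a A"
    and c: "0 < c" "c < 1" and nonneg: "a \<ge> 0" "A \<ge> 0" "A0 \<ge> 0"
  shows "degree_bounds c a A"
  unfolding degree_bounds_def
proof (intro allI impI)
  fix \<epsilon> :: real assume \<epsilon>: "\<epsilon> > 0"
  then have "\<epsilon> / 2 > 0" by simp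
  from mean_card_marginal_bounds[OF mb nonneg(1,2) this]
  obtain \<delta> where \<delta>: "\<delta> > 0" and mean:
    "\<forall>\<^sub>F n in sequentially. \<forall>t>0. \<forall>E u. \<bar>sqrt n * t - c\<bar> \<le> \<delta> \<longrightarrow> E \<subseteq> [{..<n}]\<^bsup>2\<^esup> \<longrightarrow> u < n \<longrightarrow>
       nearly_regular n a0 A0 \<delta> E ({..<n} - {u}) \<longrightarrow>
       mean_card (independent_sets E ({..<n} - {u})) t \<in> {(a - \<epsilon> / 2) * sqrt n..(A + \<epsilon> / 2) * sqrt n}" .
  \<comment> \<open>\<open>r * c \<le> \<delta>\<close> keeps the tilted fugacities inside the
    window of \<open>mean\<close>; the cap 1/2 keeps \<open>1 - r\<close> positive.\<close>
  define r where "r = min (\<delta> / c) (1 / 2)"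
  have r: "0 < r" "r < 1" "r * c \<le> \<delta>"
    using \<delta> c by (auto simp: r_def min_def field_simps)
  note irr = not_nearly_regular_tendsto[OF deg c nonneg(3) \<delta>]
  have tail: "(\<lambda>n. gibbs_prob n (c / sqrt n) (\<lambda>E. \<exists>u<n. ln s * (real (card (nbhd E u)) - x * sqrt n) \<ge> 0)) \<longlonglongrightarrow> 0"
    if s: "s > 0" "\<bar>s - 1\<bar> = r"
      and gap: "\<And>y. y \<in> {a - \<epsilon> / 2..A + \<epsilon> / 2} \<Longrightarrow> ln s * (y - x) \<le> - \<bar>ln s\<bar> * (\<epsilon> / 2)" for s x
  proof (rule degree_tail_tendsto[where \<eta> = "\<bar>ln s\<bar> * (\<epsilon> / 2)" and
        Q = "\<lambda>n u E. nearly_regular n a0 A0 \<delta> E ({..<n} - {u})"])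
    show "\<forall>\<^sub>F n in sequentially. \<forall>E\<in>triangle_free_graphs n. \<forall>u<n.
       nearly_regular n a0 A0 \<delta> (del_vertex E u) ({..<n} - {u}) \<longrightarrow>
       ln s * (mean_card (independent_sets (del_vertex E u) ({..<n} - {u})) (s * (c / sqrt n)) - x * sqrt n)
       \<le> - (\<bar>ln s\<bar> * (\<epsilon> / 2)) * sqrt n"
      using mean eventually_gt_at_top[of 0]
    proof (eventually_elim, intro ballI allI impI)
      fix n u :: nat and E
      assume mean: "\<forall>t>0. \<forall>E u. \<bar>sqrt n * t - c\<bar> \<le> \<delta> \<longrightarrow> E \<subseteq> [{..<n}]\<^bsup>2\<^esup> \<longrightarrow> u < n \<longrightarrow>
           nearly_regular n a0 A0 \<delta> E ({..<n} - {u}) \<longrightarrow>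
           mean_card (independent_sets E ({..<n} - {u})) t \<in> {(a - \<epsilon> / 2) * sqrt n..(A + \<epsilon> / 2) * sqrt n}"
        and n: "n > 0" and E: "E \<in> triangle_free_graphs n" and u: "u < n"
        and reg: "nearly_regular n a0 A0 \<delta> (del_vertex E u) ({..<n} - {u})"
      let ?m = "mean_card (independent_sets (del_vertex E u) ({..<n} - {u})) (s * (c / sqrt n))"
      have sub: "del_vertex E u \<subseteq> [{..<n}]\<^bsup>2\<^esup>"
        using triangle_free_graphs_subset[OF E] del_vertex_subset[of E u] by blast
      have t: "s * (c / sqrt n) > 0" using s(1) c n by simp
      have sq: "sqrt n > 0" using n by simp
      have "\<bar>sqrt n * (s * (c / sqrt n)) - c\<bar> = \<bar>(s - 1) * c\<bar>"
        using sq by (simp add: algebra_simps)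
      also have "\<dots> \<le> \<delta>" using r s(2) c by (simp add: abs_mult)
      finally have "?m \<in> {(a - \<epsilon> / 2) * sqrt n..(A + \<epsilon> / 2) * sqrt n}"
        using mean t sub u reg by blast
      then have "?m / sqrt n \<in> {a - \<epsilon> / 2..A + \<epsilon> / 2}"
        using sq by (simp add: pos_le_divide_eq pos_divide_le_eq)
      from mult_right_mono[OF gap[OF this], of "sqrt n"]
      show "ln s * (?m - x * sqrt n) \<le> - (\<bar>ln s\<bar> * (\<epsilon> / 2)) * sqrt n"
        using sq by (simp add: left_diff_distrib mult.assoc)
    qed
    have "s \<noteq> 1" using s r by auto
    then have "ln s \<noteq> 0" using s(1) by simp
    then show "\<bar>ln s\<bar> * (\<epsilon> / 2) > 0" using \<epsilon> by simp
  qed (use s c irr in auto)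
  have up: "(\<lambda>n. gibbs_prob n (c / sqrt n)
      (\<lambda>E. \<exists>u<n. ln (1 + r) * (real (card (nbhd E u)) - (A + \<epsilon>) * sqrt n) \<ge> 0)) \<longlonglongrightarrow> 0"
  proof (rule tail)
    fix y assume "y \<in> {a - \<epsilon> / 2..A + \<epsilon> / 2}"
    then have "y - (A + \<epsilon>) \<le> - (\<epsilon> / 2)" by simp
    moreover have "ln (1 + r) > 0" using r by simp
    ultimately have "ln (1 + r) * (y - (A + \<epsilon>)) \<le> ln (1 + r) * (- (\<epsilon> / 2))"
      by (intro mult_left_mono) auto
    then show "ln (1 + r) * (y - (A + \<epsilon>)) \<le> - \<bar>ln (1 + r)\<bar> * (\<epsilon> / 2)"
      using \<open>ln (1 + r) > 0\<close> by simp
  qed (use r in auto)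
  have low: "(\<lambda>n. gibbs_prob n (c / sqrt n)
      (\<lambda>E. \<exists>u<n. ln (1 - r) * (real (card (nbhd E u)) - (a - \<epsilon>) * sqrt n) \<ge> 0)) \<longlonglongrightarrow> 0"
  proof (rule tail)
    fix y assume "y \<in> {a - \<epsilon> / 2..A + \<epsilon> / 2}"
    then have "y - (a - \<epsilon>) \<ge> \<epsilon> / 2" by simp
    moreover have neg: "ln (1 - r) < 0" using r by simp
    ultimately have "ln (1 - r) * (y - (a - \<epsilon>)) \<le> ln (1 - r) * (\<epsilon> / 2)"
      by (intro mult_left_mono_neg) auto
    then show "ln (1 - r) * (y - (a - \<epsilon>)) \<le> - \<bar>ln (1 - r)\<bar> * (\<epsilon> / 2)"
      using neg by simp
  qed (use r in auto)
  let ?L = "\<lambda>(n::nat) (E::nat set set). \<exists>u<n. ln (1 - r) * (real (card (nbhd E u)) - (a - \<epsilon>) * sqrt n) \<ge> 0"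
  let ?U = "\<lambda>(n::nat) (E::nat set set). \<exists>u<n. ln (1 + r) * (real (card (nbhd E u)) - (A + \<epsilon>) * sqrt n) \<ge> 0"
  have both: "(\<lambda>n. gibbs_prob n (c / sqrt n) (\<lambda>E. ?L n E \<or> ?U n E)) \<longlonglongrightarrow> 0"
  proof (rule tendsto_sandwich[OF _ _ tendsto_const])
    show "\<forall>\<^sub>F n in sequentially. 0 \<le> gibbs_prob n (c / sqrt n) (\<lambda>E. ?L n E \<or> ?U n E)"
      using c by (intro always_eventually allI gibbs_prob_nonneg) simp
    show "\<forall>\<^sub>F n in sequentially. gibbs_prob n (c / sqrt n) (\<lambda>E. ?L n E \<or> ?U n E)
        \<le> gibbs_prob n (c / sqrt n) (?L n) + gibbs_prob n (c / sqrt n) (?U n)"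
      using c by (intro always_eventually allI gibbs_prob_or_le) simp
    show "(\<lambda>n. gibbs_prob n (c / sqrt n) (?L n) + gibbs_prob n (c / sqrt n) (?U n)) \<longlonglongrightarrow> 0"
      using tendsto_add[OF low up] by simp
  qed
  show "(\<lambda>n. gibbs_prob n (c / sqrt n)
     (\<lambda>E. \<exists>x<n. real (card (nbhd E x)) < (a - \<epsilon>) * sqrt n \<or> (A + \<epsilon>) * sqrt n < real (card (nbhd E x))))
     \<longlonglongrightarrow> 0"
  proof (rule gibbs_prob_tendsto_mono[OF both]; (intro always_eventually allI ballI impI)?)
    fix n :: nat and E :: "nat set set"
    assume "\<exists>x<n. real (card (nbhd E x)) < (a - \<epsilon>) * sqrt n \<or> (A + \<epsilon>) * sqrt n < real (card (nbhd E x))"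
    then obtain x where x: "x < n"
      "real (card (nbhd E x)) < (a - \<epsilon>) * sqrt n \<or> (A + \<epsilon>) * sqrt n < real (card (nbhd E x))" by blast
    from x(2) show "?L n E \<or> ?U n E"
    proof
      assume "real (card (nbhd E x)) < (a - \<epsilon>) * sqrt n"
      then have "0 \<le> ln (1 - r) * (real (card (nbhd E x)) - (a - \<epsilon>) * sqrt n)"
        using r by (intro mult_nonpos_nonpos) auto
      with x(1) show ?thesis by blast
    next
      assume "(A + \<epsilon>) * sqrt n < real (card (nbhd E x))"
      then have "0 \<le> ln (1 + r) * (real (card (nbhd E x)) - (A + \<epsilon>) * sqrt n)"
        using r by (intro mult_nonneg_nonneg) auto
      with x(1) show ?thesis by blast
    qed
  qed (use c in simp)
qed

subsection \<open>The mean number of edges\<close>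

text \<open>The handshake identity, with each expected degree replaced by the average of its
  conditional mean.\<close>

lemma mean_edges_eq:
  assumes "t > 0"
  shows "2 * mean_card (triangle_free_graphs n) t =
    (\<Sum>E\<in>triangle_free_graphs n. t ^ card E *
       (\<Sum>u<n. mean_card (independent_sets (del_vertex E u) ({..<n} - {u})) t)) / part_fun (triangle_free_graphs n) t"
proof -
  let ?T = "triangle_free_graphs n"
  have "(\<Sum>E\<in>?T. t ^ card E * (\<Sum>u<n. mean_card (independent_sets (del_vertex E u) ({..<n} - {u})) t))
      = (\<Sum>u<n. \<Sum>E\<in>?T. t ^ card E * mean_card (independent_sets (del_vertex E u) ({..<n} - {u})) t)"
    unfolding sum_distrib_left by (rule sum.swap)
  also have "\<dots> = (\<Sum>u<n. \<Sum>E\<in>?T. t ^ card E * real (card (nbhd E u)))"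
  proof (rule sum.cong)
    fix u assume "u \<in> {..<n}"
    then have "u < n" by simp
    then show "(\<Sum>E\<in>?T. t ^ card E * mean_card (independent_sets (del_vertex E u) ({..<n} - {u})) t)
        = (\<Sum>E\<in>?T. t ^ card E * real (card (nbhd E u)))"
      by (rule sum_degree_triangle_free[symmetric, OF _ assms])
  qed simp
  also have "\<dots> = (\<Sum>E\<in>?T. \<Sum>u<n. t ^ card E * real (card (nbhd E u)))"
    by (rule sum.swap)
  also have "\<dots> = (\<Sum>E\<in>?T. 2 * (t ^ card E * real (card E)))"
  proof (intro sum.cong refl)
    fix E assume "E \<in> ?T"
    then have "(\<Sum>u<n. card (nbhd E u)) = 2 * card E"
      by (intro sum_degrees triangle_free_graphs_subset)
    then have "(\<Sum>u<n. real (card (nbhd E u))) = 2 * real (card E)"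
      by (simp flip: of_nat_sum)
    then show "(\<Sum>u<n. t ^ card E * real (card (nbhd E u))) = 2 * (t ^ card E * real (card E))"
      by (simp flip: sum_distrib_left)
  qed
  finally show ?thesis
    by (simp add: mean_card_def sum_distrib_left[symmetric])
qed

text \<open>Crude bounds for every \<open>n\<close> and \<open>t\<close>; they supply the integrable
  majorant when the limit is taken under the integral over fugacities.\<close>

lemma mean_edges_le:
  assumes "t > 0"
  shows "mean_card (triangle_free_graphs n) t \<le> (real n)\<^sup>2 * t / 2" "0 \<le> mean_card (triangle_free_graphs n) t"
proof -
  let ?T = "triangle_free_graphs n"
  have Z: "part_fun ?T t > 0" using assms by (simp add: part_fun_triangle_free_pos)
  have "(\<Sum>E\<in>?T. t ^ card E * (\<Sum>u<n. mean_card (independent_sets (del_vertex E u) ({..<n} - {u})) t))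
      \<le> (\<Sum>E\<in>?T. t ^ card E * (\<Sum>u<n. real n * t))"
  proof (intro sum_mono mult_left_mono)
    fix E u assume "E \<in> ?T"
    then have "del_vertex E u \<subseteq> [{..<n}]\<^bsup>2\<^esup>"
      using triangle_free_graphs_subset[of E n] del_vertex_subset[of E u] by blast
    then show "mean_card (independent_sets (del_vertex E u) ({..<n} - {u})) t \<le> real n * t"
      using assms by (intro mean_card_le_trivial)
  qed (use assms in auto)
  also have "\<dots> = part_fun ?T t * ((real n)\<^sup>2 * t)"
    by (simp add: part_fun_def sum_distrib_right power2_eq_square mult.assoc)
  finally have "2 * mean_card ?T t \<le> (real n)\<^sup>2 * t"
    unfolding mean_edges_eq[OF assms] using Z by (simp add: pos_divide_le_eq mult.commute)
  then show "mean_card ?T t \<le> (real n)\<^sup>2 * t / 2" by simp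
  show "0 \<le> mean_card ?T t"
    unfolding mean_card_def using assms Z by (intro divide_nonneg_nonneg sum_nonneg) auto
qed

text \<open>Outside the exceptional event \<open>B\<close> every conditional mean degree lies in the
  window. On \<open>B\<close>, which has vanishing probability, only the trivial bounds are
  available.\<close>

lemma mean_edges_bounds:
  assumes deg: "degree_bounds c a0 A0" and mb: "marginal_bounds c a0 A0 a A"
    and c: "0 < c" "c < 1" and nonneg: "a \<ge> 0" "A \<ge> 0" "A0 \<ge> 0" and \<epsilon>: "\<epsilon> > 0"
  shows "\<forall>\<^sub>F n in sequentially. 2 * mean_card (triangle_free_graphs n) (c / sqrt n) / (real n * sqrt n) \<in> {a - \<epsilon>..A + \<epsilon>}"
proof -
  from \<epsilon> have "\<epsilon> / 2 > 0" by simp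
  from mean_card_marginal_bounds[OF mb nonneg(1,2) this]
  obtain \<delta> where \<delta>: "\<delta> > 0" and mean:
    "\<forall>\<^sub>F n in sequentially. \<forall>t>0. \<forall>E u. \<bar>sqrt n * t - c\<bar> \<le> \<delta> \<longrightarrow> E \<subseteq> [{..<n}]\<^bsup>2\<^esup> \<longrightarrow> u < n \<longrightarrow>
       nearly_regular n a0 A0 \<delta> E ({..<n} - {u}) \<longrightarrow>
       mean_card (independent_sets E ({..<n} - {u})) t \<in> {(a - \<epsilon> / 2) * sqrt n..(A + \<epsilon> / 2) * sqrt n}" .
  define B where "B = (\<lambda>n E. \<exists>u<n. \<not> nearly_regular n a0 A0 \<delta> (del_vertex E u) ({..<n} - {u}))"
  \<comment> \<open>Per vertex and in units of \<open>sqrt n\<close>, an exceptional graph adds at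
    most \<open>c\<close> to the upper bound and takes at most \<open>a\<close> from the lower one.
    With probability below \<open>\<epsilon> / (2 * M)\<close> either effect stays within
    \<open>\<epsilon> / 2\<close>.\<close>
  define M where "M = max c a"
  have M: "M > 0" "c \<le> M" "a \<le> M" using c by (auto simp: M_def)
  have "(\<lambda>n. gibbs_prob n (c / sqrt n) (B n)) \<longlonglongrightarrow> 0"
    unfolding B_def by (rule not_nearly_regular_tendsto[OF deg c nonneg(3) \<delta>])
  then have "\<forall>\<^sub>F n in sequentially. gibbs_prob n (c / sqrt n) (B n) < \<epsilon> / (2 * M)"
    by (rule order_tendstoD) (use \<epsilon> M in simp)
  with mean eventually_gt_at_top[of 0] show ?thesis
  proof eventually_elim
    fix n :: nat
    assume mean: "\<forall>t>0. \<forall>E u. \<bar>sqrt n * t - c\<bar> \<le> \<delta> \<longrightarrow> E \<subseteq> [{..<n}]\<^bsup>2\<^esup> \<longrightarrow> u < n \<longrightarrow>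
           nearly_regular n a0 A0 \<delta> E ({..<n} - {u}) \<longrightarrow>
           mean_card (independent_sets E ({..<n} - {u})) t \<in> {(a - \<epsilon> / 2) * sqrt n..(A + \<epsilon> / 2) * sqrt n}"
      and n: "n > 0" and bad: "gibbs_prob n (c / sqrt n) (B n) < \<epsilon> / (2 * M)"
    let ?T = "triangle_free_graphs n"
    define t where "t = c / sqrt n"
    define Z where "Z = part_fun ?T t"
    define m where "m = (\<lambda>E u. mean_card (independent_sets (del_vertex E u) ({..<n} - {u})) t)"
    have sq: "sqrt n > 0" using n by simp
    have t: "t > 0" "sqrt n * t = c" using c n by (simp_all add: t_def)
    have Z: "Z > 0" unfolding Z_def using t by (simp add: part_fun_triangle_free_pos)
    have pb: "(\<Sum>E\<in>?T. t ^ card E * of_bool (B n E)) = gibbs_prob n t (B n) * Z"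
    proof -
      have "(\<Sum>E\<in>?T. t ^ card E * of_bool (B n E)) = (\<Sum>E\<in>{E\<in>?T. B n E}. t ^ card E)"
        by (rule sum.mono_neutral_cong_right) auto
      then show ?thesis using Z unfolding gibbs_prob_def Z_def[symmetric] by simp
    qed
    have pb_nonneg: "gibbs_prob n t (B n) \<ge> 0" using t by (intro gibbs_prob_nonneg) simp
    have sum_const: "(\<Sum>E\<in>?T. t ^ card E * (real n * sqrt n * (x + y * of_bool (B n E))))
        = Z * (real n * sqrt n) * (x + y * gibbs_prob n t (B n))" for x y
    proof -
      have "(\<Sum>E\<in>?T. t ^ card E * (real n * sqrt n * (x + y * of_bool (B n E))))
          = (\<Sum>E\<in>?T. real n * sqrt n * x * t ^ card E + real n * sqrt n * y * (t ^ card E * of_bool (B n E)))"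
        by (intro sum.cong refl) (simp add: algebra_simps)
      also have "\<dots> = real n * sqrt n * x * Z + real n * sqrt n * y * (gibbs_prob n t (B n) * Z)"
        unfolding sum.distrib sum_distrib_left[symmetric] pb by (simp add: Z_def part_fun_def)
      finally show ?thesis by (simp add: algebra_simps)
    qed
    have m_bounds: "m E u \<le> sqrt n * ((A + \<epsilon> / 2) + c * of_bool (B n E))"
      "sqrt n * ((a - \<epsilon> / 2) + (- a) * of_bool (B n E)) \<le> m E u"
      if E: "E \<in> ?T" and u: "u < n" for E u
    proof -
      have sub: "del_vertex E u \<subseteq> [{..<n}]\<^bsup>2\<^esup>"
        using triangle_free_graphs_subset[OF E] del_vertex_subset[of E u] by blast
      have "m E u \<le> sqrt n * ((A + \<epsilon> / 2) + c * of_bool (B n E)) \<and>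
          sqrt n * ((a - \<epsilon> / 2) + (- a) * of_bool (B n E)) \<le> m E u"
      proof (cases "B n E")
        case False
        then have "nearly_regular n a0 A0 \<delta> (del_vertex E u) ({..<n} - {u})"
          using u by (auto simp: B_def)
        then have "m E u \<in> {(a - \<epsilon> / 2) * sqrt n..(A + \<epsilon> / 2) * sqrt n}"
          unfolding m_def using mean t \<delta> sub u by simp
        then show ?thesis using False by (simp add: mult.commute)
      next
        case True
        have "m E u \<le> real n * t" unfolding m_def by (rule mean_card_le_trivial[OF t(1) sub])
        also have "real n * t = sqrt n * (sqrt n * t)" by simp
        also have "\<dots> = sqrt n * c" by (simp only: t(2))
        also have "\<dots> \<le> sqrt n * ((A + \<epsilon> / 2) + c)"
          using nonneg \<epsilon> by (intro mult_left_mono) auto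
        finally have 1: "m E u \<le> sqrt n * ((A + \<epsilon> / 2) + c)" .
        have "sqrt n * ((a - \<epsilon> / 2) + (- a)) \<le> 0"
          using \<epsilon> sq by (simp add: mult_nonneg_nonpos)
        also have "0 \<le> m E u" unfolding m_def by (rule mean_card_le_trivial[OF t(1) sub])
        finally show ?thesis using 1 True by simp
      qed
      then show "m E u \<le> sqrt n * ((A + \<epsilon> / 2) + c * of_bool (B n E))"
        "sqrt n * ((a - \<epsilon> / 2) + (- a) * of_bool (B n E)) \<le> m E u" by auto
    qed
    have nsq: "real n * sqrt n > 0" using n by simp
    have eq: "2 * mean_card ?T t = (\<Sum>E\<in>?T. t ^ card E * (\<Sum>u<n. m E u)) / Z"
      unfolding m_def Z_def by (rule mean_edges_eq[OF t(1)])
    have "(\<Sum>E\<in>?T. t ^ card E * (\<Sum>u<n. m E u))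
        \<le> (\<Sum>E\<in>?T. t ^ card E * (\<Sum>u<n. sqrt n * ((A + \<epsilon> / 2) + c * of_bool (B n E))))"
      using t m_bounds(1) by (intro sum_mono mult_left_mono) auto
    also have "\<dots> = Z * (real n * sqrt n) * ((A + \<epsilon> / 2) + c * gibbs_prob n t (B n))"
      unfolding sum_const[symmetric] by (simp add: mult.assoc)
    also have "\<dots> \<le> Z * (real n * sqrt n) * (A + \<epsilon>)"
    proof (intro mult_left_mono)
      have "c * gibbs_prob n t (B n) \<le> M * (\<epsilon> / (2 * M))"
        using bad M c pb_nonneg by (intro mult_mono) (auto simp: t_def)
      then show "(A + \<epsilon> / 2) + c * gibbs_prob n t (B n) \<le> A + \<epsilon>" using M by simp
    qed (use Z nsq in simp)
    finally have "2 * mean_card ?T t \<le> (real n * sqrt n) * (A + \<epsilon>)"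
      unfolding eq using Z by (simp add: pos_divide_le_eq mult_ac)
    then have upper: "2 * mean_card ?T t / (real n * sqrt n) \<le> A + \<epsilon>"
      using nsq by (simp only: pos_divide_le_eq mult.commute)
    have "Z * (real n * sqrt n) * (a - \<epsilon>) \<le> Z * (real n * sqrt n) * ((a - \<epsilon> / 2) + (- a) * gibbs_prob n t (B n))"
    proof (intro mult_left_mono)
      have "a * gibbs_prob n t (B n) \<le> M * (\<epsilon> / (2 * M))"
        using bad M nonneg pb_nonneg by (intro mult_mono) (auto simp: t_def)
      then show "a - \<epsilon> \<le> (a - \<epsilon> / 2) + (- a) * gibbs_prob n t (B n)" using M by simp
    qed (use Z nsq in simp)
    also have "\<dots> = (\<Sum>E\<in>?T. t ^ card E * (\<Sum>u<n. sqrt n * ((a - \<epsilon> / 2) + (- a) * of_bool (B n E))))"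
      unfolding sum_const[symmetric] by (simp add: mult.assoc)
    also have "\<dots> \<le> (\<Sum>E\<in>?T. t ^ card E * (\<Sum>u<n. m E u))"
      using t m_bounds(2) by (intro sum_mono mult_left_mono) auto
    finally have "(real n * sqrt n) * (a - \<epsilon>) \<le> 2 * mean_card ?T t"
      unfolding eq using Z by (simp add: pos_le_divide_eq mult_ac)
    then have "a - \<epsilon> \<le> 2 * mean_card ?T t / (real n * sqrt n)"
      using nsq by (simp only: pos_le_divide_eq mult.commute)
    with upper show "2 * mean_card ?T (c / sqrt n) / (real n * sqrt n) \<in> {a - \<epsilon>..A + \<epsilon>}"
      by (simp add: t_def)
  qed
qed

text \<open>
  Lower and upper bounds for the degrees on the scale \<open>sqrt n\<close>: degrees and occupation
  probabilities satisfy the same bounds, so each step feeds the bounds for both back into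
  \<open>marginal_bounds_step\<close>.
\<close>

primrec cavity :: "real \<Rightarrow> nat \<Rightarrow> real \<times> real" where
  "cavity c 0 = (0, c)"
| "cavity c (Suc k) = (c * exp (- (snd (cavity c k))\<^sup>2), c * exp (- (fst (cavity c k))\<^sup>2))"

text \<open>The map on intervals is monotone under inclusion and sends \<open>[0, c]\<close> into
  itself, so the intervals are nested.\<close>

lemma cavity_bounds:
  assumes "c > 0"
  shows "0 \<le> fst (cavity c k) \<and> 0 \<le> snd (cavity c k) \<and> snd (cavity c k) \<le> c \<and>
    fst (cavity c k) \<le> fst (cavity c (Suc k)) \<and> snd (cavity c (Suc k)) \<le> snd (cavity c k)"
  using assms by (induction k) (auto intro!: power_mono)

text \<open>\<open>c = \<beta> * exp (\<beta>\<^sup>2)\<close> says that \<open>\<beta>\<close> is a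
  fixed point of \<open>x \<mapsto> c * exp (- x\<^sup>2)\<close>. This map is decreasing, so the
  ends of a bracketing interval swap sides and bracket again.\<close>

lemma cavity_brackets:
  assumes "\<beta> \<ge> 0" "c > 0" "c = \<beta> * exp (\<beta>\<^sup>2)"
  shows "fst (cavity c k) \<le> \<beta> \<and> \<beta> \<le> snd (cavity c k)"
proof (induction k)
  case 0
  have "\<beta> * 1 \<le> \<beta> * exp (\<beta>\<^sup>2)" using assms by (intro mult_left_mono) auto
  then show ?case using assms by simp
next
  case (Suc k)
  have \<beta>: "\<beta> = c * exp (- \<beta>\<^sup>2)" using assms(3) by (simp add: exp_minus)
  have "exp (- (snd (cavity c k))\<^sup>2) \<le> exp (- \<beta>\<^sup>2)"
    using Suc assms by (simp add: power_mono)
  then have "c * exp (- (snd (cavity c k))\<^sup>2) \<le> c * exp (- \<beta>\<^sup>2)"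
    using assms(2) by (intro mult_left_mono) auto
  moreover have "exp (- \<beta>\<^sup>2) \<le> exp (- (fst (cavity c k))\<^sup>2)"
    using Suc cavity_bounds[OF assms(2), of k] by (simp add: power_mono)
  then have "c * exp (- \<beta>\<^sup>2) \<le> c * exp (- (fst (cavity c k))\<^sup>2)"
    using assms(2) by (intro mult_left_mono) auto
  ultimately show ?case using \<beta> by simp
qed

text \<open>On \<open>[0, c]\<close> the map \<open>x \<mapsto> c * exp (- x\<^sup>2)\<close> has
  slope at most \<open>2 * c\<^sup>2\<close> in absolute value. This is the origin of the condition
  \<open>2 * c\<^sup>2 < 1\<close>.\<close>

lemma cavity_gap:
  assumes "c > 0"
  shows "snd (cavity c k) - fst (cavity c k) \<le> (2 * c\<^sup>2) ^ k * c"
proof (induction k)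
  case 0
  then show ?case by simp
next
  case (Suc k)
  let ?a = "fst (cavity c k)" and ?A = "snd (cavity c k)"
  have b: "0 \<le> ?a" "0 \<le> ?A" "?A \<le> c" "?a \<le> ?A"
  proof -
    show "0 \<le> ?a" "0 \<le> ?A" "?A \<le> c" using cavity_bounds[OF assms] by auto
    show "?a \<le> ?A"
    proof (induction k)
      case (Suc k)
      then show ?case using cavity_bounds[OF assms, of k] assms by (simp add: power_mono)
    qed (use assms in simp)
  qed
  have "exp (- ?a\<^sup>2) - exp (- ?A\<^sup>2) = exp (- ?a\<^sup>2) * (1 - exp (- (?A\<^sup>2 - ?a\<^sup>2)))"
    by (simp add: algebra_simps flip: exp_add)
  also have "\<dots> \<le> 1 * (?A\<^sup>2 - ?a\<^sup>2)"
  proof (rule mult_mono)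
    show "1 - exp (- (?A\<^sup>2 - ?a\<^sup>2)) \<le> ?A\<^sup>2 - ?a\<^sup>2"
      using exp_ge_add_one_self[of "- (?A\<^sup>2 - ?a\<^sup>2)"] by linarith
  qed (use power_mono[OF b(4) b(1), of 2] in auto)
  also have "\<dots> = (?A + ?a) * (?A - ?a)" by (simp add: power2_eq_square algebra_simps)
  also have "\<dots> \<le> (2 * c) * (?A - ?a)" using b by (intro mult_right_mono) auto
  also have "\<dots> \<le> (2 * c) * ((2 * c\<^sup>2) ^ k * c)"
    using Suc assms by (intro mult_left_mono) auto
  finally have "c * (exp (- ?a\<^sup>2) - exp (- ?A\<^sup>2)) \<le> c * ((2 * c) * ((2 * c\<^sup>2) ^ k * c))"
    using assms by (intro mult_left_mono) auto
  then show ?case by (simp add: algebra_simps power2_eq_square)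
qed

text \<open>The marginals improve first, under the old degree window. The degrees then follow as
  conditional means, and since a narrower degree window is a stronger assumption, the improved
  marginal bounds carry over to it.\<close>

lemma degree_marginal_cavity:
  assumes c: "0 < c" "c < 1"
  shows "degree_bounds c (fst (cavity c k)) (snd (cavity c k)) \<and>
    marginal_bounds c (fst (cavity c k)) (snd (cavity c k)) (fst (cavity c k)) (snd (cavity c k))"
proof (induction k)
  case 0
  then show ?case using degree_bounds_trivial[OF c(1)] marginal_bounds_trivial[of c 0 c] by simp
next
  case (Suc k)
  let ?a = "fst (cavity c k)" and ?A = "snd (cavity c k)"
  note b = cavity_bounds[OF c(1), of k]
  have mb: "marginal_bounds c ?a ?A (fst (cavity c (Suc k))) (snd (cavity c (Suc k)))"
    using marginal_bounds_step[of c ?a ?A ?a ?A] Suc b c by (simp add: power2_eq_square)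
  have "degree_bounds c (fst (cavity c (Suc k))) (snd (cavity c (Suc k)))"
    by (rule degree_bounds_step[OF _ mb c])
      (use Suc b cavity_bounds[OF c(1), of "Suc k"] in auto)
  moreover have "marginal_bounds c (fst (cavity c (Suc k))) (snd (cavity c (Suc k)))
      (fst (cavity c (Suc k))) (snd (cavity c (Suc k)))"
    by (rule marginal_bounds_mono[OF mb]) (use b in auto)
  ultimately show ?case by blast
qed

lemma mean_edges_tendsto:
  assumes \<beta>: "\<beta> > 0" and c_def: "c = \<beta> * exp (\<beta>\<^sup>2)" and c2: "2 * c\<^sup>2 < 1"
  shows "(\<lambda>n. mean_card (triangle_free_graphs n) (c / sqrt n) / (real n * sqrt n)) \<longlonglongrightarrow> \<beta> / 2"
proof -
  have c0: "c > 0" using \<beta> c_def by simp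
  have "c\<^sup>2 < 1" using c2 zero_le_power2[of c] by linarith
  then have c1: "c < 1" using abs_square_less_1[of c] c0 by simp
  have "(\<lambda>n. 2 * mean_card (triangle_free_graphs n) (c / sqrt n) / (real n * sqrt n)) \<longlonglongrightarrow> \<beta>"
  proof (rule tendstoI)
    fix \<epsilon> :: real assume \<epsilon>: "\<epsilon> > 0"
    have "(\<lambda>k. (2 * c\<^sup>2) ^ k * c) \<longlonglongrightarrow> 0 * c"
      using c2 c0 by (intro tendsto_mult tendsto_const LIMSEQ_power_zero) auto
    then have "\<forall>\<^sub>F k in sequentially. (2 * c\<^sup>2) ^ k * c < \<epsilon> / 2"
      by (rule order_tendstoD) (use \<epsilon> in auto)
    then obtain k where k: "(2 * c\<^sup>2) ^ k * c < \<epsilon> / 2"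
      by (auto simp: eventually_sequentially)
    let ?a = "fst (cavity c k)" and ?A = "snd (cavity c k)"
    have br: "?a \<le> \<beta>" "\<beta> \<le> ?A" "?A - ?a < \<epsilon> / 2"
      using cavity_brackets[of \<beta> c k] cavity_gap[OF c0, of k] \<beta> c0 c_def k by auto
    have "\<epsilon> / 2 > 0" using \<epsilon> by simp
    with degree_marginal_cavity[OF c0 c1, of k] cavity_bounds[OF c0, of k]
    have "\<forall>\<^sub>F n in sequentially. 2 * mean_card (triangle_free_graphs n) (c / sqrt n) / (real n * sqrt n)
        \<in> {?a - \<epsilon> / 2..?A + \<epsilon> / 2}"
      using mean_edges_bounds[OF _ _ c0 c1, of ?a ?A ?a ?A "\<epsilon> / 2"] by blast
    then show "\<forall>\<^sub>F n in sequentially. dist (2 * mean_card (triangle_free_graphs n) (c / sqrt n) / (real n * sqrt n)) \<beta> < \<epsilon>"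
      by eventually_elim (use br in \<open>simp add: dist_real_def abs_less_iff\<close>)
  qed
  from tendsto_divide[OF this tendsto_const[of 2]] show ?thesis by simp
qed

subsection \<open>The partition function of triangle-free graphs\<close>

lemma part_fun_has_derivative:
  fixes F :: "'a set set"
  assumes "finite F" "{} \<in> F" "t > 0"
  shows "(part_fun F has_real_derivative mean_card F t * part_fun F t / t) (at t)"
proof -
  have "(part_fun F has_real_derivative (\<Sum>S\<in>F. real (card S) * t ^ (card S - Suc 0))) (at t)"
    unfolding part_fun_def[abs_def] by (auto intro!: derivative_eq_intros)
  also have "(\<Sum>S\<in>F. real (card S) * t ^ (card S - Suc 0)) = (\<Sum>S\<in>F. t ^ card S * real (card S)) / t"
    unfolding sum_divide_distrib
  proof (intro sum.cong refl)
    fix S :: "'a set"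
    show "real (card S) * t ^ (card S - Suc 0) = t ^ card S * real (card S) / t"
      using assms(3) by (cases "card S") auto
  qed
  also have "\<dots> = mean_card F t * part_fun F t / t"
    using part_fun_pos[OF assms(1,2), of t] assms(3) by (simp add: mean_card_def)
  finally show ?thesis .
qed

text \<open>The parameter \<open>x\<close> is the scaled degree that belongs to the fugacity
  \<open>x * exp (x\<^sup>2) / s\<close>. In it the limiting mean is linear;
  \<open>1 / x + 2 * x\<close> is the logarithmic derivative of
  \<open>x * exp (x\<^sup>2)\<close>.\<close>

lemma ln_part_fun_has_derivative:
  assumes "finite F" "{} \<in> F" "x > 0" "s > 0"
  shows "((\<lambda>x. ln (part_fun F (x * exp (x\<^sup>2) / s))) has_real_derivative
     mean_card F (x * exp (x\<^sup>2) / s) * (1 / x + 2 * x)) (at x)"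
proof -
  let ?t = "x * exp (x\<^sup>2) / s"
  have t: "?t > 0" using assms by simp
  have Z: "part_fun F ?t > 0" using part_fun_pos[OF assms(1,2), of ?t] t by simp
  have "((\<lambda>x. x * exp (x\<^sup>2) / s) has_real_derivative exp (x\<^sup>2) * (1 + 2 * x\<^sup>2) / s) (at x)"
    by (rule DERIV_cdivide) (auto intro!: derivative_eq_intros simp: algebra_simps power2_eq_square)
  from DERIV_chain2[OF part_fun_has_derivative[OF assms(1,2) t] this]
  have "((\<lambda>x. part_fun F (x * exp (x\<^sup>2) / s)) has_real_derivative
      mean_card F ?t * part_fun F ?t / ?t * (exp (x\<^sup>2) * (1 + 2 * x\<^sup>2) / s)) (at x)" .
  from DERIV_chain2[OF DERIV_ln_divide[OF Z] this]
  have "((\<lambda>x. ln (part_fun F (x * exp (x\<^sup>2) / s))) has_real_derivative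
      1 / part_fun F ?t * (mean_card F ?t * part_fun F ?t / ?t * (exp (x\<^sup>2) * (1 + 2 * x\<^sup>2) / s))) (at x)" .
  also have "1 / part_fun F ?t * (mean_card F ?t * part_fun F ?t / ?t * (exp (x\<^sup>2) * (1 + 2 * x\<^sup>2) / s))
      = mean_card F ?t * (exp (x\<^sup>2) * (1 + 2 * x\<^sup>2) / s / ?t)"
    using Z by simp
  also have "exp (x\<^sup>2) * (1 + 2 * x\<^sup>2) / s / ?t = 1 / x + 2 * x"
    using assms by (simp add: field_simps power2_eq_square)
  finally show ?thesis .
qed

text \<open>Only the empty set survives at fugacity 0. Members are taken finite because
  \<open>card\<close> is 0 on infinite sets.\<close>

lemma part_fun_0:
  fixes F :: "'a set set"
  assumes "finite F" "{} \<in> F" "\<And>S. S \<in> F \<Longrightarrow> finite S"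
  shows "part_fun F 0 = 1"
proof -
  have "part_fun F 0 = (\<Sum>S\<in>{{} :: 'a set}. 0 ^ card S)"
    unfolding part_fun_def using assms by (intro sum.mono_neutral_right) auto
  then show ?thesis by simp
qed

text \<open>The logarithm vanishes at fugacity 0, so for each \<open>n\<close> it is the integral of
  its derivative along the curve \<open>x * exp (x\<^sup>2) / sqrt n\<close>. Pointwise limits of
  the means pass under the integral by dominated convergence.\<close>

lemma ln_part_fun_tendsto:
  assumes \<beta>: "\<beta> > 0" and c_def: "c = \<beta> * exp (\<beta>\<^sup>2)" and c2: "2 * c\<^sup>2 < 1"
  shows "(\<lambda>n. ln (part_fun (triangle_free_graphs n) (c / sqrt n)) / (real n * sqrt n)) \<longlonglongrightarrow> \<beta> / 2 + \<beta> ^ 3 / 3"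
proof -
  define f where "f = (\<lambda>n x. mean_card (triangle_free_graphs n) (x * exp (x\<^sup>2) / sqrt n) * (1 / x + 2 * x) / (real n * sqrt n))"
  define g where "g = (\<lambda>x::real. x / 2 * (1 / x + 2 * x))"
  have f_int: "(f n has_integral ln (part_fun (triangle_free_graphs n) (c / sqrt n)) / (real n * sqrt n)) {0..\<beta>}" for n
  proof (cases "n = 0")
    case True
    then show ?thesis by (simp add: f_def)
  next
    case False
    let ?h = "\<lambda>x. ln (part_fun (triangle_free_graphs n) (x * exp (x\<^sup>2) / sqrt n)) / (real n * sqrt n)"
    have "(f n has_integral ?h \<beta> - ?h 0) {0..\<beta>}"
    proof (rule fundamental_theorem_of_calculus_interior)
      show "0 \<le> \<beta>" using \<beta> by simp
      have "part_fun (triangle_free_graphs n) (x * exp (x\<^sup>2) / sqrt n) \<noteq> 0" if "x \<in> {0..\<beta>}" for x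
        using part_fun_triangle_free_pos[of "x * exp (x\<^sup>2) / sqrt n" n] that by simp
      then show "continuous_on {0..\<beta>} ?h"
        using False unfolding part_fun_def by (intro continuous_intros) auto
      fix x assume x: "x \<in> {0<..<\<beta>}"
      have "(?h has_real_derivative mean_card (triangle_free_graphs n) (x * exp (x\<^sup>2) / sqrt n) * (1 / x + 2 * x) / (real n * sqrt n)) (at x)"
        using x False by (intro DERIV_cdivide ln_part_fun_has_derivative) auto
      then show "(?h has_vector_derivative f n x) (at x)"
        by (simp add: f_def has_real_derivative_iff_has_vector_derivative)
    qed
    moreover have "part_fun (triangle_free_graphs n) 0 = 1"
      by (rule part_fun_0) (auto dest: triangle_free_graphs_subset finite_graph)
    ultimately show ?thesis by (simp add: c_def)
  qed
  have g_int: "(g has_integral \<beta> / 2 + \<beta> ^ 3 / 3) {0..\<beta>}"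
  proof -
    have "(g has_integral (\<beta> / 2 + \<beta> ^ 3 / 3) - (0 / 2 + 0 ^ 3 / 3)) {0..\<beta>}"
    proof (rule fundamental_theorem_of_calculus_interior)
      show "0 \<le> \<beta>" using \<beta> by simp
      show "continuous_on {0..\<beta>} (\<lambda>x::real. x / 2 + x ^ 3 / 3)" by (intro continuous_intros) auto
      fix x assume x: "x \<in> {0<..<\<beta>}"
      have "((\<lambda>x::real. x / 2 + x ^ 3 / 3) has_real_derivative g x) (at x)"
        using x by (auto intro!: derivative_eq_intros simp: g_def field_simps power2_eq_square)
      then show "((\<lambda>x::real. x / 2 + x ^ 3 / 3) has_vector_derivative g x) (at x)"
        by (simp add: has_real_derivative_iff_has_vector_derivative)
    qed
    then show ?thesis by simp
  qed
  have "(\<lambda>n. integral {0..\<beta>} (f n)) \<longlonglongrightarrow> integral {0..\<beta>} g"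
  proof (rule dominated_convergence)
    show "f n integrable_on {0..\<beta>}" for n using f_int by blast
    \<comment> \<open>The majorant comes from \<open>mean_edges_le\<close>: the bound on the mean is
      proportional to \<open>x * exp (x\<^sup>2)\<close>, whose factor \<open>x\<close> cancels the
      singularity of \<open>1 / x\<close>.\<close>
    show "(\<lambda>x::real. exp (\<beta>\<^sup>2) * (1 + 2 * \<beta>\<^sup>2) / 2) integrable_on {0..\<beta>}" by (rule integrable_const_ivl)
    fix n x assume x: "x \<in> {0..\<beta>}"
    show "norm (f n x) \<le> exp (\<beta>\<^sup>2) * (1 + 2 * \<beta>\<^sup>2) / 2"
    proof (cases "x = 0 \<or> n = 0")
      case True
      then show ?thesis by (auto simp: f_def)
    next
      case False
      let ?t = "x * exp (x\<^sup>2) / sqrt n"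
      have t: "?t > 0" using False x by simp
      have nsq: "real n * sqrt n > 0" using False by simp
      have nn: "1 / x + 2 * x \<ge> 0" using x by simp
      have "f n x \<ge> 0"
        unfolding f_def using mean_edges_le(2)[OF t, of n] nn nsq by simp
      then have "norm (f n x) = f n x" by simp
      also have "\<dots> \<le> ((real n)\<^sup>2 * ?t / 2) * (1 / x + 2 * x) / (real n * sqrt n)"
        unfolding f_def using mean_edges_le(1)[OF t, of n] nn nsq
        by (intro divide_right_mono mult_right_mono) auto
      also have "\<dots> = exp (x\<^sup>2) * (1 + 2 * x\<^sup>2) / 2"
      proof -
        have "((y\<^sup>2)\<^sup>2 * (x * exp (x\<^sup>2) / y) / 2) * (1 / x + 2 * x) / (y\<^sup>2 * y)
            = exp (x\<^sup>2) * (1 + 2 * x\<^sup>2) / 2" if "y > 0" for y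
          using that False by (simp add: field_simps power2_eq_square)
        from this[of "sqrt n"] show ?thesis using False by simp
      qed
      also have "\<dots> \<le> exp (\<beta>\<^sup>2) * (1 + 2 * \<beta>\<^sup>2) / 2"
        using x power_mono[of x \<beta> 2] by (intro divide_right_mono mult_mono) auto
      finally show ?thesis .
    qed
  next
    fix x assume x: "x \<in> {0..\<beta>}"
    show "(\<lambda>n. f n x) \<longlonglongrightarrow> g x"
    \<comment> \<open>At 0 the fugacity is 0 and \<open>mean_edges_tendsto\<close> does not apply;
      since \<open>1 / 0 = 0\<close>, both \<open>f n\<close> and \<open>g\<close> vanish
      there.\<close>
    proof (cases "x = 0")
      case True
      then show ?thesis by (simp add: f_def g_def)
    next
      case False
      \<comment> \<open>Smaller fugacities inherit the contraction condition, so the limiting mean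
        is known along the whole path.\<close>
      have "x * exp (x\<^sup>2) \<le> c"
        unfolding c_def using x power_mono[of x \<beta> 2] by (intro mult_mono) auto
      then have "(x * exp (x\<^sup>2))\<^sup>2 \<le> c\<^sup>2" using x by (intro power_mono) auto
      then have "(\<lambda>n. mean_card (triangle_free_graphs n) (x * exp (x\<^sup>2) / sqrt n) / (real n * sqrt n)) \<longlonglongrightarrow> x / 2"
        using x False c2 by (intro mean_edges_tendsto) auto
      then have "(\<lambda>n. mean_card (triangle_free_graphs n) (x * exp (x\<^sup>2) / sqrt n) / (real n * sqrt n) * (1 / x + 2 * x))
          \<longlonglongrightarrow> x / 2 * (1 / x + 2 * x)" by (intro tendsto_mult tendsto_const)
      then show ?thesis by (simp add: f_def g_def)
    qed
  qed
  then show ?thesis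
    using integral_unique[OF f_int] integral_unique[OF g_int] by simp
qed

subsection \<open>Transfer to a fixed number of edges\<close>

text \<open>The probability that \<open>G(n,m)\<close> is triangle-free, made total: for
  \<open>m > n choose 2\<close> both counts are 0 and so is the quotient, which keeps it decreasing
  in \<open>m\<close> on all natural numbers.\<close>

definition triangle_free_density :: "nat \<Rightarrow> nat \<Rightarrow> real" where
  "triangle_free_density n m = real (num_triangle_free n m) / real ((n choose 2) choose m)"

lemma num_triangle_free_eq:
  "num_triangle_free n m = card {E \<in> triangle_free_graphs n. card E = m}"
  unfolding num_triangle_free_def triangle_free_graphs_def graphs_def
  by (rule arg_cong[where f = card]) auto

lemma card_pairs: "card ([{..<n::nat}]\<^bsup>2\<^esup>) = n choose 2"
  by simp

lemma card_graphs: "card (graphs n m) = (n choose 2) choose m"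
  unfolding graphs_def using n_subsets[OF finite_pairs, of n m] by simp

lemma finite_graphs: "finite (graphs n m)"
  by (rule finite_subset[of _ "Pow ([{..<n}]\<^bsup>2\<^esup>)"]) (auto simp: graphs_def finite_pairs)

lemma prob_triangle_free:
  assumes "m \<le> n choose 2"
  shows "measure_pmf.prob (Gnm n m) {E. num_triangles n E = 0} = triangle_free_density n m"
proof -
  have "graphs n m \<noteq> {}"
    using card_graphs[of n m] assms zero_less_binomial_iff[of "n choose 2" m] by force
  then have "measure_pmf.prob (Gnm n m) {E. num_triangles n E = 0}
      = real (card (graphs n m \<inter> {E. num_triangles n E = 0})) / real (card (graphs n m))"
    unfolding Gnm_def by (intro measure_pmf_of_set finite_graphs)
  also have "graphs n m \<inter> {E. num_triangles n E = 0} = {E \<in> graphs n m. triangles n E = {}}"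
  proof -
    have "finite (triangles n E)" for E
      by (rule finite_subset[of _ "[{..<n}]\<^bsup>3\<^esup>"])
        (auto simp: triangles_def finite_imp_finite_nsets)
    then show ?thesis by (auto simp: num_triangles_def)
  qed
  finally show ?thesis
    by (simp add: triangle_free_density_def num_triangle_free_def card_graphs)
qed

text \<open>Double counting of graphs with a marked edge. Deleting that edge leaves a triangle-free
  graph with a marked non-edge, injectively; the reverse operation can create a triangle, hence only
  an inequality.\<close>

lemma num_triangle_free_Suc:
  "Suc m * num_triangle_free n (Suc m) \<le> ((n choose 2) - m) * num_triangle_free n m"
proof -
  let ?T = "\<lambda>m. {E \<in> triangle_free_graphs n. card E = m}"
  let ?P = "[{..<n}]\<^bsup>2\<^esup>"
  have fin: "finite E" "E \<subseteq> ?P" if "E \<in> triangle_free_graphs n" for E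
    using that by (auto dest: triangle_free_graphs_subset intro: finite_graph)
  have "card (Sigma (?T (Suc m)) (\<lambda>E. E)) \<le> card (Sigma (?T m) (\<lambda>E. ?P - E))"
  proof (rule card_inj_on_le[of "\<lambda>(E, e). (E - {e}, e)"])
    show "inj_on (\<lambda>(E, e). (E - {e}, e)) (Sigma (?T (Suc m)) (\<lambda>E. E))"
      by (auto simp: inj_on_def)
    show "(\<lambda>(E, e). (E - {e}, e)) ` Sigma (?T (Suc m)) (\<lambda>E. E) \<subseteq> Sigma (?T m) (\<lambda>E. ?P - E)"
    proof (rule image_subsetI)
      fix p assume "p \<in> Sigma (?T (Suc m)) (\<lambda>E. E)"
      then obtain E e where "p = (E, e)" "E \<in> triangle_free_graphs n" "card E = Suc m" "e \<in> E"
        by auto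
      then show "(case p of (E, e) \<Rightarrow> (E - {e}, e)) \<in> Sigma (?T m) (\<lambda>E. ?P - E)"
        using fin[of E] triangle_free_subset[of E n "E - {e}"] by auto
    qed
    show "finite (Sigma (?T m) (\<lambda>E. ?P - E))"
      by (intro finite_SigmaI) (auto simp: finite_pairs)
  qed
  moreover have "card (Sigma (?T (Suc m)) (\<lambda>E. E)) = Suc m * num_triangle_free n (Suc m)"
    using fin by (subst card_SigmaI) (auto simp: num_triangle_free_eq)
  moreover have "card (Sigma (?T m) (\<lambda>E. ?P - E)) = ((n choose 2) - m) * num_triangle_free n m"
  proof -
    have "card (?P - E) = (n choose 2) - m" if "E \<in> ?T m" for E
      using that fin[of E] card_pairs[of n] by (subst card_Diff_subset) auto
    then show ?thesis
      by (subst card_SigmaI) (auto simp: num_triangle_free_eq finite_pairs)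
  qed
  ultimately show ?thesis by simp
qed

text \<open>For unrestricted graphs the same double count is an equality, so in the quotient its
  factors cancel.\<close>

lemma triangle_free_density_antimono:
  assumes "i \<le> j"
  shows "triangle_free_density n j \<le> triangle_free_density n i"
proof -
  let ?N = "n choose 2"
  have "triangle_free_density n (Suc m) \<le> triangle_free_density n m" for m
  proof (cases "Suc m \<le> ?N")
    case False
    then show ?thesis by (simp add: triangle_free_density_def binomial_eq_0)
  next
    case True
    have "Suc m * (?N choose Suc m) = (?N - m) * (?N choose m)"
      by (simp only: binomial_absorption binomial_absorb_comp)
    then have eq: "real (Suc m) * real (?N choose Suc m) = real (?N - m) * real (?N choose m)"
      by (metis of_nat_mult)
    have le: "real (Suc m) * real (num_triangle_free n (Suc m)) \<le> real (?N - m) * real (num_triangle_free n m)"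
      using num_triangle_free_Suc[of m n] by (metis of_nat_le_iff of_nat_mult)
    have pos: "real (?N choose Suc m) > 0" "real (?N choose m) > 0" "real (?N - m) > 0"
      using True by (simp_all add: zero_less_binomial_iff)
    have "triangle_free_density n (Suc m)
        = (real (Suc m) * real (num_triangle_free n (Suc m))) / (real (Suc m) * real (?N choose Suc m))"
      by (simp add: triangle_free_density_def del: of_nat_Suc)
    also have "\<dots> \<le> (real (?N - m) * real (num_triangle_free n m)) / (real (?N - m) * real (?N choose m))"
      unfolding eq using le pos by (intro divide_right_mono) auto
    also have "\<dots> = triangle_free_density n m"
      using pos by (simp add: triangle_free_density_def)
    finally show ?thesis .
  qed
  then show ?thesis
    using assms by (rule lift_Suc_antimono_le)
qed

lemma triangle_free_density_nonneg: "triangle_free_density n m \<ge> 0"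
  by (simp add: triangle_free_density_def)

lemma num_triangle_free_eq_density:
  "real (num_triangle_free n m) = triangle_free_density n m * real ((n choose 2) choose m)"
proof (cases "m \<le> n choose 2")
  case False
  have "graphs n m = {}"
    using card_graphs[of n m] False finite_graphs[of n m] by (simp add: binomial_eq_0)
  then show ?thesis
    using False by (simp add: num_triangle_free_def binomial_eq_0)
qed (simp add: triangle_free_density_def)

lemma triangle_free_density_le_part_fun:
  assumes "t \<ge> 0"
  shows "triangle_free_density n m * real ((n choose 2) choose m) * t ^ m \<le> part_fun (triangle_free_graphs n) t"
proof -
  have "(\<Sum>E\<in>{E \<in> triangle_free_graphs n. card E = m}. t ^ card E) = real (num_triangle_free n m) * t ^ m"
    by (simp add: num_triangle_free_eq)
  moreover have "(\<Sum>E\<in>{E \<in> triangle_free_graphs n. card E = m}. t ^ card E) \<le> part_fun (triangle_free_graphs n) t"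
    unfolding part_fun_def using assms by (intro sum_mono2) auto
  ultimately show ?thesis by (simp only: num_triangle_free_eq_density)
qed

text \<open>Monotonicity replaces the density at each \<open>j \<ge> m\<close> by the one at
  \<open>m\<close>, and the binomial theorem sums the rest. This yields lower bounds on the density,
  while \<open>triangle_free_density_le_part_fun\<close> yields upper bounds.\<close>

lemma part_fun_upper_tail_le:
  assumes "t \<ge> 0"
  shows "(\<Sum>E\<in>{E \<in> triangle_free_graphs n. m \<le> card E}. t ^ card E)
    \<le> triangle_free_density n m * (1 + t) ^ (n choose 2)"
proof -
  let ?N = "n choose 2"
  have card_le: "card E \<le> ?N" if "E \<in> triangle_free_graphs n" for E
    using card_mono[OF finite_pairs triangle_free_graphs_subset[OF that]] by simp
  have "(\<Sum>E\<in>{E \<in> triangle_free_graphs n. m \<le> card E}. t ^ card E)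
      = (\<Sum>j\<in>{m..?N}. \<Sum>E\<in>{E \<in> {E \<in> triangle_free_graphs n. m \<le> card E}. card E = j}. t ^ card E)"
    using card_le by (intro sum.group[symmetric]) auto
  also have "\<dots> = (\<Sum>j\<in>{m..?N}. real (num_triangle_free n j) * t ^ j)"
  proof (intro sum.cong refl)
    fix j assume "j \<in> {m..?N}"
    then have "{E \<in> {E \<in> triangle_free_graphs n. m \<le> card E}. card E = j} = {E \<in> triangle_free_graphs n. card E = j}"
      by auto
    then show "(\<Sum>E\<in>{E \<in> {E \<in> triangle_free_graphs n. m \<le> card E}. card E = j}. t ^ card E)
        = real (num_triangle_free n j) * t ^ j"
      by (simp add: num_triangle_free_eq)
  qed
  also have "\<dots> \<le> (\<Sum>j\<in>{m..?N}. triangle_free_density n m * (real (?N choose j) * t ^ j))"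
  proof (intro sum_mono)
    fix j assume "j \<in> {m..?N}"
    then have "triangle_free_density n j \<le> triangle_free_density n m"
      by (intro triangle_free_density_antimono) simp
    then have "triangle_free_density n j * (real (?N choose j) * t ^ j)
        \<le> triangle_free_density n m * (real (?N choose j) * t ^ j)"
      using assms by (intro mult_right_mono) auto
    then show "real (num_triangle_free n j) * t ^ j \<le> triangle_free_density n m * (real (?N choose j) * t ^ j)"
      by (simp add: num_triangle_free_eq_density mult.assoc)
  qed
  also have "\<dots> \<le> (\<Sum>j\<in>{..?N}. triangle_free_density n m * (real (?N choose j) * t ^ j))"
    using assms triangle_free_density_nonneg by (intro sum_mono2) auto
  also have "\<dots> = triangle_free_density n m * (1 + t) ^ ?N"
    unfolding sum_distrib_left[symmetric] using binomial_ring[of t 1 ?N] by (simp add: add.commute)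
  finally show ?thesis .
qed

text \<open>At fugacity \<open>t\<close> itself the factor \<open>(1 + t) ^ (n choose 2)\<close>
  would be dominated by edge counts that triangle-free graphs rarely reach. Half of the weight has
  between \<open>m\<close> and \<open>M\<close> edges; there \<open>t\<close> can be lowered to
  \<open>\<tau> * t\<close> at the price \<open>exp (- M * ln \<tau>)\<close>. The best choice makes
  \<open>\<tau> * t * (n choose 2)\<close> equal to \<open>M\<close>.\<close>

lemma part_fun_le_density:
  assumes t: "t > 0" and \<tau>: "0 < \<tau>" "\<tau> \<le> 1"
    and low: "gibbs_prob n t (\<lambda>E. card E < m) \<le> 1 / 4"
    and up: "gibbs_prob n t (\<lambda>E. M < real (card E)) \<le> 1 / 4"
  shows "part_fun (triangle_free_graphs n) t / 2
    \<le> triangle_free_density n m * exp (\<tau> * t * real (n choose 2) - M * ln \<tau>)"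
proof -
  let ?T = "triangle_free_graphs n" and ?N = "n choose 2"
  let ?Z = "part_fun ?T t"
  let ?A = "{E\<in>?T. card E < m}" and ?B = "{E\<in>?T. M < real (card E)}" and ?C = "{E\<in>?T. m \<le> card E \<and> real (card E) \<le> M}"
  have Z: "?Z > 0" using t by (simp add: part_fun_triangle_free_pos)
  have A: "(\<Sum>E\<in>?A. t ^ card E) \<le> ?Z / 4" and B: "(\<Sum>E\<in>?B. t ^ card E) \<le> ?Z / 4"
    using low up Z by (simp_all add: gibbs_prob_def field_simps)
  have "?Z \<le> (\<Sum>E\<in>?A \<union> (?B \<union> ?C). t ^ card E)"
    unfolding part_fun_def using t by (intro sum_mono2) auto
  also have "\<dots> \<le> (\<Sum>E\<in>?A. t ^ card E) + ((\<Sum>E\<in>?B. t ^ card E) + (\<Sum>E\<in>?C. t ^ card E))"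
  proof -
    have Un: "(\<Sum>E\<in>X \<union> Y. t ^ card E) \<le> (\<Sum>E\<in>X. t ^ card E) + (\<Sum>E\<in>Y. t ^ card E)"
      if "finite X" "finite Y" for X Y :: "nat set set set"
    proof -
      have "(\<Sum>E\<in>X \<union> Y. t ^ card E) + (\<Sum>E\<in>X \<inter> Y. t ^ card E) = (\<Sum>E\<in>X. t ^ card E) + (\<Sum>E\<in>Y. t ^ card E)"
        by (rule sum.union_inter[OF that])
      moreover have "(\<Sum>E\<in>X \<inter> Y. t ^ card E) \<ge> 0" using t by (intro sum_nonneg) auto
      ultimately show ?thesis by linarith
    qed
    show ?thesis
      by (rule order_trans[OF Un add_left_mono[OF Un]]) auto
  qed
  finally have "?Z / 2 \<le> (\<Sum>E\<in>?C. t ^ card E)" using A B by linarith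
  also have "\<dots> \<le> (\<Sum>E\<in>?C. exp (- M * ln \<tau>) * (\<tau> * t) ^ card E)"
  proof (intro sum_mono)
    fix E assume "E \<in> ?C"
    then have M: "real (card E) \<le> M" by simp
    have "\<tau> ^ card E = exp (real (card E) * ln \<tau>)"
      using \<tau> by (simp add: exp_of_nat_mult)
    moreover have "(real (card E) - M) * ln \<tau> \<ge> 0"
      using M \<tau> by (intro mult_nonpos_nonpos) auto
    ultimately have "1 \<le> exp (- M * ln \<tau>) * \<tau> ^ card E"
      by (simp add: algebra_simps flip: exp_add)
    then have "1 * t ^ card E \<le> (exp (- M * ln \<tau>) * \<tau> ^ card E) * t ^ card E"
      using t by (intro mult_right_mono) auto
    then show "t ^ card E \<le> exp (- M * ln \<tau>) * (\<tau> * t) ^ card E"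
      by (simp add: power_mult_distrib mult.assoc)
  qed
  also have "\<dots> \<le> exp (- M * ln \<tau>) * (\<Sum>E\<in>{E\<in>?T. m \<le> card E}. (\<tau> * t) ^ card E)"
    unfolding sum_distrib_left[symmetric] using t \<tau> by (intro mult_left_mono sum_mono2) auto
  also have "\<dots> \<le> exp (- M * ln \<tau>) * (triangle_free_density n m * (1 + \<tau> * t) ^ ?N)"
    using t \<tau> by (intro mult_left_mono part_fun_upper_tail_le) auto
  also have "\<dots> \<le> exp (- M * ln \<tau>) * (triangle_free_density n m * exp (\<tau> * t * real ?N))"
  proof (intro mult_left_mono)
    have "(1 + \<tau> * t) ^ ?N \<le> exp (\<tau> * t) ^ ?N"
      using t \<tau> exp_ge_add_one_self[of "\<tau> * t"] by (intro power_mono) auto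
    also have "\<dots> = exp (\<tau> * t * real ?N)"
      by (simp add: exp_of_nat_mult[symmetric] mult_ac)
    finally show "(1 + \<tau> * t) ^ ?N \<le> exp (\<tau> * t * real ?N)" .
  qed (use triangle_free_density_nonneg in auto)
  also have "\<dots> = triangle_free_density n m * exp (\<tau> * t * real ?N - M * ln \<tau>)"
    by (simp add: exp_diff exp_minus field_simps)
  finally show ?thesis .
qed

section \<open>Elementary estimates for factorials and binomial coefficients\<close>

lemma fact_le_exp: "m > 0 \<Longrightarrow> fact m \<le> real m ^ (m + 1) * exp (1 - real m)"
proof (induction m rule: nat_induct_non_zero)
  case 1
  then show ?case by simp
next
  case (Suc m)
  \<comment> \<open>The bound is Stirling's up to a factor of order sqrt m, invisible on the scale
    n^(3/2). The induction step amounts to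
    \<open>(m + 1) * ln (m / (m + 1)) \<le> - 1\<close>.\<close>
  have "ln (real m / (real m + 1)) \<le> real m / (real m + 1) - 1"
    using Suc by (intro ln_le_minus_one) auto
  then have "ln (real m) - ln (real m + 1) \<le> - 1 / (real m + 1)"
    using Suc by (simp add: ln_div field_simps)
  then have "(real m + 1) * (ln (real m) - ln (real m + 1)) \<le> (real m + 1) * (- 1 / (real m + 1))"
    by (intro mult_left_mono) auto
  also have "\<dots> = - 1" by (simp add: add_nonneg_eq_0_iff)
  finally have "real (m + 1) * ln (real m) + 1 \<le> real (m + 1) * ln (real m + 1)"
    by (simp add: right_diff_distrib add.commute)
  then have "exp (real (m + 1) * ln (real m) + 1) \<le> exp (real (m + 1) * ln (real m + 1))"
    by simp
  then have *: "real m ^ (m + 1) * exp 1 \<le> (real m + 1) ^ (m + 1)"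
    using Suc by (simp only: exp_add exp_of_nat_mult) simp
  have "fact (Suc m) = (real m + 1) * fact m" by (simp add: add.commute)
  also have "\<dots> \<le> (real m + 1) * (real m ^ (m + 1) * exp (1 - real m))"
    using Suc by (intro mult_left_mono) auto
  also have "\<dots> = (real m + 1) * (real m ^ (m + 1) * exp 1) * exp (- real m)"
    by (simp add: exp_diff exp_minus field_simps)
  also have "\<dots> \<le> (real m + 1) * (real m + 1) ^ (m + 1) * exp (- real m)"
    using * by (intro mult_right_mono mult_left_mono) auto
  finally show ?case by (simp add: add.commute)
qed

text \<open>From \<open>(N - m) ^ m \<le> fact m * (N choose m)\<close>. For \<open>m\<close> of
  order n^(3/2) and \<open>N = n choose 2\<close>, using \<open>N - m\<close> for all factors of the
  falling factorial costs only order m^2 / N, that is order n, in the logarithm.\<close>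

lemma ln_binomial_ge:
  assumes "0 < m" "m < N"
  shows "real m * ln (real (N - m)) + real m - 1 - (real m + 1) * ln (real m) \<le> ln (real (N choose m))"
proof -
  have "(N - m) ^ m * fact (N - m) \<le> fact N"
  proof -
    have "(N - m) ^ m * fact (N - m) \<le> (\<Prod>i\<in>{Suc (N - m)..N}. i) * fact (N - m)"
    proof (intro mult_right_mono)
      have "(\<Prod>i\<in>{Suc (N - m)..N}. N - m) \<le> (\<Prod>i\<in>{Suc (N - m)..N}. i)"
        by (intro prod_mono) auto
      then show "(N - m) ^ m \<le> (\<Prod>i\<in>{Suc (N - m)..N}. i)" using assms by simp
    qed simp
    also have "\<dots> = fact N"
    proof -
      have "{1..N} = {1..N - m} \<union> {Suc (N - m)..N}" by auto
      then have "(\<Prod>i\<in>{1..N}. i) = (\<Prod>i\<in>{1..N - m}. i) * (\<Prod>i\<in>{Suc (N - m)..N}. i)"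
        by (simp add: prod.union_disjoint)
      then show ?thesis by (simp add: fact_prod mult.commute)
    qed
    finally show ?thesis .
  qed
  moreover have "fact N = fact m * fact (N - m) * (N choose m)"
    using binomial_fact_lemma[of m N] assms by simp
  ultimately have "(N - m) ^ m * fact (N - m) \<le> (fact m * (N choose m)) * fact (N - m)"
    by (simp add: mult_ac)
  then have "(N - m) ^ m \<le> fact m * (N choose m)" by simp
  then have le: "real (N - m) ^ m \<le> fact m * real (N choose m)"
    by (metis of_nat_fact of_nat_le_iff of_nat_mult of_nat_power)
  have pos: "real (N - m) > 0" "real (N choose m) > 0" "real m > 0"
    using assms by (simp_all add: zero_less_binomial_iff)
  have "ln (real (N - m) ^ m) \<le> ln (fact m * real (N choose m))"
    using le pos by (subst ln_le_cancel_iff) auto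
  also have "\<dots> = ln (fact m) + ln (real (N choose m))"
    using pos by (simp add: ln_mult)
  also have "ln (fact m) \<le> ln (real m ^ (m + 1) * exp (1 - real m))"
    using fact_le_exp[OF assms(1)] pos by (subst ln_le_cancel_iff) auto
  also have "\<dots> = (real m + 1) * ln (real m) + (1 - real m)"
    using pos by (simp add: ln_mult ln_realpow algebra_simps)
  finally show ?thesis using pos by (simp add: ln_realpow)
qed

section \<open>Concentration of the edge count and the two bounds on the density\<close>

lemma real_choose_two: "real (n choose 2) = real n * (real n - 1) / 2"
  by (induction n) (simp_all add: numeral_2_eq_2 field_simps)

text \<open>The sign condition says that \<open>\<alpha>\<close> lies strictly between
  \<open>\<beta>\<close> and \<open>\<xi>\<close>: tilting from \<open>c2\<close> to
  \<open>c1\<close> moves the typical edge count only part of the way to \<open>x n\<close>, so the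
  Chernoff exponent is negative of order n^(3/2).\<close>

lemma edges_tail_tendsto:
  fixes x :: "nat \<Rightarrow> real"
  assumes pos0: "\<alpha> > 0" "\<beta> > 0" and c_def: "c1 = \<alpha> * exp (\<alpha>\<^sup>2)" "c2 = \<beta> * exp (\<beta>\<^sup>2)"
    and c1: "2 * c1\<^sup>2 < 1"
    and x: "(\<lambda>n. x n / (real n * sqrt n)) \<longlonglongrightarrow> \<xi> / 2"
    and sgn: "ln (c1 / c2) * (\<alpha> - \<xi>) < 0"
  shows "(\<lambda>n. gibbs_prob n (c2 / sqrt n) (\<lambda>E. ln (c1 / c2) * (real (card E) - x n) \<ge> 0)) \<longlonglongrightarrow> 0"
proof (rule tendsto_sandwich[OF _ _ tendsto_const])
  let ?T = "triangle_free_graphs" and ?v = "\<lambda>n. real n * sqrt n"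
  define s where "s = c1 / c2"
  have pos: "c1 > 0" "c2 > 0" "s > 0" using pos0 by (auto simp: c_def s_def)
  show "\<forall>\<^sub>F n in sequentially. 0 \<le> gibbs_prob n (c2 / sqrt n) (\<lambda>E. ln (c1 / c2) * (real (card E) - x n) \<ge> 0)"
    using pos by (intro always_eventually allI gibbs_prob_nonneg) simp
  have lim: "(\<lambda>n. ln s * (mean_card (?T n) (c1 / sqrt n) / ?v n - x n / ?v n)) \<longlonglongrightarrow> ln s * (\<alpha> / 2 - \<xi> / 2)"
    by (intro tendsto_intros mean_edges_tendsto pos0 c_def c1 x)
  have "ln s * (\<alpha> / 2 - \<xi> / 2) < 0"
    using sgn by (simp add: s_def field_simps)
  moreover have "filterlim (\<lambda>n. ?v n) at_top sequentially" by real_asymp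
  ultimately have "filterlim (\<lambda>n. ln s * (mean_card (?T n) (c1 / sqrt n) / ?v n - x n / ?v n) * ?v n) at_bot sequentially"
    using filterlim_tendsto_neg_mult_at_bot[OF lim] by blast
  then show "(\<lambda>n. exp (ln s * (mean_card (?T n) (c1 / sqrt n) / ?v n - x n / ?v n) * ?v n)) \<longlonglongrightarrow> 0"
    by (rule filterlim_compose[OF exp_at_bot])
  show "\<forall>\<^sub>F n in sequentially. gibbs_prob n (c2 / sqrt n) (\<lambda>E. ln (c1 / c2) * (real (card E) - x n) \<ge> 0)
      \<le> exp (ln s * (mean_card (?T n) (c1 / sqrt n) / ?v n - x n / ?v n) * ?v n)"
    using eventually_gt_at_top[of 0]
  proof eventually_elim
    fix n :: nat assume n: "n > 0"
    let ?t = "c2 / sqrt n"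
    have t: "?t > 0" using n pos by simp
    have v: "?v n > 0" using n by simp
    have st: "s * ?t = c1 / sqrt n" using pos by (simp add: s_def)
    have "(\<Sum>E\<in>{E\<in>?T n. ln s * (real (card E) - x n) \<ge> 0}. ?t ^ card E)
        \<le> part_fun (?T n) ?t * exp (ln s * (mean_card (?T n) (s * ?t) - x n))"
      using t pos by (intro part_fun_tail_le) auto
    then have "gibbs_prob n ?t (\<lambda>E. ln s * (real (card E) - x n) \<ge> 0) \<le> exp (ln s * (mean_card (?T n) (c1 / sqrt n) - x n))"
      unfolding gibbs_prob_def st using part_fun_triangle_free_pos[of ?t n] t
      by (simp add: pos_divide_le_eq mult.commute)
    also have "ln s * (mean_card (?T n) (c1 / sqrt n) - x n)
        = ln s * (mean_card (?T n) (c1 / sqrt n) / ?v n - x n / ?v n) * ?v n"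
      using n by (simp only: diff_divide_distrib[symmetric] mult.assoc) simp
    finally show "gibbs_prob n ?t (\<lambda>E. ln (c1 / c2) * (real (card E) - x n) \<ge> 0)
      \<le> exp (ln s * (mean_card (?T n) (c1 / sqrt n) / ?v n - x n / ?v n) * ?v n)"
      by (simp only: s_def)
  qed
qed

lemma edge_count_asymptotics:
  assumes b: "b > 0" and m: "(\<lambda>n. real (m n) / (real n * sqrt n)) \<longlonglongrightarrow> b / 2"
  shows "\<forall>\<^sub>F n in sequentially. 0 < m n \<and> m n < n choose 2"
    and "(\<lambda>n. real ((n choose 2) - m n) / (real n)\<^sup>2) \<longlonglongrightarrow> 1 / 2"
    and "(\<lambda>n. ln (real (m n)) / (real n * sqrt n)) \<longlonglongrightarrow> 0"
proof -
  let ?v = "\<lambda>n. real n * sqrt n"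
  have ev_pos: "\<forall>\<^sub>F n in sequentially. real (m n) / ?v n > 0"
    by (rule order_tendstoD[OF m]) (use b in auto)
  have "(\<lambda>n. 1 / sqrt (real n)) \<longlonglongrightarrow> 0" by real_asymp
  from tendsto_mult[OF m this]
  have m0: "(\<lambda>n. real (m n) / ?v n * (1 / sqrt n)) \<longlonglongrightarrow> 0" by simp
  have "(\<lambda>n. real n * (real n - 1) / 2 / (real n)\<^sup>2) \<longlonglongrightarrow> 1 / 2" by real_asymp
  from tendsto_diff[OF this m0]
  have lim: "(\<lambda>n. real n * (real n - 1) / 2 / (real n)\<^sup>2 - real (m n) / ?v n * (1 / sqrt n)) \<longlonglongrightarrow> 1 / 2" by simp
  have eq: "\<forall>\<^sub>F n in sequentially. real n * (real n - 1) / 2 / (real n)\<^sup>2 - real (m n) / ?v n * (1 / sqrt n)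
      = (real (n choose 2) - real (m n)) / (real n)\<^sup>2"
    using eventually_gt_at_top[of 0]
  proof eventually_elim
    fix n :: nat assume n: "n > 0"
    have "real (m n) / ?v n * (1 / sqrt n) = real (m n) / (real n * (sqrt n * sqrt n))"
      by (simp only: times_divide_times_eq mult_1_right mult.assoc)
    also have "\<dots> = real (m n) / (real n)\<^sup>2" by (simp add: power2_eq_square)
    finally show "real n * (real n - 1) / 2 / (real n)\<^sup>2 - real (m n) / ?v n * (1 / sqrt n)
      = (real (n choose 2) - real (m n)) / (real n)\<^sup>2"
      by (simp only: real_choose_two diff_divide_distrib)
  qed
  then have lim2: "(\<lambda>n. (real (n choose 2) - real (m n)) / (real n)\<^sup>2) \<longlonglongrightarrow> 1 / 2"
    using lim by (rule Lim_transform_eventually[rotated])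
  then have "\<forall>\<^sub>F n in sequentially. (real (n choose 2) - real (m n)) / (real n)\<^sup>2 > 0"
    by (rule order_tendstoD) simp
  with ev_pos show ev: "\<forall>\<^sub>F n in sequentially. 0 < m n \<and> m n < n choose 2"
    by eventually_elim (auto simp: zero_less_divide_iff)
  show "(\<lambda>n. real ((n choose 2) - m n) / (real n)\<^sup>2) \<longlonglongrightarrow> 1 / 2"
    using lim2 by (rule Lim_transform_eventually) (use ev in \<open>eventually_elim, simp add: of_nat_diff\<close>)
  have "(\<lambda>n. 1 / ?v n) \<longlonglongrightarrow> 0" by real_asymp
  moreover have "(\<lambda>n. ln (?v n) / ?v n) \<longlonglongrightarrow> 0" by real_asymp
  ultimately have "(\<lambda>n. ln (real (m n) / ?v n) * (1 / ?v n) + ln (?v n) / ?v n) \<longlonglongrightarrow> ln (b / 2) * 0 + 0"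
    using b by (intro tendsto_add tendsto_mult tendsto_ln m) auto
  then have "(\<lambda>n. ln (real (m n) / ?v n) * (1 / ?v n) + ln (?v n) / ?v n) \<longlonglongrightarrow> 0" by simp
  then show "(\<lambda>n. ln (real (m n)) / ?v n) \<longlonglongrightarrow> 0"
  proof (rule Lim_transform_eventually)
    show "\<forall>\<^sub>F n in sequentially. ln (real (m n) / ?v n) * (1 / ?v n) + ln (?v n) / ?v n = ln (real (m n)) / ?v n"
      using ev eventually_gt_at_top[of 0]
    proof eventually_elim
      fix n :: nat assume "0 < m n \<and> m n < n choose 2" "n > 0"
      then have "ln (real (m n) / ?v n) = ln (real (m n)) - ln (?v n)" by (intro ln_divide_pos) auto
      then show "ln (real (m n) / ?v n) * (1 / ?v n) + ln (?v n) / ?v n = ln (real (m n)) / ?v n"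
        by (simp add: diff_divide_distrib)
    qed
  qed
qed

text \<open>At the fugacity whose typical edge count is asymptotic to \<open>m n\<close>, the graphs
  with exactly \<open>m n\<close> edges are compared with the whole partition function. Positivity
  is assumed so that logarithms of products split; the lower bound provides it.\<close>

lemma ln_density_upper:
  assumes b: "b > 0" and c_def: "c = b * exp (b\<^sup>2)" and c2: "2 * c\<^sup>2 < 1"
    and m: "(\<lambda>n. real (m n) / (real n * sqrt n)) \<longlonglongrightarrow> b / 2"
    and pos: "\<forall>\<^sub>F n in sequentially. triangle_free_density n (m n) > 0"
    and y: "- (b ^ 3) / 6 < y"
  shows "\<forall>\<^sub>F n in sequentially. ln (triangle_free_density n (m n)) / (real n * sqrt n) < y"
proof -
  let ?v = "\<lambda>n. real n * sqrt n" and ?Z = "\<lambda>n. part_fun (triangle_free_graphs n) (c / sqrt n)"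
  note as = edge_count_asymptotics[OF b m]
  define U where "U = (\<lambda>n. ln (?Z n) / ?v n
     - real (m n) / ?v n * (ln (c * (real ((n choose 2) - m n) / (real n)\<^sup>2) / (real (m n) / ?v n)) + 1)
     + 1 / ?v n + ln (real (m n)) / ?v n)"
  have c: "c > 0" using b c_def by simp
  have v0: "(\<lambda>n. 1 / ?v n) \<longlonglongrightarrow> 0" by real_asymp
  have "U \<longlonglongrightarrow> (b / 2 + b ^ 3 / 3) - b / 2 * (ln (c * (1 / 2) / (b / 2)) + 1) + 0 + 0"
    unfolding U_def using b c
    by (intro tendsto_add tendsto_diff tendsto_mult tendsto_ln tendsto_divide tendsto_const m v0
        as(2,3) ln_part_fun_tendsto c_def c2) auto
  moreover have "c * (1 / 2) / (b / 2) = exp (b\<^sup>2)" using b by (simp add: c_def)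
  \<comment> \<open>The terms \<open>b / 2\<close> cancel, and b^3/3 - b^3/2 remains.\<close>
  moreover have "(b / 2 + b ^ 3 / 3) - b / 2 * (b\<^sup>2 + 1) + 0 + 0 = - (b ^ 3) / 6"
    by (simp add: field_simps power2_eq_square power3_eq_cube)
  ultimately have "U \<longlonglongrightarrow> - (b ^ 3) / 6" by (simp only: ln_exp)
  then have "\<forall>\<^sub>F n in sequentially. U n < y" by (rule order_tendstoD) (rule y)
  then show ?thesis using as(1) pos eventually_gt_at_top[of 0]
  proof eventually_elim
    fix n :: nat
    assume U: "U n < y" and mn: "0 < m n \<and> m n < n choose 2" and \<rho>: "triangle_free_density n (m n) > 0" and n: "n > 0"
    let ?N = "n choose 2" and ?t = "c / sqrt n" and ?\<rho> = "triangle_free_density n (m n)"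
    have t: "?t > 0" using c n by simp
    have v: "?v n > 0" using n by simp
    have C: "real (?N choose m n) > 0" using mn by (simp add: zero_less_binomial_iff)
    have "?\<rho> * real (?N choose m n) * ?t ^ m n \<le> ?Z n"
      using t by (intro triangle_free_density_le_part_fun) simp
    then have "ln (?\<rho> * real (?N choose m n) * ?t ^ m n) \<le> ln (?Z n)"
      using \<rho> C t part_fun_triangle_free_pos[of ?t n] by (subst ln_le_cancel_iff) auto
    also have "ln (?\<rho> * real (?N choose m n) * ?t ^ m n) = ln ?\<rho> + ln (real (?N choose m n)) + real (m n) * ln ?t"
    proof -
      have "?t ^ m n > 0" using t by simp
      moreover have "?\<rho> * real (?N choose m n) > 0" using \<rho> C by simp
      ultimately have "ln (?\<rho> * real (?N choose m n) * ?t ^ m n) = ln (?\<rho> * real (?N choose m n)) + ln (?t ^ m n)"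
        by (simp only: ln_mult_pos)
      also have "ln (?\<rho> * real (?N choose m n)) = ln ?\<rho> + ln (real (?N choose m n))"
        using \<rho> C by (simp only: ln_mult_pos)
      also have "ln (?t ^ m n) = real (m n) * ln ?t" using t by (simp only: ln_realpow)
      finally show ?thesis .
    qed
    finally have "ln ?\<rho> \<le> ln (?Z n) - real (m n) * ln ?t - ln (real (?N choose m n))" by linarith
    moreover have "real (m n) * ln (real (?N - m n)) + real (m n) - 1 - (real (m n) + 1) * ln (real (m n)) \<le> ln (real (?N choose m n))"
      using mn by (intro ln_binomial_ge) auto
    ultimately have "ln ?\<rho> \<le> ln (?Z n) - real (m n) * (ln ?t + ln (real (?N - m n)) - ln (real (m n)) + 1) + 1 + ln (real (m n))"
      by (simp add: algebra_simps)
    also have "ln ?t + ln (real (?N - m n)) - ln (real (m n))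
        = ln (c * (real (?N - m n) / (real n)\<^sup>2) / (real (m n) / ?v n))"
    proof -
      have "real (?N - m n) > 0" "real (m n) > 0" using mn by auto
      then have "ln ?t + ln (real (?N - m n)) - ln (real (m n)) = ln (?t * real (?N - m n) / real (m n))"
        using t by (simp only: ln_mult_pos ln_divide_pos mult_pos_pos)
      also have "?t * real (?N - m n) / real (m n) = c * (real (?N - m n) / (real n)\<^sup>2) / (real (m n) / ?v n)"
      proof -
        have "c / y * p / q = c * (p / (y\<^sup>2)\<^sup>2) / (q / (y\<^sup>2 * y))" if "y > 0" "q > 0" for y p q :: real
          using that by (simp add: field_simps power2_eq_square)
        from this[of "sqrt n" "real (m n)" "real (?N - m n)"] show ?thesis using n mn by simp
      qed
      finally show ?thesis .
    qed
    finally have "ln ?\<rho> / ?v n \<le> (ln (?Z n) - real (m n) * (ln (c * (real (?N - m n) / (real n)\<^sup>2) / (real (m n) / ?v n)) + 1)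
        + 1 + ln (real (m n))) / ?v n"
      using v by (intro divide_right_mono) auto
    also have "\<dots> = U n"
      by (simp only: U_def add_divide_distrib diff_divide_distrib times_divide_eq_left)
    finally show "ln ?\<rho> / ?v n < y" using U by linarith
  qed
qed

text \<open>A margin is kept on both sides of the typical edge count. The fugacity belongs to
  \<open>b + \<eta>\<close>, so that typical graphs have more than \<open>m n\<close> edges, and
  fewer than the cutoff \<open>M n\<close>, which belongs to \<open>b + 2 * \<eta>\<close>. As
  \<open>y\<close> lies strictly below the limit, a small \<open>\<eta>\<close> loses
  nothing.\<close>

lemma ln_density_lower:
  assumes b: "b > 0" and c2: "2 * (b * exp (b\<^sup>2))\<^sup>2 < 1"
    and m: "(\<lambda>n. real (m n) / (real n * sqrt n)) \<longlonglongrightarrow> b / 2"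
    and y: "y < - (b ^ 3) / 6"
  shows "\<forall>\<^sub>F n in sequentially. triangle_free_density n (m n) > 0 \<and>
    y < ln (triangle_free_density n (m n)) / (real n * sqrt n)"
proof -
  let ?v = "\<lambda>n. real n * sqrt n"
  define c where "c = (\<lambda>x::real. x * exp (x\<^sup>2))"
  \<comment> \<open>The limiting exponent supplied by \<open>part_fun_le_density\<close>, with
    \<open>\<tau>\<close> chosen so that
    \<open>\<tau> * c (b + \<eta>) = b + 2 * \<eta>\<close>.\<close>
  define G where "G = (\<lambda>\<eta>. (b + \<eta>) / 2 + (b + \<eta>) ^ 3 / 3 + (b + 2 * \<eta>) / 2 * ln ((b + 2 * \<eta>) / c (b + \<eta>))
     - (b + 2 * \<eta>) / 2)"
  have c_pos: "c x > 0" if "x > 0" for x using that by (simp add: c_def)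
  have c_less: "c x < c z" if "0 < x" "x < z" for x z
    using that power_strict_mono[of x z 2] unfolding c_def by (intro mult_strict_mono) auto
  \<comment> \<open>All conditions but \<open>\<eta> > 0\<close> hold strictly at
    \<open>\<eta> = 0\<close> and persist by continuity. The last one, there
    \<open>b < b * exp (b\<^sup>2)\<close>, ensures \<open>\<tau> \<le> 1\<close>.\<close>
  obtain \<eta> where \<eta>: "\<eta> > 0" "y < G \<eta>" "2 * (c (b + 2 * \<eta>))\<^sup>2 < 1" "b + 2 * \<eta> < c (b + \<eta>)"
  proof -
    have "(G \<longlongrightarrow> (b + 0) / 2 + (b + 0) ^ 3 / 3 + (b + 2 * 0) / 2 * ln ((b + 2 * 0) / c (b + 0)) - (b + 2 * 0) / 2) (at_right 0)"
      unfolding G_def c_def using b by (intro tendsto_intros) auto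
    moreover have "ln (b / c b) = - b\<^sup>2"
      using b by (simp add: c_def ln_div ln_mult_pos)
    ultimately have "(G \<longlongrightarrow> b / 2 + b ^ 3 / 3 + b / 2 * (- b\<^sup>2) - b / 2) (at_right 0)" by simp
    moreover have "b / 2 + b ^ 3 / 3 + b / 2 * (- b\<^sup>2) - b / 2 = - (b ^ 3) / 6"
      by (simp add: field_simps power2_eq_square power3_eq_cube)
    ultimately have "(G \<longlongrightarrow> - (b ^ 3) / 6) (at_right 0)" by simp
    then have 1: "\<forall>\<^sub>F \<eta> in at_right 0. y < G \<eta>" by (rule order_tendstoD) (rule y)
    have "((\<lambda>\<eta>. 2 * (c (b + 2 * \<eta>))\<^sup>2) \<longlongrightarrow> 2 * (c (b + 2 * 0))\<^sup>2) (at_right 0)"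
      unfolding c_def by (intro tendsto_intros)
    then have 2: "\<forall>\<^sub>F \<eta> in at_right 0. 2 * (c (b + 2 * \<eta>))\<^sup>2 < 1"
      by (rule order_tendstoD) (use c2 in \<open>simp add: c_def\<close>)
    have "((\<lambda>\<eta>. c (b + \<eta>) - (b + 2 * \<eta>)) \<longlongrightarrow> c (b + 0) - (b + 2 * 0)) (at_right 0)"
      unfolding c_def by (intro tendsto_intros)
    moreover have "c (b + 0) - (b + 2 * 0) > 0" using b by (simp add: c_def)
    ultimately have 3: "\<forall>\<^sub>F \<eta> in at_right 0. c (b + \<eta>) - (b + 2 * \<eta>) > 0"
      by (rule order_tendstoD)
    have "\<forall>\<^sub>F \<eta> in at_right 0. y < G \<eta> \<and> 2 * (c (b + 2 * \<eta>))\<^sup>2 < 1 \<and> c (b + \<eta>) - (b + 2 * \<eta>) > 0 \<and> \<eta> > 0"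
      by (intro eventually_conj 1 2 3 eventually_at_right_less)
    then obtain \<eta> where "y < G \<eta> \<and> 2 * (c (b + 2 * \<eta>))\<^sup>2 < 1 \<and> c (b + \<eta>) - (b + 2 * \<eta>) > 0 \<and> \<eta> > 0"
      using eventually_happens[of _ "at_right (0::real)"] by auto
    then show thesis by (intro that[of \<eta>]) auto
  qed
  define \<beta> where "\<beta> = b + \<eta>"
  define \<beta>' where "\<beta>' = b + 2 * \<eta>"
  define M where "M = (\<lambda>n. \<beta>' / 2 * ?v n)"
  \<comment> \<open>The minimiser of the exponent in \<open>part_fun_le_density\<close>, up to lower
    order: it equates \<open>\<tau> * t * (n choose 2)\<close> with \<open>M n\<close>.\<close>
  define \<tau> where "\<tau> = \<beta>' / c \<beta>"
  have \<beta>: "\<beta> > 0" "\<beta>' > 0" using b \<eta> by (auto simp: \<beta>_def \<beta>'_def)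
  have \<tau>: "0 < \<tau>" "\<tau> \<le> 1" using \<beta> \<eta> c_pos[OF \<beta>(1)] by (auto simp: \<tau>_def \<beta>_def \<beta>'_def)
  have small: "2 * (c x)\<^sup>2 < 1" if "0 < x" "x \<le> b + 2 * \<eta>" for x
  proof -
    have "c x \<le> c (b + 2 * \<eta>)" using c_less[of x "b + 2 * \<eta>"] that by (cases "x = b + 2 * \<eta>") auto
    then have "(c x)\<^sup>2 \<le> (c (b + 2 * \<eta>))\<^sup>2" using c_pos[OF that(1)] by (intro power_mono) auto
    then show ?thesis using \<eta>(3) by linarith
  qed
  \<comment> \<open>Targets of the tilting, halfway from \<open>\<beta>\<close> to \<open>b\<close>
    and from \<open>\<beta>\<close> to \<open>\<beta>'\<close>, as the sign condition of
    \<open>edges_tail_tendsto\<close> demands.\<close>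
  let ?lo = "b + \<eta> / 2" and ?hi = "b + 3 * \<eta> / 2"
  have "(\<lambda>n. gibbs_prob n (c \<beta> / sqrt n) (\<lambda>E. ln (c ?lo / c \<beta>) * (real (card E) - real (m n)) \<ge> 0)) \<longlonglongrightarrow> 0"
  proof (rule edges_tail_tendsto[where \<alpha> = ?lo and \<beta> = \<beta>, OF _ _ _ _ _ m])
    have "c ?lo < c \<beta>" using b \<eta> by (intro c_less) (auto simp: \<beta>_def)
    then have "ln (c ?lo / c \<beta>) < 0" using c_pos[of ?lo] c_pos[OF \<beta>(1)] b \<eta> by simp
    then show "ln (c ?lo / c \<beta>) * (?lo - b) < 0" using \<eta> by (intro mult_neg_pos) auto
  qed (use b \<eta> \<beta> small[of ?lo] in \<open>simp_all add: c_def\<close>)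
  then have low: "\<forall>\<^sub>F n in sequentially. gibbs_prob n (c \<beta> / sqrt n) (\<lambda>E. ln (c ?lo / c \<beta>) * (real (card E) - real (m n)) \<ge> 0) < 1 / 4"
    by (rule order_tendstoD) simp
  have "(\<lambda>n. gibbs_prob n (c \<beta> / sqrt n) (\<lambda>E. ln (c ?hi / c \<beta>) * (real (card E) - M n) \<ge> 0)) \<longlonglongrightarrow> 0"
  proof (rule edges_tail_tendsto[where \<alpha> = ?hi and \<beta> = \<beta>])
    show "(\<lambda>n. M n / ?v n) \<longlonglongrightarrow> \<beta>' / 2"
    proof (rule Lim_transform_eventually[OF tendsto_const])
      show "\<forall>\<^sub>F n in sequentially. \<beta>' / 2 = M n / ?v n"
        using eventually_gt_at_top[of 0] by eventually_elim (simp add: M_def)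
    qed
    have "c \<beta> < c ?hi" using b \<eta> by (intro c_less) (auto simp: \<beta>_def)
    then have "ln (c ?hi / c \<beta>) > 0" using c_pos[OF \<beta>(1)] by simp
    then show "ln (c ?hi / c \<beta>) * (?hi - \<beta>') < 0" using \<eta> by (intro mult_pos_neg) (auto simp: \<beta>'_def)
  qed (use b \<eta> \<beta> small[of ?hi] in \<open>simp_all add: c_def\<close>)
  then have up: "\<forall>\<^sub>F n in sequentially. gibbs_prob n (c \<beta> / sqrt n) (\<lambda>E. ln (c ?hi / c \<beta>) * (real (card E) - M n) \<ge> 0) < 1 / 4"
    by (rule order_tendstoD) simp
  define Lo where "Lo = (\<lambda>n. ln (part_fun (triangle_free_graphs n) (c \<beta> / sqrt n)) / ?v n - ln 2 * (1 / ?v n)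
     + \<beta>' / 2 * ln \<tau> - \<tau> * c \<beta> * (real n * (real n - 1) / 2 / (real n)\<^sup>2))"
  have lim1: "(\<lambda>n. real n * (real n - 1) / 2 / (real n)\<^sup>2) \<longlonglongrightarrow> 1 / 2"
    and lim2: "(\<lambda>n. 1 / ?v n) \<longlonglongrightarrow> 0" by real_asymp+
  have lim3: "(\<lambda>n. ln (part_fun (triangle_free_graphs n) (c \<beta> / sqrt n)) / ?v n) \<longlonglongrightarrow> \<beta> / 2 + \<beta> ^ 3 / 3"
    by (rule ln_part_fun_tendsto[OF \<beta>(1)]) (use small[of \<beta>] \<beta> \<eta> in \<open>auto simp: c_def \<beta>_def\<close>)
  have "Lo \<longlonglongrightarrow> (\<beta> / 2 + \<beta> ^ 3 / 3) - ln 2 * 0 + \<beta>' / 2 * ln \<tau> - \<tau> * c \<beta> * (1 / 2)"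
    unfolding Lo_def by (intro lim1 lim2 lim3 tendsto_add tendsto_diff tendsto_mult tendsto_const)
  moreover have "(\<beta> / 2 + \<beta> ^ 3 / 3) - ln 2 * 0 + \<beta>' / 2 * ln \<tau> - \<tau> * c \<beta> * (1 / 2) = G \<eta>"
    using c_pos[OF \<beta>(1)] by (simp add: G_def \<tau>_def \<beta>_def \<beta>'_def)
  ultimately have "\<forall>\<^sub>F n in sequentially. y < Lo n"
    using \<eta>(2) by (metis order_tendstoD(1))
  then show ?thesis using low up eventually_gt_at_top[of 0]
  proof eventually_elim
    fix n :: nat
    assume Lo: "y < Lo n" and n: "n > 0"
      and low: "gibbs_prob n (c \<beta> / sqrt n) (\<lambda>E. ln (c ?lo / c \<beta>) * (real (card E) - real (m n)) \<ge> 0) < 1 / 4"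
      and up: "gibbs_prob n (c \<beta> / sqrt n) (\<lambda>E. ln (c ?hi / c \<beta>) * (real (card E) - M n) \<ge> 0) < 1 / 4"
    let ?t = "c \<beta> / sqrt n" and ?Z = "part_fun (triangle_free_graphs n) (c \<beta> / sqrt n)"
      and ?\<rho> = "triangle_free_density n (m n)"
    have t: "?t > 0" using c_pos[OF \<beta>(1)] n by simp
    have v: "?v n > 0" using n by simp
    have Z: "?Z > 0" using t by (simp add: part_fun_triangle_free_pos)
    have "gibbs_prob n ?t (\<lambda>E. card E < m n) \<le> gibbs_prob n ?t (\<lambda>E. ln (c ?lo / c \<beta>) * (real (card E) - real (m n)) \<ge> 0)"
    proof (rule gibbs_prob_mono)
      have "c ?lo \<le> c \<beta>" using b \<eta> by (intro less_imp_le c_less) (auto simp: \<beta>_def)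
      then have "ln (c ?lo / c \<beta>) \<le> 0" using c_pos[of ?lo] c_pos[OF \<beta>(1)] b \<eta> by simp
      then show "ln (c ?lo / c \<beta>) * (real (card E) - real (m n)) \<ge> 0" if "card E < m n" for E :: "nat set set"
        using that by (intro mult_nonpos_nonpos) auto
    qed (use t in simp)
    with low have low': "gibbs_prob n ?t (\<lambda>E. card E < m n) \<le> 1 / 4" by linarith
    have "gibbs_prob n ?t (\<lambda>E. M n < real (card E)) \<le> gibbs_prob n ?t (\<lambda>E. ln (c ?hi / c \<beta>) * (real (card E) - M n) \<ge> 0)"
    proof (rule gibbs_prob_mono)
      have "c \<beta> < c ?hi" using b \<eta> by (intro c_less) (auto simp: \<beta>_def)
      then have "ln (c ?hi / c \<beta>) > 0" using c_pos[OF \<beta>(1)] by simp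
      then show "ln (c ?hi / c \<beta>) * (real (card E) - M n) \<ge> 0" if "M n < real (card E)" for E :: "nat set set"
        using that by (intro mult_nonneg_nonneg) auto
    qed (use t in simp)
    with up have up': "gibbs_prob n ?t (\<lambda>E. M n < real (card E)) \<le> 1 / 4" by linarith
    let ?X = "\<tau> * ?t * real (n choose 2) - M n * ln \<tau>"
    have le: "?Z / 2 \<le> ?\<rho> * exp ?X"
      by (rule part_fun_le_density[OF t \<tau> low' up'])
    have \<rho>: "?\<rho> > 0"
    proof (rule ccontr)
      assume "\<not> ?\<rho> > 0"
      then have "?\<rho> * exp ?X \<le> 0" by (simp add: mult_nonpos_nonneg)
      then show False using le Z by linarith
    qed
    have "ln (?Z / 2) \<le> ln (?\<rho> * exp ?X)"
      using le Z \<rho> by (subst ln_le_cancel_iff) auto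
    then have "ln ?Z - ln 2 \<le> ln ?\<rho> + ?X"
      using Z \<rho> by (simp add: ln_mult_pos ln_divide_pos)
    then have "ln ?Z - ln 2 + M n * ln \<tau> - \<tau> * ?t * real (n choose 2) \<le> ln ?\<rho>" by linarith
    then have "(ln ?Z - ln 2 + M n * ln \<tau> - \<tau> * ?t * real (n choose 2)) / ?v n \<le> ln ?\<rho> / ?v n"
      using v by (intro divide_right_mono) auto
    also have "(ln ?Z - ln 2 + M n * ln \<tau> - \<tau> * ?t * real (n choose 2)) / ?v n = Lo n"
    proof -
      have "(M n * ln \<tau>) / ?v n = \<beta>' / 2 * ln \<tau>" using n by (simp add: M_def)
      moreover have "(\<tau> * ?t * real (n choose 2)) / ?v n = \<tau> * c \<beta> * (real n * (real n - 1) / 2 / (real n)\<^sup>2)"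
      proof -
        have "(\<tau> * (z / w) * p) / (w\<^sup>2 * w) = \<tau> * z * (p / (w\<^sup>2)\<^sup>2)" if "w > 0" for w z p :: real
          using that by (simp add: field_simps power2_eq_square)
        from this[of "sqrt n" "c \<beta>" "real (n choose 2)"] show ?thesis
          using n by (simp add: real_choose_two)
      qed
      ultimately show ?thesis
        by (simp add: Lo_def add_divide_distrib diff_divide_distrib)
    qed
    finally show "?\<rho> > 0 \<and> y < ln ?\<rho> / ?v n" using Lo \<rho> by linarith
  qed
qed

text \<open>With \<open>?f x = x * exp x\<close>, the quantity \<open>2 * c\<^sup>2\<close> for
  \<open>c = b * exp (b\<^sup>2)\<close> is \<open>?f (2 * b\<^sup>2)\<close>. The hypothesis
  compares \<open>2 * b\<^sup>2\<close> with the point where \<open>?f\<close> equals 2/e.\<close>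

lemma Lambert_W_bound:
  assumes b: "b > 0" and W: "b\<^sup>2 < 1 / 2 * Lambert_W (2 / exp 1)"
  shows "2 * (b * exp (b\<^sup>2))\<^sup>2 < 1"
proof -
  let ?f = "\<lambda>x::real. x * exp x"
  have mono: "?f x < ?f y" if "0 \<le> x" "x < y" for x y
    using that by (intro mult_strict_mono') auto
  have inj: "inj_on ?f {0..}"
  proof (rule inj_onI)
    fix x y :: real assume "x \<in> {0..}" "y \<in> {0..}" "?f x = ?f y"
    then show "x = y" using mono[of x y] mono[of y x] by (cases x y rule: linorder_cases) auto
  qed
  have e: "exp 1 \<ge> (2::real)" using exp_ge_add_one_self[of "1::real"] by simp
  \<comment> \<open>The inverse \<open>the_inv_into\<close> is specified only on the range of
    \<open>?f\<close>, so 2/e must be exhibited as a value; it lies between \<open>?f 0\<close> and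
    \<open>?f 1\<close>.\<close>
  have "\<exists>x. 0 \<le> x \<and> x \<le> 1 \<and> ?f x = 2 / exp 1"
  proof (rule IVT')
    have "2 / exp 1 \<le> (1::real)" using e by simp
    also have "\<dots> \<le> ?f 1" using e by simp
    finally show "2 / exp 1 \<le> ?f 1" .
    show "continuous_on {0..1} ?f" by (intro continuous_intros)
  qed auto
  then have img: "2 / exp 1 \<in> ?f ` {0..}" by force
  define w where "w = Lambert_W (2 / exp 1)"
  have w: "?f w = 2 / exp 1"
    unfolding w_def Lambert_W_def by (rule f_the_inv_into_f[OF inj img])
  have "2 * (b * exp (b\<^sup>2))\<^sup>2 = ?f (2 * b\<^sup>2)"
    by (simp add: power_mult_distrib exp_double)
  also have "\<dots> < ?f w" using W by (intro mono) (auto simp: w_def)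
  also have "\<dots> \<le> 1" using e w by simp
  finally show ?thesis .
qed

theorem corollary1p9:
  fixes b :: real and m :: "nat \<Rightarrow> nat"
  assumes "b > 0"
    and "b\<^sup>2 < 1 / 2 * Lambert_W (2 / exp 1)"
    and "(\<lambda>n. real (m n)) \<sim>[at_top] (\<lambda>n. b / 2 * real n powr (3 / 2))"
  shows "((\<lambda>n. 1 / real n powr (3 / 2) *
            ln (measure_pmf.prob (Gnm n (m n)) {E. num_triangles n E = 0}))
          \<longlonglongrightarrow> - (b ^ 3) / 6) \<and>
         (\<exists>err :: nat \<Rightarrow> real. err \<in> o[at_top](\<lambda>n. real n powr (3 / 2)) \<and>
           (\<forall>\<^sub>F n in at_top. real (num_triangle_free n (m n)) =
              real ((n choose 2) choose m n) *
                exp (- (4 / 3) * (real (m n) / real n) ^ 3 + err n)))"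
proof -
  let ?v = "\<lambda>n. real n * sqrt n" and ?\<rho> = "\<lambda>n. triangle_free_density n (m n)"
  have powr: "real n powr (3 / 2) = ?v n" for n
  proof (cases "n = 0")
    case False
    have "real n powr (3 / 2) = real n powr (1 + 1 / 2)" by simp
    also have "\<dots> = real n powr 1 * real n powr (1 / 2)" by (rule powr_add)
    finally show ?thesis using False by (simp add: powr_half_sqrt)
  qed simp
  have c2: "2 * (b * exp (b\<^sup>2))\<^sup>2 < 1" by (rule Lambert_W_bound[OF assms(1,2)])
  have "\<forall>\<^sub>F n in sequentially. real (m n) \<noteq> 0 \<or> b / 2 * real n powr (3 / 2) \<noteq> 0"
    using eventually_gt_at_top[of 0] by eventually_elim (use assms(1) in \<open>simp add: powr\<close>)
  from asymp_equivD_strong[OF assms(3) this]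
  have "(\<lambda>n. real (m n) / (b / 2 * ?v n)) \<longlonglongrightarrow> 1" by (simp only: powr)
  from tendsto_mult[OF this tendsto_const[of "b / 2"]]
  have m: "(\<lambda>n. real (m n) / ?v n) \<longlonglongrightarrow> b / 2"
    using assms(1) by simp
  \<comment> \<open>Any threshold below the limit serves here. Positivity feeds the upper bound and
    later allows the density to be written as the exponential of its logarithm.\<close>
  have pos: "\<forall>\<^sub>F n in sequentially. ?\<rho> n > 0"
    using ln_density_lower[OF assms(1) c2 m, of "- (b ^ 3) / 6 - 1"] by (auto elim: eventually_mono)
  have lim: "(\<lambda>n. ln (?\<rho> n) / ?v n) \<longlonglongrightarrow> - (b ^ 3) / 6"
  proof (rule order_tendstoI)
    fix y assume "y < - (b ^ 3) / 6"
    from ln_density_lower[OF assms(1) c2 m this]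
    show "\<forall>\<^sub>F n in sequentially. y < ln (?\<rho> n) / ?v n" by (auto elim: eventually_mono)
  next
    fix y assume "- (b ^ 3) / 6 < y"
    from ln_density_upper[OF assms(1) refl c2 m pos this]
    show "\<forall>\<^sub>F n in sequentially. ln (?\<rho> n) / ?v n < y" .
  qed
  \<comment> \<open>Only in this range is \<open>Gnm\<close> the uniform distribution on a nonempty
    set.\<close>
  have le: "\<forall>\<^sub>F n in sequentially. m n \<le> n choose 2"
    using edge_count_asymptotics(1)[OF assms(1) m] by (auto elim: eventually_mono)
  \<comment> \<open>Defined so that the second formula is exact whenever the density is positive. On
    the scale n^(3/2) its limit is -b^3/6 + (4/3)(b/2)^3 = 0.\<close>
  define err where "err = (\<lambda>n. ln (?\<rho> n) + 4 / 3 * (real (m n) / real n) ^ 3)"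
  have "(\<lambda>n. 1 / real n powr (3 / 2) * ln (measure_pmf.prob (Gnm n (m n)) {E. num_triangles n E = 0}))
          \<longlonglongrightarrow> - (b ^ 3) / 6"
    using lim
  proof (rule Lim_transform_eventually)
    show "\<forall>\<^sub>F n in sequentially. ln (?\<rho> n) / ?v n =
        1 / real n powr (3 / 2) * ln (measure_pmf.prob (Gnm n (m n)) {E. num_triangles n E = 0})"
      using le by eventually_elim (simp add: powr prob_triangle_free)
  qed
  moreover have "err \<in> o[at_top](\<lambda>n. real n powr (3 / 2))"
  proof (rule smalloI_tendsto)
    have "(\<lambda>n. ln (?\<rho> n) / ?v n + 4 / 3 * (real (m n) / ?v n) ^ 3) \<longlonglongrightarrow> - (b ^ 3) / 6 + 4 / 3 * (b / 2) ^ 3"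
      by (intro tendsto_intros lim m)
    then have "(\<lambda>n. ln (?\<rho> n) / ?v n + 4 / 3 * (real (m n) / ?v n) ^ 3) \<longlonglongrightarrow> 0"
      by (simp add: power_divide)
    then show "(\<lambda>n. err n / real n powr (3 / 2)) \<longlonglongrightarrow> 0"
    proof (rule Lim_transform_eventually)
      show "\<forall>\<^sub>F n in sequentially. ln (?\<rho> n) / ?v n + 4 / 3 * (real (m n) / ?v n) ^ 3 = err n / real n powr (3 / 2)"
        using eventually_gt_at_top[of 0]
      proof eventually_elim
        fix n :: nat assume n: "n > 0"
        have "(k / (y\<^sup>2 * y)) ^ 3 = (k / y\<^sup>2) ^ 3 / (y\<^sup>2 * y)" if "y > 0" for k y :: real
          using that by (simp add: field_simps power2_eq_square power3_eq_cube)
        from this[of "sqrt n" "real (m n)"]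
        have "(real (m n) / ?v n) ^ 3 = (real (m n) / real n) ^ 3 / ?v n" using n by simp
        then show "ln (?\<rho> n) / ?v n + 4 / 3 * (real (m n) / ?v n) ^ 3 = err n / real n powr (3 / 2)"
          by (simp add: err_def powr add_divide_distrib)
      qed
    qed
    show "\<forall>\<^sub>F n in sequentially. real n powr (3 / 2) \<noteq> 0"
      using eventually_gt_at_top[of 0] by eventually_elim (simp add: powr)
  qed
  moreover have "\<forall>\<^sub>F n in at_top. real (num_triangle_free n (m n)) =
      real ((n choose 2) choose m n) * exp (- (4 / 3) * (real (m n) / real n) ^ 3 + err n)"
    using pos by eventually_elim (simp add: err_def num_triangle_free_eq_density)
  ultimately show ?thesis by blast
qed

end
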